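(* Let $f:[0,1]^2\to\mathbb{R}$ equal $f_1$ on $\Omega_1$ and $f_2$ on $\Omega_2=[0,1]^2\setminus\Omega_1$, where $\Omega_1,\Omega_2$ are separated by a curve $\Gamma$, where $f_1,f_2$ have $C^4$ extensions to $[-\varepsilon,1+\varepsilon]^2$ for some $\varepsilon>0$, and where $|f_1-f_2|\ge\delta>0$ on $\Gamma$. Assume $\Gamma$ is a $C^4$ smooth curve in $[0,1]^2$ with minimal curvature radius $>R$ (for some $R>0$), whose $R$-neighborhood is not self-intersecting and does not intersect the boundary of $[0,1]^2$. For $h=1/N$, let $\tilde\Gamma$ be the zero level curve of the bicubic spline $S_3$ constructed from the cell-averages of $f$ as described in the context, using a mesh of $n\times n$ points with $n$ of exact order $h^{-3/4}$ and a cubic quasi-interpolation operator. Then, as $h\to0$, $$\mathrm{dist}(\Gamma,\tilde\Gamma)=O(h^3).$$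
   Context: Cell-averages. For $h=1/N$ and $1\le i,j\le N$, the cells are $c_{i,j}=[(i-1)h,ih]\times[(j-1)h,jh]$ and $\bar f_{i,j}=h^{-2}\iint_{c_{i,j}}f\,dx\,dy$. Local quadratic approximation of $\Gamma$. After a change of coordinates (translation by grid steps and, if needed, exchange or reflection of the axes), a section of $\Gamma$ lies in the window $[h,4h]\times[h,9h]$ as a graph passing between $y=3h$ and $y=7h$. Take $f_1$ below $\Gamma$ and $f_2$ above it. - $L_1$ is the linear polynomial $\alpha_1x+\beta_1y+\gamma_1$ whose cell-averages on $c_{3,2},c_{3,3},c_{4,3}$ equal $\bar f_{3,2},\bar f_{3,3},\bar f_{4,3}$. - $L_2$ is the linear polynomial $\alpha_2x+\beta_2y+\gamma_2$ whose cell-averages on $c_{3,9},c_{3,8},c_{4,8}$ equal $\bar f_{3,9},\bar f_{3,8},\bar f_{4,8}$. - With $q(x)=ax^2+bx+ch$, the parameters $(a,b,c)$ solve $Q_i(a,b,c)=\bar f_{i,4}+\bar f_{i,5}+\bar f_{i,6}+\bar f_{i,7}$ for $i=2,3,4$, where $$Q_i(a,b,c)=h^{-2}\Big(\int_{(i-1)h}^{ih}\int_{3h}^{q(x)}(L_1-L_2)\,dy\,dx+\int_{(i-1)h}^{ih}\int_{3h}^{7h}L_2\,dy\,dx\Big).$$ The solution taken is the limit of Newton's iteration started at the coefficients of a quadratic $\tilde q(x)=\tilde ax^2+\tilde bx+\tilde ch$ that approximates $\Gamma$ in the window to order $O(h^3)$. The local approximation is the graph of $q$ on $[2h,3h]$.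 Global construction. (1) Let $G$ be the union of all the local quadratic approximation curves to the different sections of $\Gamma$ (for windows covering all of $\Gamma$). (2) Overlay on $[0,1]^2$ a mesh $Q$ of $n\times n$ points, of mesh size $d$. (3) Divide $Q$ into two sets $Q_1,Q_2$ separated by $G$. (4) Attach the value $\mathrm{dist}(p,G)$ to each $p\in Q_1$ and the value $-\mathrm{dist}(p,G)$ to each $p\in Q_2$. (5) Let $S_3$ be the bicubic spline on $[0,1]^2$ with uniform mesh size $d$ obtained by applying to these values a local bicubic quasi-interpolation operator $A$ (a linear operator from values on $Q$ to bicubic splines, of approximation order $4$ on $C^4$ functions, with $\|A\|_\infty<\beta$ for a constant $\beta$ independent of $d$). (6) $\tilde\Gamma$ is the zero level curve of $S_3$. Here $\mathrm{dist}(\Gamma,\tilde\Gamma)$ is the Hausdorff distance between the curves, and the constant in $O(h^3)$ is independent of $h$. *)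

theory Defs
  imports "HOL-Analysis.Analysis"
begin

type_synonym plane = "real \<times> real"

abbreviation unit_square :: "plane set" where
  "unit_square \<equiv> {0..1} \<times> {0..1}"

text \<open>Continuous differentiability of order \<open>k\<close> on a set, through all iterated directional
  derivatives along the basis. On closed squares the derivatives are one-sided at the boundary.\<close>

primrec Ck_on :: "nat \<Rightarrow> 'a::euclidean_space set \<Rightarrow> ('a \<Rightarrow> 'b::real_normed_vector) \<Rightarrow> bool" where
  "Ck_on 0 S f \<longleftrightarrow> continuous_on S f"
| "Ck_on (Suc k) S f \<longleftrightarrow>
     (\<exists>D. (\<forall>x\<in>S. (f has_derivative D x) (at x within S)) \<and> (\<forall>v\<in>Basis. Ck_on k S (\<lambda>x. D x v)))"

text \<open>Extended-real valued, so that the distance between a nonempty and an empty set is infinite.\<close>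

definition hausdorff_dist :: "'a::metric_space set \<Rightarrow> 'a set \<Rightarrow> ennreal" where
  "hausdorff_dist X Y =
     max (SUP x\<in>X. INF y\<in>Y. ennreal (dist x y)) (SUP y\<in>Y. INF x\<in>X. ennreal (dist x y))"


section \<open>The interface curve\<close>

abbreviation velocity :: "(real \<Rightarrow> plane) \<Rightarrow> real \<Rightarrow> plane" where
  "velocity \<gamma> \<equiv> \<lambda>s. vector_derivative \<gamma> (at s)"

definition unit_normal :: "(real \<Rightarrow> plane) \<Rightarrow> real \<Rightarrow> plane" where
  "unit_normal \<gamma> s = (- snd (velocity \<gamma> s), fst (velocity \<gamma> s))"

definition curvature :: "(real \<Rightarrow> plane) \<Rightarrow> real \<Rightarrow> real" where
  "curvature \<gamma> s = norm (vector_derivative (velocity \<gamma>) (at s))"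

text \<open>A closed \<open>C\<^sup>4\<close> curve of length \<open>len\<close>, parametrized by arc length and extended periodically.
  The curvature radius is the reciprocal of the curvature, and is infinite where the latter
  vanishes. The open \<open>R\<close>-neighbourhood does not intersect itself when the normal segments of
  half-length \<open>R\<close> are pairwise disjoint; in particular the curve is simple.\<close>

definition C4_closed_curve :: "real \<Rightarrow> (real \<Rightarrow> plane) \<Rightarrow> bool" where
  "C4_closed_curve len \<gamma> \<longleftrightarrow>
     len > 0 \<and> Ck_on 4 UNIV \<gamma> \<and> (\<forall>s. \<gamma> (s + len) = \<gamma> s) \<and> (\<forall>s. norm (velocity \<gamma> s) = 1)"

definition curvature_radius_gt :: "real \<Rightarrow> (real \<Rightarrow> plane) \<Rightarrow> bool" where
  "curvature_radius_gt R \<gamma> \<longleftrightarrow> (\<forall>s. curvature \<gamma> s \<noteq> 0 \<longrightarrow> 1 / curvature \<gamma> s > R)"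

definition embedded_tube :: "real \<Rightarrow> real \<Rightarrow> (real \<Rightarrow> plane) \<Rightarrow> bool" where
  "embedded_tube R len \<gamma> \<longleftrightarrow>
     inj_on (\<lambda>(s, t). \<gamma> s + t *\<^sub>R unit_normal \<gamma> s) ({0..<len} \<times> {-R<..<R})"


section \<open>Cell averages and local quadratic approximation\<close>

definition cell_avg :: "real \<Rightarrow> (plane \<Rightarrow> real) \<Rightarrow> nat \<Rightarrow> nat \<Rightarrow> real" where
  "cell_avg h f i j =
     1 / h^2 * integral ({(real i - 1) * h..real i * h} \<times> {(real j - 1) * h..real j * h}) f"

text \<open>A window is given by the map \<open>T\<close> from its local coordinates to those of the unit square: a
  translation by grid steps, composed with reflections and possibly with the exchange of the axes.
  Such a \<open>T\<close> permutes the cells of the grid, so the cell averages of \<open>f \<circ> T\<close> in the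
  window are among those of \<open>f\<close>.\<close>

definition grid_change :: "real \<Rightarrow> (plane \<Rightarrow> plane) \<Rightarrow> bool" where
  "grid_change h T \<longleftrightarrow>
     (\<exists>s\<in>{-1, 1}. \<exists>t\<in>{-1, 1}. \<exists>k l :: int.
        T = (\<lambda>(x, y). (s * x + of_int k * h, t * y + of_int l * h)) \<or>
        T = (\<lambda>(x, y). (s * y + of_int k * h, t * x + of_int l * h)))"

text \<open>In the window \<open>T\<close> the section of \<open>\<Gamma>\<close> is the graph of \<open>g\<close>, with \<open>\<Omega>1\<close> below and \<open>\<Omega>2\<close> above.\<close>

definition window_section ::
    "real \<Rightarrow> plane set \<Rightarrow> plane set \<Rightarrow> plane set \<Rightarrow> (plane \<Rightarrow> plane) \<Rightarrow> (real \<Rightarrow> real) \<Rightarrow> bool" where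
  "window_section h \<Gamma> \<Omega>1 \<Omega>2 T g \<longleftrightarrow>
     grid_change h T \<and>
     T ` ({h..4*h} \<times> {h..9*h}) \<subseteq> unit_square \<and>
     (\<forall>x\<in>{h..4*h}. 3*h \<le> g x \<and> g x \<le> 7*h) \<and>
     {p \<in> {h..4*h} \<times> {h..9*h}. T p \<in> \<Gamma>} = (\<lambda>x. (x, g x)) ` {h..4*h} \<and>
     (\<forall>x\<in>{h..4*h}. \<forall>y\<in>{h..9*h}.
        (y < g x \<longrightarrow> T (x, y) \<in> \<Omega>1) \<and> (g x < y \<longrightarrow> T (x, y) \<in> \<Omega>2))"

text \<open>In the following definitions \<open>f\<close> is the target function in window coordinates.\<close>

definition linear_fit :: "real \<Rightarrow> (plane \<Rightarrow> real) \<Rightarrow> (nat \<times> nat) set \<Rightarrow> plane \<Rightarrow> real" where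
  "linear_fit h f I =
     (THE L. (\<exists>\<alpha> \<beta> \<gamma>. L = (\<lambda>(x, y). \<alpha> * x + \<beta> * y + \<gamma>)) \<and>
             (\<forall>(i, j)\<in>I. cell_avg h L i j = cell_avg h f i j))"

definition L\<^sub>1 :: "real \<Rightarrow> (plane \<Rightarrow> real) \<Rightarrow> plane \<Rightarrow> real" where
  "L\<^sub>1 h f = linear_fit h f {(3, 2), (3, 3), (4, 3)}"

definition L\<^sub>2 :: "real \<Rightarrow> (plane \<Rightarrow> real) \<Rightarrow> plane \<Rightarrow> real" where
  "L\<^sub>2 h f = linear_fit h f {(3, 9), (3, 8), (4, 8)}"

type_synonym coeffs = "real \<times> real \<times> real"

definition quad :: "real \<Rightarrow> coeffs \<Rightarrow> real \<Rightarrow> real" where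
  "quad h = (\<lambda>(a, b, c) x. a * x^2 + b * x + c * h)"

text \<open>The interval integrals are oriented, as needed when a Newton iterate drops below \<open>3h\<close>.\<close>

definition column_integral :: "real \<Rightarrow> (plane \<Rightarrow> real) \<Rightarrow> nat \<Rightarrow> coeffs \<Rightarrow> real" where
  "column_integral h f i u =
     1 / h^2 *
       ((LBINT x=ereal ((real i - 1) * h)..ereal (real i * h).
           (LBINT y=ereal (3 * h)..ereal (quad h u x). L\<^sub>1 h f (x, y) - L\<^sub>2 h f (x, y))) +
        (LBINT x=ereal ((real i - 1) * h)..ereal (real i * h).
           (LBINT y=ereal (3 * h)..ereal (7 * h). L\<^sub>2 h f (x, y))))"

definition residual :: "real \<Rightarrow> (plane \<Rightarrow> real) \<Rightarrow> coeffs \<Rightarrow> real \<times> real \<times> real" where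
  "residual h f u =
     (let r = (\<lambda>i. column_integral h f i u - (\<Sum>j=4..7. cell_avg h f i j)) in (r 2, r 3, r 4))"

definition newton_step :: "('a::euclidean_space \<Rightarrow> 'a) \<Rightarrow> 'a \<Rightarrow> 'a" where
  "newton_step F u = u - inv (frechet_derivative F (at u)) (F u)"

definition newton_limit :: "('a::euclidean_space \<Rightarrow> 'a) \<Rightarrow> 'a \<Rightarrow> 'a" where
  "newton_limit F u\<^sub>0 = lim (\<lambda>k. (newton_step F ^^ k) u\<^sub>0)"

definition local_quad :: "real \<Rightarrow> (plane \<Rightarrow> real) \<Rightarrow> coeffs \<Rightarrow> coeffs" where
  "local_quad h f u\<^sub>0 = newton_limit (residual h f) u\<^sub>0"

text \<open>A set \<open>W\<close> of windows together with starting values \<open>u\<^sub>0\<close> for the Newton iterations, of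
  accuracy \<open>K h\<^sup>3\<close>. The central columns, over which the local curves are taken, cover \<open>\<Gamma>\<close>.\<close>

definition windows ::
    "real \<Rightarrow> real \<Rightarrow> plane set \<Rightarrow> plane set \<Rightarrow> plane set \<Rightarrow> (plane \<Rightarrow> plane) set \<Rightarrow>
     ((plane \<Rightarrow> plane) \<Rightarrow> coeffs) \<Rightarrow> bool" where
  "windows K h \<Gamma> \<Omega>1 \<Omega>2 W u\<^sub>0 \<longleftrightarrow>
     (\<forall>T\<in>W. \<exists>g. window_section h \<Gamma> \<Omega>1 \<Omega>2 T g \<and>
                  (\<forall>x\<in>{h..4*h}. \<bar>quad h (u\<^sub>0 T) x - g x\<bar> \<le> K * h^3)) \<and>
     \<Gamma> \<subseteq> (\<Union>T\<in>W. T ` ({2*h..3*h} \<times> {h..9*h}))"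

definition local_curves ::
    "real \<Rightarrow> (plane \<Rightarrow> real) \<Rightarrow> (plane \<Rightarrow> plane) set \<Rightarrow> ((plane \<Rightarrow> plane) \<Rightarrow> coeffs) \<Rightarrow> plane set" where
  "local_curves h f W u\<^sub>0 =
     (\<Union>T\<in>W. (\<lambda>x. T (x, quad h (local_quad h (f \<circ> T) (u\<^sub>0 T)) x)) ` {2*h..3*h})"


section \<open>Global construction\<close>

definition mesh :: "nat \<Rightarrow> plane set" where
  "mesh n = (\<lambda>(i, j). (real i / real (n - 1), real j / real (n - 1))) ` ({..<n} \<times> {..<n})"

text \<open>The union \<open>G\<close> of the local curves generally has small gaps, so it need not disconnect the
  square. The side of \<open>G\<close> on which a point \<open>p\<close> lies is read off at a point of \<open>G\<close> nearest to \<open>p\<close>: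
  \<open>\<sigma> = 1\<close> if \<open>p\<close> lies (weakly) above the tangent of the local curve there, in window
  coordinates, and \<open>\<sigma> = -1\<close> if it lies (weakly) below. Points at which both hold may be put
  on either side.\<close>

definition on_side ::
    "real \<Rightarrow> real \<Rightarrow> (plane \<Rightarrow> real) \<Rightarrow> (plane \<Rightarrow> plane) set \<Rightarrow> ((plane \<Rightarrow> plane) \<Rightarrow> coeffs) \<Rightarrow> plane \<Rightarrow> bool"
  where
  "on_side \<sigma> h f W u\<^sub>0 p \<longleftrightarrow>
     (\<exists>T\<in>W. \<exists>x\<in>{2*h..3*h}. \<exists>v w.
        let q = quad h (local_quad h (f \<circ> T) (u\<^sub>0 T)) in
          dist p (T (x, q x)) = infdist p (local_curves h f W u\<^sub>0) \<and>
          p = T (v, w) \<and> 0 \<le> \<sigma> * (w - (q x + deriv q x * (v - x))))"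

definition separated ::
    "real \<Rightarrow> (plane \<Rightarrow> real) \<Rightarrow> (plane \<Rightarrow> plane) set \<Rightarrow> ((plane \<Rightarrow> plane) \<Rightarrow> coeffs) \<Rightarrow>
     plane set \<Rightarrow> plane set \<Rightarrow> bool" where
  "separated h f W u\<^sub>0 Q1 Q2 \<longleftrightarrow>
     (\<exists>\<sigma>\<in>{-1, 1}. (\<forall>p\<in>Q1. on_side \<sigma> h f W u\<^sub>0 p) \<and> (\<forall>p\<in>Q2. on_side (- \<sigma>) h f W u\<^sub>0 p))"

definition signed_values :: "plane set \<Rightarrow> plane set \<Rightarrow> plane \<Rightarrow> real" where
  "signed_values G Q1 p = (if p \<in> Q1 then infdist p G else - infdist p G)"

definition cubic_spline :: "nat \<Rightarrow> (real \<Rightarrow> real) \<Rightarrow> bool" where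
  "cubic_spline n s \<longleftrightarrow>
     Ck_on 2 {0..1} s \<and>
     (\<forall>k<n - 1. \<exists>P :: real poly. degree P \<le> 3 \<and>
        (\<forall>x\<in>{real k / real (n - 1)..real (k + 1) / real (n - 1)}. s x = poly P x))"

text \<open>Elements of the tensor product of two spaces of cubic splines.\<close>

definition bicubic_spline :: "nat \<Rightarrow> (plane \<Rightarrow> real) \<Rightarrow> bool" where
  "bicubic_spline n S \<longleftrightarrow>
     (\<exists>(m::nat) u v. (\<forall>k<m. cubic_spline n (u k) \<and> cubic_spline n (v k)) \<and>
        (\<forall>x\<in>{0..1}. \<forall>y\<in>{0..1}. S (x, y) = (\<Sum>k<m. u k x * v k y)))"

text \<open>\<open>A n\<close> acts on values on \<open>mesh n\<close>, represented by functions on the plane; by locality, the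
  values outside \<open>mesh n\<close> do not matter.\<close>

definition quasi_interpolation :: "real \<Rightarrow> (nat \<Rightarrow> (plane \<Rightarrow> real) \<Rightarrow> plane \<Rightarrow> real) \<Rightarrow> bool" where
  "quasi_interpolation \<beta> A \<longleftrightarrow>
     \<comment> \<open>linear, with bicubic splines as values\<close>
     (\<forall>n\<ge>2. \<forall>v. bicubic_spline n (A n v)) \<and>
     (\<forall>n\<ge>2. \<forall>v w a b. \<forall>p\<in>unit_square.
        A n (\<lambda>q. a * v q + b * w q) p = a * A n v p + b * A n w p) \<and>
     \<comment> \<open>local\<close>
     (\<exists>\<rho>. \<forall>n\<ge>2. \<forall>v w. \<forall>p\<in>unit_square.
        (\<forall>q\<in>mesh n. dist p q \<le> \<rho> / real (n - 1) \<longrightarrow> v q = w q) \<longrightarrow> A n v p = A n w p) \<and>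
     \<comment> \<open>operator norm less than \<open>\<beta>\<close>\<close>
     (\<forall>n\<ge>2. \<exists>b<\<beta>. \<forall>v. (\<forall>q\<in>mesh n. \<bar>v q\<bar> \<le> 1) \<longrightarrow> (\<forall>p\<in>unit_square. \<bar>A n v p\<bar> \<le> b)) \<and>
     \<comment> \<open>approximation order 4\<close>
     (\<forall>g. Ck_on 4 unit_square g \<longrightarrow>
        (\<exists>C. \<forall>\<^sub>F n in sequentially. \<forall>p\<in>unit_square. \<bar>A n g p - g p\<bar> \<le> C * (1 / real (n - 1))^4))"

definition zero_level :: "(plane \<Rightarrow> real) \<Rightarrow> plane set" where
  "zero_level S = {p \<in> unit_square. S p = 0}"

end

theory Submission
  imports Defs
begin

text \<open>
  Subtracting the local data, the residual of the Newton iteration is an exactly quadratic map of the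
  three coefficients. Its derivative is, up to \<open>O(h)\<close>, the jump of \<open>f\<close> times the moments of the
  correction over the three columns, hence uniformly invertible after scaling, and its value at the
  start is \<open>O(h\<^sup>2)\<close>. So the local quadratics are \<open>O(h\<^sup>3)\<close> close to \<open>\<Gamma>\<close> on the whole width of
  the windows. The side read off from the tangent at a nearest point is therefore correct except within
  \<open>O(h\<^sup>3)\<close> of \<open>\<Gamma>\<close>, and the mesh values differ by \<open>O(h\<^sup>3)\<close> from the signed distance to \<open>\<Gamma>\<close>.
  Near a point of \<open>\<Gamma>\<close> the signed distance agrees up to fourth order with a cubic polynomial, in the
  coordinates of the tangent frame, whose coefficients are bounded along \<open>\<Gamma>\<close>. Approximation order
  \<open>4\<close> for the finitely many products of three of \<open>1, x, y\<close> gives a uniform error \<open>O(n\<^sup>-\<^sup>4) = O(h\<^sup>3)\<close>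
  for all these polynomials, and locality and boundedness carry this over to the spline. On the normal
  through a point of \<open>\<Gamma>\<close> the polynomial is the arc length parameter of the normal, so the spline
  changes sign within \<open>O(h\<^sup>3)\<close> there, and it vanishes nowhere else.\<close>

section \<open>Functions of class \<open>C\<^sup>k\<close>\<close>

text \<open>The integrand \<open>L\<^sub>1 - L\<^sub>2\<close> of a column is affine in
  \<open>y\<close>, so its primitive is quadratic and the remainder of the residual is a column
  average of the squared correction. The weights of \<open>scaled_norm\<close> remove
  \<open>h\<close> from the moment matrix, which makes the inverse bound independent of
  \<open>h\<close>. Two obstacles shape the rest. The local curves leave gaps, so a nearest point of
  their union may be an endpoint, where the offset need not be normal; the remedy is that each
  quadratic is accurate on \<open>[h, 4h]\<close>, so that its graph beyond the endpoint cannot come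
  much nearer. And approximation order 4 supplies a constant for each single function, whereas the
  spline is examined at all points of \<Gamma> and the signed distance is smooth only near it; hence
  a finite-dimensional space of polynomials, used within distance \<open>L * r\<close> of \<Gamma>
  for \<open>r = h powr (3/4)\<close>, where \<open>r^4 = h^3\<close> and the mesh size is
  \<open>O(r)\<close>. Farther away it is enough that the signed distance varies little over a
  stencil compared with its size.\<close>

lemma Ck_on_imp_continuous_on: "Ck_on k S f \<Longrightarrow> continuous_on S f"
  by (cases k) (auto simp: continuous_on_eq_continuous_within intro: has_derivative_continuous)

lemma Ck_on_SucD: "Ck_on (Suc k) S f \<Longrightarrow> Ck_on k S f"
proof (induction k arbitrary: f)
  case 0
  then show ?case using Ck_on_imp_continuous_on by (metis Ck_on.simps(1))
next
  case (Suc k)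
  from Suc.prems obtain D where D: "\<forall>x\<in>S. (f has_derivative D x) (at x within S)"
    "\<forall>v\<in>Basis. Ck_on (Suc k) S (\<lambda>x. D x v)"
    unfolding Ck_on.simps(2)[of "Suc k"] by blast
  then show ?case using Suc.IH unfolding Ck_on.simps(2)[of k] by blast
qed

lemma Ck_on_const: "Ck_on k S (\<lambda>_. c)"
proof (induction k arbitrary: c)
  case (Suc k)
  show ?case unfolding Ck_on.simps
    by (rule exI[of _ "\<lambda>_ _. 0"]) (use Suc in auto)
qed auto

lemma Ck_on_bounded_linear:
  assumes "bounded_linear f"
  shows "Ck_on k S f"
proof (cases k)
  case 0
  then show ?thesis using assms by (simp add: linear_continuous_on)
next
  case (Suc k')
  show ?thesis unfolding Suc Ck_on.simps
    by (rule exI[of _ "\<lambda>_. f"]) (use assms Ck_on_const in \<open>auto intro: bounded_linear_imp_has_derivative\<close>)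
qed

lemma Ck_on_add: "Ck_on k S f \<Longrightarrow> Ck_on k S g \<Longrightarrow> Ck_on k S (\<lambda>x. f x + g x)"
proof (induction k arbitrary: f g)
  case (Suc k)
  then obtain D E where
    D: "\<forall>x\<in>S. (f has_derivative D x) (at x within S)" "\<forall>v\<in>Basis. Ck_on k S (\<lambda>x. D x v)" and
    E: "\<forall>x\<in>S. (g has_derivative E x) (at x within S)" "\<forall>v\<in>Basis. Ck_on k S (\<lambda>x. E x v)"
    by auto
  show ?case unfolding Ck_on.simps
    by (rule exI[of _ "\<lambda>x v. D x v + E x v"]) (use D E Suc.IH in \<open>auto intro: has_derivative_add\<close>)
qed (auto intro: continuous_on_add)

lemma Ck_on_mult:
  fixes f g :: "'a::euclidean_space \<Rightarrow> real"
  shows "Ck_on k S f \<Longrightarrow> Ck_on k S g \<Longrightarrow> Ck_on k S (\<lambda>x. f x * g x)"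
proof (induction k arbitrary: f g)
  case (Suc k)
  then obtain D E where
    D: "\<forall>x\<in>S. (f has_derivative D x) (at x within S)" "\<forall>v\<in>Basis. Ck_on k S (\<lambda>x. D x v)" and
    E: "\<forall>x\<in>S. (g has_derivative E x) (at x within S)" "\<forall>v\<in>Basis. Ck_on k S (\<lambda>x. E x v)"
    by auto
  have "Ck_on k S f" "Ck_on k S g" using Suc.prems Ck_on_SucD by auto
  then show ?case unfolding Ck_on.simps
    by (intro exI[of _ "\<lambda>x v. f x * E x v + D x v * g x"])
       (use D E Suc.IH in \<open>auto intro!: has_derivative_mult Ck_on_add\<close>)
qed (auto intro: continuous_on_mult)

text \<open>Second derivatives are bounded on the compact set, so by convexity the first derivative
  is Lipschitz; linearizing along the segment from \<open>p\<close> to \<open>q\<close> gives the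
  quadratic remainder. Compactness makes \<open>M\<close> common to all base points
  \<open>p\<close>.\<close>

lemma Ck_on_2_taylor:
  fixes f :: "'a::euclidean_space \<Rightarrow> real"
  assumes f: "Ck_on (Suc (Suc k)) S f" and S: "compact S" "convex S"
  shows "\<exists>M\<ge>0. \<forall>p\<in>S. \<exists>D. linear D \<and> (\<forall>v. \<bar>D v\<bar> \<le> M * norm v) \<and>
           (\<forall>q\<in>S. \<bar>f q - f p - D (q - p)\<bar> \<le> M * (norm (q - p))\<^sup>2)"
proof -
  obtain D where D: "\<And>x. x \<in> S \<Longrightarrow> (f has_derivative D x) (at x within S)"
    and D2: "\<And>v. v \<in> Basis \<Longrightarrow> Ck_on (Suc k) S (\<lambda>x. D x v)"
    using f by auto
  have lin: "bounded_linear (D x)" if "x \<in> S" for x using D[OF that] has_derivative_bounded_linear by blast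
  have bound: "\<exists>B\<ge>0. \<forall>x\<in>S. norm (c x) \<le> B" if "continuous_on S c" for c :: "'a \<Rightarrow> real"
    using compact_imp_bounded[OF compact_continuous_image[OF that S(1)]]
    unfolding bounded_pos by (metis image_eqI less_imp_le)
  \<comment> \<open>Bounds at the basis vectors bound a linear functional everywhere; this serves
    for \<open>D x\<close>, for the second derivative \<open>E x\<close> and for the difference
    \<open>D x - D p\<close>.\<close>
  have sum_basis: "\<bar>L v\<bar> \<le> (\<Sum>b\<in>Basis. B b) * norm v"
    if "linear L" "\<And>b. b \<in> Basis \<Longrightarrow> \<bar>L b\<bar> \<le> B b" for L :: "'a \<Rightarrow> real" and v B
  proof -
    have "L v = L (\<Sum>b\<in>Basis. (v \<bullet> b) *\<^sub>R b)" by (simp add: euclidean_representation)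
    also have "\<dots> = (\<Sum>b\<in>Basis. (v \<bullet> b) * L b)" using that(1) by (simp add: linear_sum linear_scale)
    also have "\<bar>\<dots>\<bar> \<le> (\<Sum>b\<in>Basis. \<bar>(v \<bullet> b) * L b\<bar>)" by (rule sum_abs)
    also have "\<dots> \<le> (\<Sum>b\<in>Basis. norm v * B b)"
      by (intro sum_mono) (auto simp: abs_mult intro!: mult_mono that Basis_le_norm)
    also have "\<dots> = (\<Sum>b\<in>Basis. B b) * norm v" by (simp add: sum_distrib_left sum_distrib_right mult.commute)
    finally show ?thesis .
  qed
  have "\<exists>B\<ge>0. \<forall>x\<in>S. \<bar>D x v\<bar> \<le> B" if "v \<in> Basis" for v
    using bound[of "\<lambda>x. D x v"] Ck_on_imp_continuous_on[OF D2[OF that]] by auto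
  then obtain B where B: "\<And>v. v \<in> Basis \<Longrightarrow> B v \<ge> 0 \<and> (\<forall>x\<in>S. \<bar>D x v\<bar> \<le> B v)" by metis
  have "\<exists>L\<ge>0. \<forall>x\<in>S. \<forall>y\<in>S. \<bar>D y v - D x v\<bar> \<le> L * norm (y - x)" if v: "v \<in> Basis" for v
  proof -
    obtain E where E: "\<And>x. x \<in> S \<Longrightarrow> ((\<lambda>x. D x v) has_derivative E x) (at x within S)"
      and E2: "\<And>w. w \<in> Basis \<Longrightarrow> Ck_on k S (\<lambda>x. E x w)"
      using D2[OF v] by auto
    have "\<exists>C\<ge>0. \<forall>x\<in>S. \<bar>E x w\<bar> \<le> C" if "w \<in> Basis" for w
      using bound[of "\<lambda>x. E x w"] Ck_on_imp_continuous_on[OF E2[OF that]] by auto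
    then obtain C where C: "\<And>w. w \<in> Basis \<Longrightarrow> C w \<ge> 0 \<and> (\<forall>x\<in>S. \<bar>E x w\<bar> \<le> C w)" by metis
    have nn: "(\<Sum>b\<in>Basis. C b) \<ge> 0" using C by (simp add: sum_nonneg)
    have on: "onorm (E x) \<le> (\<Sum>b\<in>Basis. C b)" if "x \<in> S" for x
      using that C E[OF that] nn
      by (intro onorm_bound)
        (auto intro!: sum_basis simp: has_derivative_def bounded_linear.linear)
    show ?thesis
      using differentiable_bound[OF S(2) E on] nn by (intro exI[of _ "\<Sum>b\<in>Basis. C b"]) auto
  qed
  then obtain L where L: "\<And>v. v \<in> Basis \<Longrightarrow> L v \<ge> 0 \<and> (\<forall>x\<in>S. \<forall>y\<in>S. \<bar>D y v - D x v\<bar> \<le> L v * norm (y - x))"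
    by metis
  define M where "M = (\<Sum>b\<in>Basis. B b) + (\<Sum>b\<in>Basis. L b)"
  have pos: "(\<Sum>b\<in>Basis. B b) \<ge> 0" "(\<Sum>b\<in>Basis. L b) \<ge> 0" using B L by (auto intro!: sum_nonneg)
  have "\<bar>f q - f p - D p (q - p)\<bar> \<le> M * (norm (q - p))\<^sup>2" if p: "p \<in> S" and q: "q \<in> S" for p q
  proof -
    have seg: "closed_segment p q \<subseteq> S" using S p q by (simp add: closed_segment_subset)
    have on: "onorm (\<lambda>v. D x v - D p v) \<le> (\<Sum>b\<in>Basis. L b) * norm (q - p)" if x: "x \<in> closed_segment p q" for x
    proof (rule onorm_bound)
      have xS: "x \<in> S" using x seg by auto
      have xp: "norm (x - p) \<le> norm (q - p)" using segment_bound1[OF x] by simp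
      fix v
      have "\<bar>D x v - D p v\<bar> \<le> (\<Sum>b\<in>Basis. L b * norm (q - p)) * norm v"
      proof (rule sum_basis)
        show "linear (\<lambda>v. D x v - D p v)"
          using lin[OF xS] lin[OF p] by (intro linear_compose_sub) (auto simp: bounded_linear.linear)
        fix b :: 'a assume b: "b \<in> Basis"
        have "\<bar>D x b - D p b\<bar> \<le> L b * norm (x - p)" using L[OF b] p xS by auto
        also have "\<dots> \<le> L b * norm (q - p)" using L[OF b] xp by (intro mult_left_mono) auto
        finally show "\<bar>D x b - D p b\<bar> \<le> L b * norm (q - p)" .
      qed
      then show "norm (D x v - D p v) \<le> (\<Sum>b\<in>Basis. L b) * norm (q - p) * norm v"
        by (simp add: sum_distrib_right)
    qed (use pos in auto)
    have seg': "p + t *\<^sub>R (q - p) \<in> closed_segment p q" if "t \<in> {0..1}" for t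
      using that by (auto simp: closed_segment_def algebra_simps intro!: exI[of _ t])
    have "norm (f (p + (q - p)) - f p - D p (q - p)) \<le> norm (p + (q - p) - p) * ((\<Sum>b\<in>Basis. L b) * norm (q - p))"
      using differentiable_bound_linearization[of p "p + (q - p)" "closed_segment p q" f D p "(\<Sum>b\<in>Basis. L b) * norm (q - p)"]
      using seg' has_derivative_subset[OF D seg] seg on by (auto simp: fun_diff_def)
    also have "\<dots> \<le> M * (norm (q - p))\<^sup>2"
      using pos by (simp add: M_def power2_eq_square algebra_simps)
    finally show ?thesis by simp
  qed
  moreover have "\<bar>D p v\<bar> \<le> M * norm v" if "p \<in> S" for p v
  proof -
    have "\<bar>D p v\<bar> \<le> (\<Sum>b\<in>Basis. B b) * norm v"
      using B that lin[OF that] by (intro sum_basis) (auto simp: bounded_linear.linear)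
    also have "\<dots> \<le> M * norm v" using pos by (intro mult_right_mono) (auto simp: M_def)
    finally show ?thesis .
  qed
  ultimately show ?thesis using pos lin
    by (intro exI[of _ M]) (auto simp: M_def bounded_linear.linear intro!: exI[of _ "D _"])
qed

section \<open>Newton's method for quadratic maps\<close>

text \<open>A Newton step cancels the linearization, so the new value of \<open>F\<close> is the
  pure quadratic remainder, and \<open>small\<close> makes it at most half the old bound. The steps
  are then at most \<open>\<mu> * \<epsilon> / 2^k\<close>, they sum to
  \<open>2 * \<mu> * \<epsilon>\<close>, and the iterates stay in the ball where \<open>inj\<close>
  is available. The function \<nu> is a weighted norm; its comparison constants \<open>c\<close> and
  \<open>c'\<close> enter the convergence but not the resulting radius.\<close>

lemma newton_limit_quadratic:
  fixes F :: "'a::euclidean_space \<Rightarrow> 'a" and \<nu> :: "'a \<Rightarrow> real"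
  assumes lin: "\<And>u. linear (D u)"
    and quad: "\<And>u e. norm (F (u + e) - F u - D u e) \<le> \<kappa> * (\<nu> e)\<^sup>2"
    and tri: "\<And>x y. \<nu> (x + y) \<le> \<nu> x + \<nu> y"
    and norm_le: "\<And>x. norm x \<le> c * \<nu> x" and le_norm: "\<And>x. \<nu> x \<le> c' * norm x"
    and pos: "\<And>x. \<nu> x \<ge> 0" "c \<ge> 0" "\<kappa> \<ge> 0" "\<mu> \<ge> 0" "\<epsilon> \<ge> 0"
    and inj: "\<And>u e. \<nu> (u - u0) \<le> 2 * \<mu> * \<epsilon> \<Longrightarrow> \<nu> e \<le> \<mu> * norm (D u e)"
    and start: "norm (F u0) \<le> \<epsilon>"
    and small: "\<mu> * \<kappa> * \<mu> * \<epsilon> \<le> 1/2"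
  shows "\<nu> (newton_limit F u0 - u0) \<le> 2 * \<mu> * \<epsilon>"
proof -
  have D: "(F has_derivative D u) (at u)" for u
  proof -
    have bl: "bounded_linear (D u)" using lin by (simp add: linear_conv_bounded_linear)
    have "\<exists>d>0. \<forall>y. norm (y - u) < d \<longrightarrow> norm (F y - F u - D u (y - u)) \<le> e * norm (y - u)" if "e > 0" for e
    proof (intro exI conjI allI impI)
      \<comment> \<open>The summand 1 keeps the denominator positive when
        \<open>\<kappa> * c'\<^sup>2\<close> vanishes.\<close>
      let ?d = "e / (\<kappa> * c'\<^sup>2 + 1)"
      have dn: "\<kappa> * c'\<^sup>2 + 1 > 0" using pos by (simp add: add_nonneg_pos)
      show "?d > 0" using dn that by simp
      fix y assume y: "norm (y - u) < ?d"
      have "norm (F y - F u - D u (y - u)) \<le> \<kappa> * (\<nu> (y - u))\<^sup>2"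
        using quad[of u "y - u"] by simp
      also have "\<dots> \<le> \<kappa> * (c' * norm (y - u))\<^sup>2"
        using pos le_norm by (intro mult_left_mono power_mono) auto
      also have "\<dots> \<le> ((\<kappa> * c'\<^sup>2 + 1) * norm (y - u)) * norm (y - u)"
        by (simp add: power2_eq_square algebra_simps)
      also have "\<dots> \<le> e * norm (y - u)"
        using y dn by (intro mult_right_mono) (auto simp: field_simps)
      finally show "norm (F y - F u - D u (y - u)) \<le> e * norm (y - u)" .
    qed
    then show ?thesis using bl unfolding has_derivative_at_alt by blast
  qed
  have step: "newton_step F u = u - inv (D u) (F u)" for u
    unfolding newton_step_def using frechet_derivative_at[OF D[of u]] by simp
  have nu0: "\<nu> 0 = 0" using le_norm[of 0] pos(1)[of 0] by simp
  \<comment> \<open>\<open>newton_step\<close> applies the choice-based \<open>inv\<close> to the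
    derivative. The lower bound \<open>inj\<close> makes this linear endomorphism injective, hence
    surjective in finite dimension, and \<open>inv\<close> a right inverse.\<close>
  have invD: "D u (inv (D u) y) = y" if "\<nu> (u - u0) \<le> 2 * \<mu> * \<epsilon>" for u y
  proof -
    have "inj (D u)"
    proof (rule linear_injective_0[THEN iffD2, OF lin], intro allI impI)
      fix e assume "D u e = 0"
      then have "\<nu> e \<le> 0" using inj[OF that, of e] by simp
      then show "e = 0" using norm_le[of e] pos
        by (metis mult_nonneg_nonpos norm_le_zero_iff order_trans)
    qed
    then have "surj (D u)" using lin linear_injective_imp_surjective by blast
    then show ?thesis by (rule surj_f_inv_f)
  qed
  define u where "u k = (newton_step F ^^ k) u0" for k
  have u0: "u 0 = u0" and us: "u (Suc k) = u k - inv (D (u k)) (F (u k))" for k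
    by (auto simp: u_def step)
  \<comment> \<open>The factor \<open>1 - (1/2)^k\<close> is the partial geometric sum of the step
    bounds, so the radius \<open>2 * \<mu> * \<epsilon>\<close> is never exceeded.\<close>
  have inv: "\<nu> (u k - u0) \<le> 2 * \<mu> * \<epsilon> * (1 - (1/2)^k) \<and> norm (F (u k)) \<le> \<epsilon> * (1/2)^k \<and>
      \<nu> (u (Suc k) - u k) \<le> \<mu> * \<epsilon> * (1/2)^k" for k
  proof (induction k)
    have third: "D (u k) (u (Suc k) - u k) = - F (u k) \<and> \<nu> (u (Suc k) - u k) \<le> \<mu> * \<epsilon> * (1/2)^k"
      if "\<nu> (u k - u0) \<le> 2 * \<mu> * \<epsilon>" "norm (F (u k)) \<le> \<epsilon> * (1/2)^k" for k
    proof -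
      have *: "D (u k) (u (Suc k) - u k) = - F (u k)"
        using invD[OF that(1)] lin[of "u k"] by (simp add: us linear_neg)
      have "\<nu> (u (Suc k) - u k) \<le> \<mu> * norm (F (u k))" using inj[OF that(1), of "u (Suc k) - u k"] * by simp
      also have "\<dots> \<le> \<mu> * (\<epsilon> * (1/2)^k)" using that pos by (intro mult_left_mono) auto
      finally show ?thesis using * by simp
    qed
    {
      case 0
      show ?case using third[of 0] start u0 nu0 pos by auto
    next
      case (Suc k)
      let ?p = "(1/2::real)^k"
      have p: "0 \<le> ?p" "?p \<le> 1" by (auto simp: power_le_one)
      have me: "\<mu> * \<epsilon> \<ge> 0" "\<epsilon> * \<mu> \<ge> 0" using pos by simp_all
      have uk: "\<nu> (u k - u0) \<le> 2 * \<mu> * \<epsilon>"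
      proof -
        have "2 * \<mu> * \<epsilon> * (1 - ?p) \<le> 2 * \<mu> * \<epsilon> * 1" using p me by (intro mult_left_mono) auto
        then show ?thesis using Suc by linarith
      qed
      have a: "\<nu> (u (Suc k) - u0) \<le> 2 * \<mu> * \<epsilon> * (1 - (1/2)^Suc k)"
      proof -
        have "\<nu> (u (Suc k) - u0) \<le> \<nu> (u (Suc k) - u k) + \<nu> (u k - u0)"
          using tri[of "u (Suc k) - u k" "u k - u0"] by simp
        then show ?thesis using Suc by (simp add: algebra_simps)
      qed
      have b: "norm (F (u (Suc k))) \<le> \<epsilon> * (1/2)^Suc k"
      proof -
        have "norm (F (u (Suc k))) \<le> \<kappa> * (\<nu> (u (Suc k) - u k))\<^sup>2"
          using quad[of "u k" "u (Suc k) - u k"] third[OF uk] Suc by simp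
        also have "\<dots> \<le> \<kappa> * (\<mu> * \<epsilon> * ?p)\<^sup>2" using Suc pos by (intro mult_left_mono power_mono) auto
        also have "\<dots> = (\<mu> * \<kappa> * \<mu> * \<epsilon>) * (\<epsilon> * ?p) * ?p" by (simp add: power2_eq_square algebra_simps)
        also have "\<dots> \<le> (1/2) * (\<epsilon> * ?p) * 1" using small p pos by (intro mult_mono) auto
        finally show ?thesis by simp
      qed
      have "2 * \<mu> * \<epsilon> * (1 - (1/2)^Suc k) \<le> 2 * \<mu> * \<epsilon> * 1" using me by (intro mult_left_mono) auto
      then have "\<nu> (u (Suc k) - u0) \<le> 2 * \<mu> * \<epsilon>" using a by linarith
      from third[OF this b] show ?case using a b by blast
    }
  qed
  have "norm (u (Suc k) - u k) \<le> c * \<mu> * \<epsilon> * (1/2)^k" for k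
  proof -
    have "norm (u (Suc k) - u k) \<le> c * \<nu> (u (Suc k) - u k)" by (rule norm_le)
    also have "\<dots> \<le> c * (\<mu> * \<epsilon> * (1/2)^k)" using inv[of k] pos by (intro mult_left_mono) auto
    finally show ?thesis by simp
  qed
  then have "summable (\<lambda>k. u (Suc k) - u k)"
    using summable_comparison_test'[OF summable_mult[OF summable_geometric[of "1/2::real"], of "c * \<mu> * \<epsilon>"],
        of 0 "\<lambda>k. u (Suc k) - u k"]
    by simp
  then have "convergent (\<lambda>n. \<Sum>k<n. u (Suc k) - u k)" by (simp add: summable_iff_convergent)
  then have "convergent (\<lambda>n. u n - u0)" by (simp add: sum_lessThan_telescope u0)
  then have "convergent u" using convergent_add[of "\<lambda>n. u n - u0" "\<lambda>_. u0"] by (simp add: convergent_const)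
  then have L: "u \<longlonglongrightarrow> newton_limit F u0"
    unfolding newton_limit_def u_def convergent_LIMSEQ_iff by (simp add: u_def[abs_def])
  \<comment> \<open>The triangle inequality and \<open>le_norm\<close> carry the bound on the
    iterates over to their limit.\<close>
  have "\<nu> (newton_limit F u0 - u0) \<le> c' * norm (newton_limit F u0 - u n) + 2 * \<mu> * \<epsilon>" for n
  proof -
    have "\<nu> (newton_limit F u0 - u0) \<le> \<nu> (newton_limit F u0 - u n) + \<nu> (u n - u0)"
      using tri[of "newton_limit F u0 - u n" "u n - u0"] by simp
    moreover have "2 * \<mu> * \<epsilon> * (1 - (1/2)^n) \<le> 2 * \<mu> * \<epsilon> * 1" using pos by (intro mult_left_mono) auto
    ultimately show ?thesis using inv[of n] le_norm[of "newton_limit F u0 - u n"] by linarith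
  qed
  moreover have "(\<lambda>n. c' * norm (newton_limit F u0 - u n) + 2 * \<mu> * \<epsilon>)
      \<longlonglongrightarrow> c' * norm (newton_limit F u0 - newton_limit F u0) + 2 * \<mu> * \<epsilon>"
    by (intro tendsto_intros L)
  ultimately show ?thesis using LIMSEQ_le_const by fastforce
qed

section \<open>The curve and its normal segments\<close>

text \<open>Over the reals \<open>Basis\<close> is \<open>{1}\<close>, so the recursion of
  \<open>Ck_on\<close> becomes one on vector derivatives.\<close>

lemma Ck_on_Suc_vector_derivative:
  fixes f :: "real \<Rightarrow> 'b::real_normed_vector"
  assumes "Ck_on (Suc k) UNIV f"
  shows "(f has_vector_derivative vector_derivative f (at s)) (at s)"
    and "Ck_on k UNIV (\<lambda>s. vector_derivative f (at s))"
proof -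
  obtain D where D: "\<And>x. (f has_derivative D x) (at x)" and k: "Ck_on k UNIV (\<lambda>x. D x 1)"
    using assms by auto
  have hv: "(f has_vector_derivative D x 1) (at x)" for x
  proof -
    have "(\<lambda>h. h *\<^sub>R D x 1) = D x"
    proof
      fix h
      show "h *\<^sub>R D x 1 = D x h" using linear_scale[OF has_derivative_linear[OF D[of x]], of h 1] by simp
    qed
    then show ?thesis using D[of x] unfolding has_vector_derivative_def by simp
  qed
  have vd: "vector_derivative f (at x) = D x 1" for x using hv by (rule vector_derivative_at)
  show "(f has_vector_derivative vector_derivative f (at s)) (at s)"
    and "Ck_on k UNIV (\<lambda>s. vector_derivative f (at s))"
    unfolding vd by (rule hv, rule k)
qed

text \<open>Mean value inequality on the segment from \<open>a\<close> to \<open>s\<close>. Applied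
  to a Taylor remainder it raises the order by one; the factor \<open>1 / Suc k\<close> of exact
  integration is given up.\<close>

lemma has_vector_derivative_power_bound:
  fixes f :: "real \<Rightarrow> 'b::real_normed_vector"
  assumes f: "\<And>s. (f has_vector_derivative f' s) (at s)"
    and f': "\<And>s. norm (f' s) \<le> M * \<bar>s - a\<bar> ^ k" and M: "M \<ge> 0"
  shows "norm (f s - f a) \<le> M * \<bar>s - a\<bar> ^ Suc k"
proof -
  have "norm (f s - f a) \<le> M * \<bar>s - a\<bar> ^ k * norm (s - a)"
  proof (rule differentiable_bound[OF convex_closed_segment[of a s]])
    fix x assume x: "x \<in> closed_segment a s"
    show "(f has_derivative (\<lambda>h. h *\<^sub>R f' x)) (at x within closed_segment a s)"
      using f[of x] has_derivative_at_withinI unfolding has_vector_derivative_def by blast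
    have "\<bar>x - a\<bar> \<le> \<bar>s - a\<bar>" using segment_bound1[OF x] by simp
    then have "norm (f' x) \<le> M * \<bar>s - a\<bar> ^ k"
      using f'[of x] M by (meson abs_ge_zero mult_left_mono order_trans power_mono)
    then show "onorm (\<lambda>h. h *\<^sub>R f' x) \<le> M * \<bar>s - a\<bar> ^ k"
      using M by (intro onorm_bound) (auto simp: mult.commute intro!: mult_left_mono)
  qed auto
  then show ?thesis by (simp add: algebra_simps)
qed

lemma plane_inner: "(a::plane) \<bullet> b = fst a * fst b + snd a * snd b"
  by (cases a; cases b) simp

locale interface_curve =
  fixes \<gamma> :: "real \<Rightarrow> plane" and len R :: real
  assumes curve: "C4_closed_curve len \<gamma>" and R: "R > 0" and tube: "embedded_tube R len \<gamma>"
begin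

abbreviation "\<gamma>1 \<equiv> velocity \<gamma>"
abbreviation "\<gamma>2 \<equiv> velocity \<gamma>1"
abbreviation "\<gamma>3 \<equiv> velocity \<gamma>2"
abbreviation "\<gamma>4 \<equiv> velocity \<gamma>3"
abbreviation "\<nu> \<equiv> unit_normal \<gamma>"

lemma len: "len > 0" and period: "\<gamma> (s + len) = \<gamma> s" and norm_velocity: "norm (\<gamma>1 s) = 1"
  using curve by (auto simp: C4_closed_curve_def)

lemma C4: "Ck_on (Suc (Suc (Suc (Suc 0)))) UNIV \<gamma>"
  using curve by (simp add: C4_closed_curve_def numeral_eq_Suc)

lemmas C3 = Ck_on_Suc_vector_derivative(2)[OF C4]
lemmas C2 = Ck_on_Suc_vector_derivative(2)[OF C3]
lemmas C1 = Ck_on_Suc_vector_derivative(2)[OF C2]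
lemmas D\<gamma> = Ck_on_Suc_vector_derivative(1)[OF C4]
lemmas D\<gamma>1 = Ck_on_Suc_vector_derivative(1)[OF C3]
lemmas D\<gamma>2 = Ck_on_Suc_vector_derivative(1)[OF C2]
lemmas D\<gamma>3 = Ck_on_Suc_vector_derivative(1)[OF C1]
lemmas C0 = Ck_on_imp_continuous_on[OF Ck_on_Suc_vector_derivative(2)[OF C1]]

lemma continuous_curve: "continuous_on S \<gamma>" "continuous_on S \<gamma>1"
  using Ck_on_imp_continuous_on[OF C4] Ck_on_imp_continuous_on[OF C3]
  by (auto intro: continuous_on_subset)

lemma velocity_periodic:
  fixes f :: "real \<Rightarrow> plane"
  assumes f: "\<And>s. f (s + len) = f s" and D: "\<And>s. (f has_vector_derivative velocity f s) (at s)"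
  shows "velocity f (s + len) = velocity f s"
proof -
  have "((\<lambda>s. s + len) has_vector_derivative 1) (at s)" by (auto intro!: derivative_eq_intros)
  then have "(f \<circ> (\<lambda>s. s + len) has_vector_derivative 1 *\<^sub>R velocity f (s + len)) (at s)"
    using D[of "s + len"] by (rule vector_diff_chain_at)
  moreover have "f \<circ> (\<lambda>s. s + len) = f" using f by auto
  ultimately show ?thesis using vector_derivative_at by force
qed

lemmas period1 = velocity_periodic[OF period D\<gamma>]
lemmas period2 = velocity_periodic[OF period1 D\<gamma>1]
lemmas period3 = velocity_periodic[OF period2 D\<gamma>2]
lemmas period4 = velocity_periodic[OF period3 D\<gamma>3]

lemma periodic_int:
  assumes f: "\<And>s. f (s + len) = f s"
  shows "f (s + of_int k * len) = f s"
proof -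
  have nat: "f (s + of_nat n * len) = f s" for n s
  proof (induction n)
    case (Suc n)
    have "f (s + of_nat (Suc n) * len) = f ((s + of_nat n * len) + len)"
      by (rule arg_cong[of _ _ f]) (simp add: algebra_simps)
    then show ?case unfolding f Suc .
  qed simp
  show ?thesis
  proof (cases "k \<ge> 0")
    case True
    then show ?thesis using nat[of s "nat k"] by simp
  next
    case False
    then show ?thesis using nat[of "s + of_int k * len" "nat (- k)"] by simp
  qed
qed

lemma reduce_mod_period: "\<exists>s'\<in>{0..<len}. \<exists>k::int. s = s' + of_int k * len"
proof (intro bexI exI)
  let ?k = "\<lfloor>s / len\<rfloor>"
  show "s = (s - of_int ?k * len) + of_int ?k * len" by simp
  have "of_int ?k \<le> s / len" "s / len < of_int ?k + 1" by linarith+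
  then have "of_int ?k * len \<le> s" "s < (of_int ?k + 1) * len"
    using len by (simp_all only: pos_le_divide_eq pos_divide_less_eq)
  then show "s - of_int ?k * len \<in> {0..<len}" by (simp add: algebra_simps)
qed

lemma periodic_bounded:
  fixes f :: "real \<Rightarrow> plane"
  assumes f: "\<And>s. f (s + len) = f s" and c: "continuous_on UNIV f"
  shows "\<exists>M\<ge>1. \<forall>s. norm (f s) \<le> M"
proof -
  have "compact (f ` {0..len})"
    by (intro compact_continuous_image continuous_on_subset[OF c]) auto
  then obtain M where M: "\<And>s. s \<in> {0..len} \<Longrightarrow> norm (f s) \<le> M"
    using compact_imp_bounded bounded_iff by (metis image_eqI)
  have "norm (f s) \<le> max M 1" for s
    using reduce_mod_period[of s] periodic_int[of f, OF f] M by (force simp: le_max_iff_disj)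
  then show ?thesis by (intro exI[of _ "max M 1"]) auto
qed

text \<open>One constant for all base points. The orders are those that a fourth-order expansion of
  the signed distance requires: up to four for the position, up to three for the velocity, which
  enters multiplied by the small normal offset.\<close>

definition taylor_bound :: "real \<Rightarrow> bool" where
  "taylor_bound M \<longleftrightarrow> M \<ge> 1 \<and> (\<forall>s. norm (\<gamma>2 s) \<le> M \<and> norm (\<gamma>3 s) \<le> M) \<and>
    (\<forall>s s0. norm (\<gamma> s - \<gamma> s0 - (s - s0) *\<^sub>R \<gamma>1 s0) \<le> M * \<bar>s - s0\<bar>^2 \<and>
      norm (\<gamma> s - \<gamma> s0 - (s - s0) *\<^sub>R \<gamma>1 s0 - ((s - s0)^2 / 2) *\<^sub>R \<gamma>2 s0) \<le> M * \<bar>s - s0\<bar>^3 \<and>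
      norm (\<gamma> s - \<gamma> s0 - (s - s0) *\<^sub>R \<gamma>1 s0 - ((s - s0)^2 / 2) *\<^sub>R \<gamma>2 s0 - ((s - s0)^3 / 6) *\<^sub>R \<gamma>3 s0)
        \<le> M * \<bar>s - s0\<bar>^4 \<and>
      norm (\<gamma>1 s - \<gamma>1 s0 - (s - s0) *\<^sub>R \<gamma>2 s0) \<le> M * \<bar>s - s0\<bar>^2 \<and>
      norm (\<gamma>1 s - \<gamma>1 s0 - (s - s0) *\<^sub>R \<gamma>2 s0 - ((s - s0)^2 / 2) *\<^sub>R \<gamma>3 s0) \<le> M * \<bar>s - s0\<bar>^3)"

lemma taylor_boundD:
  assumes "taylor_bound M"
  shows "M \<ge> 1" "norm (\<gamma>2 s) \<le> M" "norm (\<gamma>3 s) \<le> M"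
    "norm (\<gamma> s - \<gamma> s0 - (s - s0) *\<^sub>R \<gamma>1 s0) \<le> M * \<bar>s - s0\<bar>^2"
    "norm (\<gamma> s - \<gamma> s0 - (s - s0) *\<^sub>R \<gamma>1 s0 - ((s - s0)^2 / 2) *\<^sub>R \<gamma>2 s0) \<le> M * \<bar>s - s0\<bar>^3"
    "norm (\<gamma> s - \<gamma> s0 - (s - s0) *\<^sub>R \<gamma>1 s0 - ((s - s0)^2 / 2) *\<^sub>R \<gamma>2 s0 - ((s - s0)^3 / 6) *\<^sub>R \<gamma>3 s0)
        \<le> M * \<bar>s - s0\<bar>^4"
    "norm (\<gamma>1 s - \<gamma>1 s0 - (s - s0) *\<^sub>R \<gamma>2 s0) \<le> M * \<bar>s - s0\<bar>^2"
    "norm (\<gamma>1 s - \<gamma>1 s0 - (s - s0) *\<^sub>R \<gamma>2 s0 - ((s - s0)^2 / 2) *\<^sub>R \<gamma>3 s0) \<le> M * \<bar>s - s0\<bar>^3"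
  using assms unfolding taylor_bound_def by simp_all

text \<open>The derivative of each remainder is a remainder of one order less for the next
  derivative of the curve, so all bounds build up from bounds on the continuous periodic functions
  \<open>\<gamma>2\<close>, \<open>\<gamma>3\<close> and \<open>\<gamma>4\<close>.\<close>

lemma curve_taylor: "\<exists>M. taylor_bound M"
proof -
  obtain M2 where M2: "M2 \<ge> 1" "\<And>s. norm (\<gamma>2 s) \<le> M2"
    using periodic_bounded[of \<gamma>2, OF period2] Ck_on_imp_continuous_on[OF C2] by auto
  obtain M3 where M3: "M3 \<ge> 1" "\<And>s. norm (\<gamma>3 s) \<le> M3"
    using periodic_bounded[of \<gamma>3, OF period3] Ck_on_imp_continuous_on[OF C1] by auto
  obtain M4 where M4: "M4 \<ge> 1" "\<And>s. norm (\<gamma>4 s) \<le> M4"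
    using periodic_bounded[of \<gamma>4, OF period4 C0] by auto
  define M where "M = max M2 (max M3 M4)"
  have M: "M \<ge> 1" "\<And>s. norm (\<gamma>2 s) \<le> M" "\<And>s. norm (\<gamma>3 s) \<le> M" "\<And>s. norm (\<gamma>4 s) \<le> M"
    using M2 M3 M4 by (auto simp: M_def le_max_iff_disj)
  have b: "norm (\<gamma>1 s - \<gamma>1 s0) \<le> M * \<bar>s - s0\<bar>^1" "norm (\<gamma>2 s - \<gamma>2 s0) \<le> M * \<bar>s - s0\<bar>^1"
    "norm (\<gamma>3 s - \<gamma>3 s0) \<le> M * \<bar>s - s0\<bar>^1" for s s0
    using has_vector_derivative_power_bound[OF D\<gamma>1, of M s0 0 s]
      has_vector_derivative_power_bound[OF D\<gamma>2, of M s0 0 s]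
      has_vector_derivative_power_bound[OF D\<gamma>3, of M s0 0 s] M by auto
  have l: "((\<lambda>s. (s - s0) *\<^sub>R v) has_vector_derivative v) (at s)" for s s0 :: real and v :: plane
  proof -
    have "((\<lambda>s. (s - s0) *\<^sub>R v) has_vector_derivative (s - s0) *\<^sub>R 0 + 1 *\<^sub>R v) (at s)"
      by (intro has_vector_derivative_scaleR) (auto intro!: derivative_eq_intros)
    then show ?thesis by simp
  qed
  have c0: "norm (\<gamma> s - \<gamma> s0 - (s - s0) *\<^sub>R \<gamma>1 s0) \<le> M * \<bar>s - s0\<bar>^2" for s s0
  proof -
    have "((\<lambda>s. \<gamma> s - (s - s0) *\<^sub>R \<gamma>1 s0) has_vector_derivative \<gamma>1 s - \<gamma>1 s0) (at s)" for s
      by (intro has_vector_derivative_diff l D\<gamma>)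
    from has_vector_derivative_power_bound[OF this b(1), of s] M show ?thesis
      by (simp add: algebra_simps numeral_eq_Suc)
  qed
  have c1: "norm (\<gamma>1 s - \<gamma>1 s0 - (s - s0) *\<^sub>R \<gamma>2 s0) \<le> M * \<bar>s - s0\<bar>^2" for s s0
  proof -
    have "((\<lambda>s. \<gamma>1 s - (s - s0) *\<^sub>R \<gamma>2 s0) has_vector_derivative \<gamma>2 s - \<gamma>2 s0) (at s)" for s
      by (intro has_vector_derivative_diff l D\<gamma>1)
    from has_vector_derivative_power_bound[OF this b(2), of s] M show ?thesis
      by (simp add: algebra_simps numeral_eq_Suc)
  qed
  have c2: "norm (\<gamma>2 s - \<gamma>2 s0 - (s - s0) *\<^sub>R \<gamma>3 s0) \<le> M * \<bar>s - s0\<bar>^2" for s s0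
  proof -
    have "((\<lambda>s. \<gamma>2 s - (s - s0) *\<^sub>R \<gamma>3 s0) has_vector_derivative \<gamma>3 s - \<gamma>3 s0) (at s)" for s
      by (intro has_vector_derivative_diff l D\<gamma>2)
    from has_vector_derivative_power_bound[OF this b(3), of s] M show ?thesis
      by (simp add: algebra_simps numeral_eq_Suc)
  qed
  have q: "((\<lambda>s. ((s - s0)^2 / 2) *\<^sub>R v) has_vector_derivative (s - s0) *\<^sub>R v) (at s)"
    "((\<lambda>s. ((s - s0)^3 / 6) *\<^sub>R v) has_vector_derivative ((s - s0)^2 / 2) *\<^sub>R v) (at s)"
    for s s0 :: real and v :: plane
  proof -
    have "((\<lambda>s. ((s - s0)^2 / 2) *\<^sub>R v) has_vector_derivative ((s - s0)^2 / 2) *\<^sub>R 0 + (s - s0) *\<^sub>R v) (at s)"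
      by (intro has_vector_derivative_scaleR) (auto intro!: derivative_eq_intros)
    moreover have "((\<lambda>s. ((s - s0)^3 / 6) *\<^sub>R v) has_vector_derivative ((s - s0)^3 / 6) *\<^sub>R 0 + ((s - s0)^2 / 2) *\<^sub>R v) (at s)"
      by (intro has_vector_derivative_scaleR) (auto intro!: derivative_eq_intros)
    ultimately show "((\<lambda>s. ((s - s0)^2 / 2) *\<^sub>R v) has_vector_derivative (s - s0) *\<^sub>R v) (at s)"
      "((\<lambda>s. ((s - s0)^3 / 6) *\<^sub>R v) has_vector_derivative ((s - s0)^2 / 2) *\<^sub>R v) (at s)"
      by simp_all
  qed
  have d0: "norm (\<gamma> s - \<gamma> s0 - (s - s0) *\<^sub>R \<gamma>1 s0 - ((s - s0)^2 / 2) *\<^sub>R \<gamma>2 s0) \<le> M * \<bar>s - s0\<bar>^3" for s s0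
  proof -
    have "((\<lambda>s. \<gamma> s - (s - s0) *\<^sub>R \<gamma>1 s0 - ((s - s0)^2 / 2) *\<^sub>R \<gamma>2 s0) has_vector_derivative
        \<gamma>1 s - \<gamma>1 s0 - (s - s0) *\<^sub>R \<gamma>2 s0) (at s)" for s
      by (intro has_vector_derivative_diff l q D\<gamma>)
    from has_vector_derivative_power_bound[OF this c1, of s] M show ?thesis
      by (simp add: algebra_simps numeral_eq_Suc)
  qed
  have d1: "norm (\<gamma>1 s - \<gamma>1 s0 - (s - s0) *\<^sub>R \<gamma>2 s0 - ((s - s0)^2 / 2) *\<^sub>R \<gamma>3 s0) \<le> M * \<bar>s - s0\<bar>^3" for s s0
  proof -
    have "((\<lambda>s. \<gamma>1 s - (s - s0) *\<^sub>R \<gamma>2 s0 - ((s - s0)^2 / 2) *\<^sub>R \<gamma>3 s0) has_vector_derivative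
        \<gamma>2 s - \<gamma>2 s0 - (s - s0) *\<^sub>R \<gamma>3 s0) (at s)" for s
      by (intro has_vector_derivative_diff l q D\<gamma>1)
    from has_vector_derivative_power_bound[OF this c2, of s] M show ?thesis
      by (simp add: algebra_simps numeral_eq_Suc)
  qed
  have e0: "norm (\<gamma> s - \<gamma> s0 - (s - s0) *\<^sub>R \<gamma>1 s0 - ((s - s0)^2 / 2) *\<^sub>R \<gamma>2 s0 - ((s - s0)^3 / 6) *\<^sub>R \<gamma>3 s0)
      \<le> M * \<bar>s - s0\<bar>^4" for s s0
  proof -
    have "((\<lambda>s. \<gamma> s - (s - s0) *\<^sub>R \<gamma>1 s0 - ((s - s0)^2 / 2) *\<^sub>R \<gamma>2 s0 - ((s - s0)^3 / 6) *\<^sub>R \<gamma>3 s0) has_vector_derivative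
        \<gamma>1 s - \<gamma>1 s0 - (s - s0) *\<^sub>R \<gamma>2 s0 - ((s - s0)^2 / 2) *\<^sub>R \<gamma>3 s0) (at s)" for s
      by (intro has_vector_derivative_diff l q D\<gamma>)
    from has_vector_derivative_power_bound[OF this d1, of s] M show ?thesis
      by (simp add: algebra_simps numeral_eq_Suc)
  qed
  have "taylor_bound M"
    unfolding taylor_bound_def by (intro conjI allI M c0 c1 d0 d1 e0)
  then show ?thesis ..
qed

section \<open>The moving frame, the normal tube and nearest points\<close>

lemma norm_normal: "norm (\<nu> s) = 1" and normal_orth: "\<nu> s \<bullet> \<gamma>1 s = 0"
  using norm_velocity[of s]
  by (auto simp: unit_normal_def norm_Pair norm_prod_def add.commute plane_inner)

lemma inner_velocity: "\<gamma>1 s \<bullet> \<gamma>1 s = 1" and inner_normal: "\<nu> s \<bullet> \<nu> s = 1"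
  by (simp_all only: dot_square_norm norm_velocity norm_normal one_power2)

lemma frame_expansion: "v = (v \<bullet> \<gamma>1 s) *\<^sub>R \<gamma>1 s + (v \<bullet> \<nu> s) *\<^sub>R \<nu> s"
proof -
  obtain a b where ab: "\<gamma>1 s = (a, b)" by force
  obtain x y where xy: "v = (x, y)" by force
  have 1: "a * a + b * b = 1" using inner_velocity[of s] by (simp add: ab)
  have "x = (x * a + y * b) * a + (- x * b + y * a) * - b"
    "y = (x * a + y * b) * b + (- x * b + y * a) * a"
    using 1 by algebra+
  then show ?thesis by (simp add: ab xy unit_normal_def)
qed

text \<open>Differentiate \<open>\<gamma>1 s \<bullet> \<gamma>1 s = 1\<close> twice; since
  \<open>\<gamma>2 s\<close> is a multiple of the normal, its squared length is the square of its
  normal component.\<close>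

lemma velocity_acceleration: "\<gamma>1 s \<bullet> \<gamma>2 s = 0"
  and velocity_jerk: "\<gamma>1 s \<bullet> \<gamma>3 s = - (\<gamma>2 s \<bullet> \<nu> s)\<^sup>2"
proof -
  have "((\<lambda>s. \<gamma>1 s \<bullet> \<gamma>1 s) has_vector_derivative \<gamma>1 s \<bullet> \<gamma>2 s + \<gamma>2 s \<bullet> \<gamma>1 s) (at s)" for s
    by (rule bounded_bilinear.has_vector_derivative[OF bounded_bilinear_inner D\<gamma>1 D\<gamma>1])
  moreover have "(\<lambda>s. \<gamma>1 s \<bullet> \<gamma>1 s) = (\<lambda>s. 1)" using inner_velocity by auto
  ultimately have "((\<lambda>s. 1) has_vector_derivative \<gamma>1 s \<bullet> \<gamma>2 s + \<gamma>2 s \<bullet> \<gamma>1 s) (at s)" for s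
    by (simp only:)
  then have "\<gamma>1 s \<bullet> \<gamma>2 s + \<gamma>2 s \<bullet> \<gamma>1 s = 0" for s
    by (rule vector_derivative_unique_at[OF _ has_vector_derivative_const])
  then have 0: "\<gamma>1 s \<bullet> \<gamma>2 s = 0" for s by (simp add: inner_commute)
  then show "\<gamma>1 s \<bullet> \<gamma>2 s = 0" .
  have "((\<lambda>s. \<gamma>1 s \<bullet> \<gamma>2 s) has_vector_derivative \<gamma>1 s \<bullet> \<gamma>3 s + \<gamma>2 s \<bullet> \<gamma>2 s) (at s)" for s
    by (rule bounded_bilinear.has_vector_derivative[OF bounded_bilinear_inner D\<gamma>1 D\<gamma>2])
  moreover have "(\<lambda>s. \<gamma>1 s \<bullet> \<gamma>2 s) = (\<lambda>s. 0)" using 0 by auto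
  ultimately have "((\<lambda>s. 0) has_vector_derivative \<gamma>1 s \<bullet> \<gamma>3 s + \<gamma>2 s \<bullet> \<gamma>2 s) (at s)"
    by (simp only:)
  then have 1: "\<gamma>1 s \<bullet> \<gamma>3 s + \<gamma>2 s \<bullet> \<gamma>2 s = 0"
    by (rule vector_derivative_unique_at[OF _ has_vector_derivative_const])
  have "\<gamma>2 s = (\<gamma>2 s \<bullet> \<nu> s) *\<^sub>R \<nu> s" using frame_expansion[of "\<gamma>2 s" s] 0[of s] by (simp add: inner_commute)
  then have "\<gamma>2 s \<bullet> \<gamma>2 s = (\<gamma>2 s \<bullet> \<nu> s)\<^sup>2"
    by (metis inner_normal inner_scaleR_left inner_scaleR_right mult.right_neutral power2_eq_square)
  with 1 show "\<gamma>1 s \<bullet> \<gamma>3 s = - (\<gamma>2 s \<bullet> \<nu> s)\<^sup>2" by simp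
qed

text \<open>The normal is the velocity turned by a right angle, so expansions of the velocity also
  serve for the normal.\<close>

lemma normal_inner_velocity: "\<nu> s \<bullet> \<gamma>1 s0 = - (\<gamma>1 s \<bullet> \<nu> s0)"
  and normal_inner_normal: "\<nu> s \<bullet> \<nu> s0 = \<gamma>1 s \<bullet> \<gamma>1 s0"
  by (simp_all add: plane_inner unit_normal_def)

lemma tube_inj:
  assumes "\<gamma> s + t *\<^sub>R \<nu> s = \<gamma> s' + t' *\<^sub>R \<nu> s'" "\<bar>t\<bar> < R" "\<bar>t'\<bar> < R"
  shows "t = t'" "\<exists>k::int. s' = s + of_int k * len"
proof -
  have \<nu>p: "\<nu> (s + of_int k * len) = \<nu> s" for s and k :: int
    using periodic_int[of \<gamma>1, OF period1] by (simp add: unit_normal_def)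
  obtain a j where a: "a \<in> {0..<len}" "s = a + of_int j * len" using reduce_mod_period by metis
  obtain a' j' where a': "a' \<in> {0..<len}" "s' = a' + of_int j' * len" using reduce_mod_period by metis
  have "\<gamma> a + t *\<^sub>R \<nu> a = \<gamma> a' + t' *\<^sub>R \<nu> a'"
    using assms(1) unfolding a(2) a'(2) \<nu>p using periodic_int[of \<gamma>, OF period] by simp
  with inj_onD[OF tube[unfolded embedded_tube_def], of "(a, t)" "(a', t')"] a(1) a'(1) assms
  have "(a, t) = (a', t')" by (auto simp: abs_less_iff)
  then show "t = t'" "\<exists>k::int. s' = s + of_int k * len"
    using a(2) a'(2) by (auto intro!: exI[of _ "j' - j"] simp: algebra_simps)
qed

text \<open>For short arcs the chord is at least half the arc, by Taylor expansion. For longer arcs,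
  taken modulo the period, the chord has a positive minimum by compactness and injectivity; a chord
  below it therefore comes from a short arc.\<close>

lemma chord_arc:
  "\<exists>\<eta>>0. \<forall>s0 s1. norm (\<gamma> s1 - \<gamma> s0) < \<eta> \<longrightarrow>
     (\<exists>k::int. \<bar>s1 + of_int k * len - s0\<bar> \<le> 2 * norm (\<gamma> s1 - \<gamma> s0))"
proof -
  obtain M where "taylor_bound M" using curve_taylor ..
  note M = taylor_boundD(1)[OF this] and T = taylor_boundD(4)[OF this]
  have local_bound: "\<bar>s - s0\<bar> \<le> 2 * norm (\<gamma> s - \<gamma> s0)" if "\<bar>s - s0\<bar> \<le> 1 / (2 * M)" for s s0
  proof -
    have "\<bar>s - s0\<bar> = norm ((s - s0) *\<^sub>R \<gamma>1 s0)" using norm_velocity by simp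
    also have "\<dots> \<le> norm (\<gamma> s - \<gamma> s0) + norm (\<gamma> s - \<gamma> s0 - (s - s0) *\<^sub>R \<gamma>1 s0)"
      by (metis norm_minus_commute norm_triangle_sub)
    also have "\<dots> \<le> norm (\<gamma> s - \<gamma> s0) + (M * \<bar>s - s0\<bar>) * \<bar>s - s0\<bar>"
      using T[of s s0] by (simp add: power2_eq_square)
    also have "\<dots> \<le> norm (\<gamma> s - \<gamma> s0) + 1/2 * \<bar>s - s0\<bar>"
      using that M by (intro add_left_mono mult_right_mono) (auto simp: field_simps)
    finally show ?thesis by simp
  qed
  define \<eta>1 where "\<eta>1 = min (1 / (2 * M)) (len / 2)"
  have \<eta>1: "\<eta>1 > 0" using M len by (simp add: \<eta>1_def)
  \<comment> \<open>Pairs of a parameter and an offset, where the offset runs through a symmetric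
    period with a neighbourhood of 0 removed.\<close>
  define K where "K = {0..len} \<times> ({-(len/2)..-\<eta>1} \<union> {\<eta>1..len/2})"
  have "compact K" unfolding K_def by (intro compact_Times compact_Un) auto
  moreover have "K \<noteq> {}" using len \<eta>1 by (auto simp: K_def \<eta>1_def)
  moreover have "continuous_on K (\<lambda>(a, d). norm (\<gamma> (a + d) - \<gamma> a))"
    unfolding case_prod_unfold
    by (intro continuous_intros continuous_on_compose2[OF continuous_curve(1)[of UNIV]]) auto
  ultimately obtain z where z: "z \<in> K"
    and min: "\<And>w. w \<in> K \<Longrightarrow> norm (\<gamma> (fst z + snd z) - \<gamma> (fst z)) \<le> norm (\<gamma> (fst w + snd w) - \<gamma> (fst w))"
    using continuous_attains_inf[of K "\<lambda>(a, d). norm (\<gamma> (a + d) - \<gamma> a)"]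
    by (auto simp: case_prod_unfold)
  define \<eta> where "\<eta> = norm (\<gamma> (fst z + snd z) - \<gamma> (fst z))"
  have "\<eta> > 0"
  proof (rule ccontr)
    assume "\<not> \<eta> > 0"
    then have "\<gamma> (fst z + snd z) = \<gamma> (fst z)" by (simp add: \<eta>_def)
    then obtain k :: int where k: "snd z = of_int k * len"
      using tube_inj(2)[of "fst z" 0 "fst z + snd z" 0] R by auto
    have "0 < \<bar>snd z\<bar>" "\<bar>snd z\<bar> \<le> len / 2" using z \<eta>1 by (auto simp: K_def)
    then have "k \<noteq> 0" "of_int \<bar>k\<bar> * len \<le> 1/2 * len" using k len by (auto simp: abs_mult)
    then have "of_int \<bar>k\<bar> \<le> (1/2::real)" using len by (simp only: mult_le_cancel_right_pos)
    then show False using \<open>k \<noteq> 0\<close> by linarith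
  qed
  moreover have "\<exists>k::int. \<bar>s1 + of_int k * len - s0\<bar> \<le> 2 * norm (\<gamma> s1 - \<gamma> s0)"
    if near: "norm (\<gamma> s1 - \<gamma> s0) < \<eta>" for s0 s1
  proof -
    obtain a j where a: "a \<in> {0..<len}" "s0 = a + of_int j * len" using reduce_mod_period by metis
    \<comment> \<open>Subtracting the nearest multiple of the period brings the offset into
      \<open>[-len/2, len/2]\<close>.\<close>
    define m where "m = round ((s1 - a) / len)"
    define d where "d = s1 - of_int m * len - a"
    have "\<bar>of_int m - (s1 - a) / len\<bar> \<le> 1/2" unfolding m_def by (rule of_int_round_abs_le)
    then have "\<bar>of_int m - (s1 - a) / len\<bar> * len \<le> 1/2 * len" using len by (intro mult_right_mono) auto
    then have "\<bar>(of_int m - (s1 - a) / len) * len\<bar> \<le> len / 2" using len by (simp add: abs_mult)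
    moreover have "(of_int m - (s1 - a) / len) * len = - d" using len by (simp add: d_def field_simps)
    ultimately have d: "\<bar>d\<bar> \<le> len / 2" by simp
    have eq: "\<gamma> s0 = \<gamma> a" "\<gamma> (a + d) = \<gamma> s1"
      using periodic_int[of \<gamma>, OF period, of a j] periodic_int[of \<gamma>, OF period, of s1 "- m"] a
      by (auto simp: d_def)
    have "(a, d) \<notin> K" using min[of "(a, d)"] near eq by (auto simp: \<eta>_def)
    then have "\<bar>d\<bar> < \<eta>1" using a d by (auto simp: K_def)
    then have "\<bar>d\<bar> \<le> 2 * norm (\<gamma> s1 - \<gamma> s0)" using local_bound[of "a + d" a] eq by (simp add: \<eta>1_def)
    then show ?thesis by (intro exI[of _ "j - m"]) (simp add: a(2) d_def algebra_simps)
  qed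
  ultimately show ?thesis by (intro exI[of _ \<eta>] conjI allI impI)
qed

lemma compact_curve: "compact (range \<gamma>)"
proof -
  have "range \<gamma> = \<gamma> ` {0..len}"
  proof -
    have "\<gamma> s \<in> \<gamma> ` {0..len}" for s
    proof -
      obtain s' k where "s' \<in> {0..<len}" "s = s' + of_int k * len" using reduce_mod_period by metis
      then show ?thesis using periodic_int[of \<gamma>, OF period, of s' k] by (auto intro!: image_eqI[of _ _ s'])
    qed
    then show ?thesis by auto
  qed
  then show ?thesis using compact_continuous_image[OF continuous_curve(1)] by simp
qed

text \<open>At a nearest curve point the derivative of the squared distance vanishes, so the offset
  is orthogonal to the velocity and hence a multiple of the normal. This holds for every point of
  the plane; the tube enters only for uniqueness.\<close>

lemma nearest_point: "\<exists>s t. p = \<gamma> s + t *\<^sub>R \<nu> s \<and> infdist p (range \<gamma>) = \<bar>t\<bar>"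
proof -
  obtain s where s: "infdist p (range \<gamma>) = dist p (\<gamma> s)"
    using infdist_attains_inf[OF compact_imp_closed[OF compact_curve]] by blast
  have min: "dist p (\<gamma> s) \<le> dist p (\<gamma> s')" for s' using s infdist_le[of "\<gamma> s'" "range \<gamma>" p] by simp
  have "((\<lambda>s. (p - \<gamma> s) \<bullet> (p - \<gamma> s)) has_vector_derivative (p - \<gamma> s) \<bullet> (0 - \<gamma>1 s) + (0 - \<gamma>1 s) \<bullet> (p - \<gamma> s)) (at s)"
    by (rule bounded_bilinear.has_vector_derivative[OF bounded_bilinear_inner])
       (intro has_vector_derivative_diff has_vector_derivative_const D\<gamma>)+
  then have "((\<lambda>s. (p - \<gamma> s) \<bullet> (p - \<gamma> s)) has_real_derivative - 2 * ((p - \<gamma> s) \<bullet> \<gamma>1 s)) (at s)"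
    by (simp add: has_real_derivative_iff_has_vector_derivative inner_commute)
  moreover have "(p - \<gamma> s) \<bullet> (p - \<gamma> s) \<le> (p - \<gamma> s') \<bullet> (p - \<gamma> s')" for s'
    using min[of s'] by (simp add: dot_square_norm dist_norm power_mono)
  ultimately have "(p - \<gamma> s) \<bullet> \<gamma>1 s = 0"
    using DERIV_local_min[of "\<lambda>s. (p - \<gamma> s) \<bullet> (p - \<gamma> s)" "- 2 * ((p - \<gamma> s) \<bullet> \<gamma>1 s)" s 1] by auto
  then have *: "p - \<gamma> s = ((p - \<gamma> s) \<bullet> \<nu> s) *\<^sub>R \<nu> s" using frame_expansion[of "p - \<gamma> s" s] by simp
  then have "dist p (\<gamma> s) = \<bar>(p - \<gamma> s) \<bullet> \<nu> s\<bar>" using norm_normal[of s]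
    by (metis dist_norm mult.right_neutral norm_scaleR)
  then show ?thesis using * s
    by (intro exI[of _ s] exI[of _ "(p - \<gamma> s) \<bullet> \<nu> s"]) (auto simp: algebra_simps)
qed

end

section \<open>Taylor polynomials of the signed distance\<close>

text \<open>Boundedness in the index is preserved by polynomial operations, so the bounds on
  remainders and coefficients below follow from the syntax of the expressions, without explicit
  constants.\<close>

definition bdd_on :: "'i set \<Rightarrow> ('i \<Rightarrow> real) \<Rightarrow> bool" where
  "bdd_on I f \<longleftrightarrow> (\<exists>C. \<forall>i\<in>I. \<bar>f i\<bar> \<le> C)"

lemma bdd_onI: "(\<And>i. i \<in> I \<Longrightarrow> \<bar>f i\<bar> \<le> C) \<Longrightarrow> bdd_on I f"
  by (auto simp: bdd_on_def)

lemma bdd_on_const: "bdd_on I (\<lambda>_. c)"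
  by (rule bdd_onI) auto

lemma bdd_on_add:
  assumes "bdd_on I f" "bdd_on I g"
  shows "bdd_on I (\<lambda>i. f i + g i)"
proof -
  from assms obtain C D where "\<forall>i\<in>I. \<bar>f i\<bar> \<le> C" "\<forall>i\<in>I. \<bar>g i\<bar> \<le> D" by (auto simp: bdd_on_def)
  then show ?thesis by (intro bdd_onI[of _ _ "C + D"]) (meson abs_triangle_ineq add_mono order_trans)
qed

lemma bdd_on_mult:
  assumes "bdd_on I f" "bdd_on I g"
  shows "bdd_on I (\<lambda>i. f i * g i)"
proof -
  from assms obtain C D where "\<forall>i\<in>I. \<bar>f i\<bar> \<le> C" "\<forall>i\<in>I. \<bar>g i\<bar> \<le> D" by (auto simp: bdd_on_def)
  then show ?thesis
    by (intro bdd_onI[of _ _ "C * D"]) (auto simp: abs_mult intro!: mult_mono intro: order_trans[OF abs_ge_zero])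
qed

lemma bdd_on_uminus: "bdd_on I f \<Longrightarrow> bdd_on I (\<lambda>i. - f i)"
  by (simp add: bdd_on_def)

lemma bdd_on_diff: "bdd_on I f \<Longrightarrow> bdd_on I g \<Longrightarrow> bdd_on I (\<lambda>i. f i - g i)"
  using bdd_on_add[of I f "\<lambda>i. - g i"] bdd_on_uminus[of I g] by simp

lemma bdd_on_divide: "bdd_on I f \<Longrightarrow> bdd_on I (\<lambda>i. f i / c)"
  using bdd_on_mult[OF _ bdd_on_const, of I f "1 / c"] by simp

lemma bdd_on_power: "bdd_on I f \<Longrightarrow> bdd_on I (\<lambda>i. f i ^ n)"
  by (induction n) (auto intro: bdd_on_const bdd_on_mult)

lemmas bdd_on_intros = bdd_on_const bdd_on_add bdd_on_mult bdd_on_uminus bdd_on_diff bdd_on_divide bdd_on_power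

text \<open>Here \<open>(x, y)\<close> are the coordinates, in the frame of the curve at a base point, of the point at
  signed distance \<open>t = \<rho> v\<close> from the curve point at arc length \<open>\<rho> u\<close>; the cubic polynomial is the
  Taylor polynomial of the signed distance, and its coefficients were found by matching the terms
  of degree up to \<open>3\<close> in \<open>\<rho>\<close>.\<close>

lemma signed_distance_expansion:
  fixes M :: real
  shows "\<exists>C. \<forall>\<rho> u v \<kappa> k A A' B B' x y.
     0 \<le> \<rho> \<and> \<rho> \<le> 1 \<and> \<bar>u\<bar> \<le> 1 \<and> \<bar>v\<bar> \<le> 1 \<and> \<bar>\<kappa>\<bar> \<le> M \<and> \<bar>k\<bar> \<le> M \<and>
     \<bar>A\<bar> \<le> M \<and> \<bar>A'\<bar> \<le> M \<and> \<bar>B\<bar> \<le> M \<and> \<bar>B'\<bar> \<le> M \<and>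
     x = \<rho> * u + \<rho>^3 * A - \<rho> * v * (\<kappa> * \<rho> * u + \<rho>^2 * A') \<and>
     y = \<kappa> * (\<rho> * u)^2 / 2 + k * (\<rho> * u)^3 / 6 + \<rho>^4 * B + \<rho> * v * (1 - \<kappa>^2 * (\<rho> * u)^2 / 2 + \<rho>^3 * B')
     \<longrightarrow> \<bar>y - \<kappa> / 2 * x^2 - k / 6 * x^3 - \<kappa>^2 / 2 * (x^2 * y) - \<rho> * v\<bar> \<le> C * \<rho>^4"
proof -
  \<comment> \<open>The values \<open>i 0\<close> to \<open>i 8\<close> stand for \<rho>,
    \<open>u\<close>, \<open>v\<close>, \<kappa>, \<open>k\<close>, \<open>A\<close>,
    \<open>A'\<close>, \<open>B\<close>, \<open>B'\<close>. Then \<open>x = \<rho> * X i\<close> and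
    \<open>y = \<rho> * Y i\<close>; the others collect what the leading terms leave over, and the
    whole error is \<open>\<rho>^4 * Q i\<close>.\<close>
  define E where "E i = i 5 - i 2 * i 6" for i :: "nat \<Rightarrow> real"
  define X where "X i = i 1 - i 0 * i 3 * i 1 * i 2 + i 0 ^2 * E i" for i :: "nat \<Rightarrow> real"
  define F where "F i = i 3^2 * i 1^2 * i 2^2 + 2 * (i 1 - i 0 * i 3 * i 1 * i 2) * E i + i 0^2 * E i^2" for i :: "nat \<Rightarrow> real"
  define G where "G i = (- i 3 * i 1 * i 2 + i 0 * E i) * (X i^2 + X i * i 1 + i 1^2)" for i :: "nat \<Rightarrow> real"
  define H where "H i = i 7 + i 2 * i 8" for i :: "nat \<Rightarrow> real"
  define Z where "Z i = i 3 * i 1^2 / 2 + i 0 * (i 4 * i 1^3 / 6 - i 3^2 * i 1^2 * i 2 / 2) + i 0^2 * H i" for i :: "nat \<Rightarrow> real"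
  define Y where "Y i = i 2 + i 0 * Z i" for i :: "nat \<Rightarrow> real"
  define K where "K i = (- 2 * i 3 * i 1^2 * i 2 + i 0 * F i) * Y i + i 1^2 * Z i" for i :: "nat \<Rightarrow> real"
  define Q where "Q i = H i - i 3 * F i / 2 - i 4 * G i / 6 - i 3^2 * K i / 2" for i :: "nat \<Rightarrow> real"
  define I :: "(nat \<Rightarrow> real) set" where "I = {i. \<forall>k. \<bar>i k\<bar> \<le> max M 1}"
  have proj: "bdd_on I (\<lambda>i. i k)" for k by (rule bdd_onI[of _ _ "max M 1"]) (auto simp: I_def)
  have "bdd_on I Q"
    unfolding Q_def[abs_def] K_def Y_def Z_def H_def G_def F_def X_def E_def by (intro bdd_on_intros proj)
  then obtain C where C: "\<And>i. i \<in> I \<Longrightarrow> \<bar>Q i\<bar> \<le> C" by (auto simp: bdd_on_def)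
  have main: "\<bar>y - \<kappa> / 2 * x^2 - k / 6 * x^3 - \<kappa>^2 / 2 * (x^2 * y) - \<rho> * v\<bar> \<le> C * \<rho>^4"
    if h: "0 \<le> \<rho>" "\<rho> \<le> 1" "\<bar>u\<bar> \<le> 1" "\<bar>v\<bar> \<le> 1" "\<bar>\<kappa>\<bar> \<le> M" "\<bar>k\<bar> \<le> M"
     "\<bar>A\<bar> \<le> M" "\<bar>A'\<bar> \<le> M" "\<bar>B\<bar> \<le> M" "\<bar>B'\<bar> \<le> M"
     and x: "x = \<rho> * u + \<rho>^3 * A - \<rho> * v * (\<kappa> * \<rho> * u + \<rho>^2 * A')"
     and y: "y = \<kappa> * (\<rho> * u)^2 / 2 + k * (\<rho> * u)^3 / 6 + \<rho>^4 * B + \<rho> * v * (1 - \<kappa>^2 * (\<rho> * u)^2 / 2 + \<rho>^3 * B')"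
   for \<rho> u v \<kappa> k A A' B B' x y
  proof -
    define i where "i = (\<lambda>_::nat. 0::real)(0 := \<rho>, 1 := u, 2 := v, 3 := \<kappa>, 4 := k, 5 := A, 6 := A', 7 := B, 8 := B')"
    have ix: "i 0 = \<rho>" "i 1 = u" "i 2 = v" "i 3 = \<kappa>" "i 4 = k" "i 5 = A" "i 6 = A'" "i 7 = B" "i 8 = B'"
      by (auto simp: i_def)
    have iI: "i \<in> I"
    proof -
      define m where "m = max M 1"
      have b: "\<bar>\<rho>\<bar> \<le> m" "\<bar>u\<bar> \<le> m" "\<bar>v\<bar> \<le> m" "\<bar>\<kappa>\<bar> \<le> m" "\<bar>k\<bar> \<le> m" "\<bar>A\<bar> \<le> m" "\<bar>A'\<bar> \<le> m" "\<bar>B\<bar> \<le> m" "\<bar>B'\<bar> \<le> m" "0 \<le> m"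
        using h unfolding m_def by linarith+
      have upd: "\<forall>l. \<bar>(f(a := z)) l\<bar> \<le> m" if "\<forall>l. \<bar>f l\<bar> \<le> m" "\<bar>z\<bar> \<le> m" for f :: "nat \<Rightarrow> real" and a z
        using that by simp
      have "\<forall>l. \<bar>i l\<bar> \<le> m" unfolding i_def by (intro upd b(1-9)) (simp add: b(10))
      then show ?thesis unfolding I_def m_def by blast
    qed
    note d = E_def[of i] X_def[of i] F_def[of i] G_def[of i] H_def[of i] Z_def[of i] Y_def[of i] K_def[of i] Q_def[of i]
    note d = d[unfolded ix]
    have xX: "x = \<rho> * X i" unfolding x d by algebra
    have yY: "y = \<rho> * Y i" unfolding y d by (simp add: field_simps power2_eq_square power3_eq_cube power4_eq_xxxx)
    have X2: "(X i)^2 = u^2 - 2 * \<rho> * \<kappa> * u^2 * v + \<rho>^2 * F i" unfolding d(2,3) by algebra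
    have X3: "(X i)^3 = u^3 + \<rho> * G i"
    proof -
      have "(X i)^3 = u^3 + (X i - u) * (X i^2 + X i * u + u^2)" by algebra
      also have "X i - u = \<rho> * (- \<kappa> * u * v + \<rho> * E i)" unfolding d(2) by algebra
      finally show ?thesis unfolding d(4) by (simp add: mult.assoc)
    qed
    have XY: "(X i)^2 * Y i = u^2 * v + \<rho> * K i"
    proof -
      have "(X i)^2 * Y i = u^2 * v + ((X i)^2 - u^2) * Y i + u^2 * (Y i - v)" by algebra
      also have "(X i)^2 - u^2 = \<rho> * (- 2 * \<kappa> * u^2 * v + \<rho> * F i)" unfolding X2 by algebra
      also have "Y i - v = \<rho> * Z i" unfolding d(7) by simp
      finally show ?thesis unfolding d(8) by (simp add: algebra_simps)
    qed
    have "y - \<kappa> / 2 * x^2 - k / 6 * x^3 - \<kappa>^2 / 2 * (x^2 * y) - \<rho> * v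
        = \<rho> * Y i - \<kappa> / 2 * \<rho>^2 * (X i)^2 - k / 6 * \<rho>^3 * (X i)^3 - \<kappa>^2 / 2 * \<rho>^3 * ((X i)^2 * Y i) - \<rho> * v"
      unfolding xX yY by (simp add: field_simps power2_eq_square power3_eq_cube)
    \<comment> \<open>All terms below fourth order cancel. The mixed term in
      \<open>\<kappa>^2 * u^2 * v\<close> occurs with the factors -1/2 from \<open>y\<close>, 1 from
      \<open>x^2\<close> and -1/2 from \<open>x^2 * y\<close>, which is where the last term of the
      polynomial comes from.\<close>
    also have "\<dots> = \<rho>^4 * Q i"
      unfolding XY unfolding X2 X3 unfolding d(9) d(7) d(6)
      by (simp add: field_simps power2_eq_square power3_eq_cube power4_eq_xxxx)
    finally have "\<bar>y - \<kappa> / 2 * x^2 - k / 6 * x^3 - \<kappa>^2 / 2 * (x^2 * y) - \<rho> * v\<bar> = \<rho>^4 * \<bar>Q i\<bar>"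
      by (simp add: abs_mult)
    then show ?thesis using C[OF iI] h(1) by (simp add: mult.commute mult_left_mono mult_right_mono)
  qed
  show ?thesis by (intro exI[of _ C] allI impI, elim conjE) (rule main)
qed

context interface_curve
begin

text \<open>\<open>curv\<close> is the signed curvature and \<open>curv'\<close> its derivative:
  differentiating \<open>\<gamma>2 s \<bullet> \<nu> s\<close> also produces the product of
  \<open>\<gamma>2\<close> with the derivative of the normal, which vanishes because that derivative
  is tangential.\<close>

definition curv :: "real \<Rightarrow> real" where "curv s = \<gamma>2 s \<bullet> \<nu> s"
definition curv' :: "real \<Rightarrow> real" where "curv' s = \<gamma>3 s \<bullet> \<nu> s"
definition tcoord :: "real \<Rightarrow> plane \<Rightarrow> real" where "tcoord s p = (p - \<gamma> s) \<bullet> \<gamma>1 s"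
definition ncoord :: "real \<Rightarrow> plane \<Rightarrow> real" where "ncoord s p = (p - \<gamma> s) \<bullet> \<nu> s"

text \<open>The polynomial of \<open>signed_distance_expansion\<close> in the frame at
  \<open>\<gamma> s\<close>. Each of its terms is a product of at most three affine functions of
  \<open>p\<close>, as the uniform approximation requires.\<close>

definition dist_poly :: "real \<Rightarrow> plane \<Rightarrow> real" where
  "dist_poly s p = ncoord s p - curv s / 2 * (tcoord s p)^2 - curv' s / 6 * (tcoord s p)^3
     - (curv s)^2 / 2 * ((tcoord s p)^2 * ncoord s p)"

lemma dist_poly_normal: "dist_poly s (\<gamma> s + t *\<^sub>R \<nu> s) = t"
  by (simp add: dist_poly_def tcoord_def ncoord_def normal_orth inner_normal)

lemma abs_inner_unit: "norm e = 1 \<Longrightarrow> \<bar>v \<bullet> e\<bar> \<le> norm v"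
  using Cauchy_Schwarz_ineq2[of v e] by simp

text \<open>Scaling arc length and normal offset by \<rho>, and dividing each Taylor remainder by
  the matching power of \<rho>, leaves bounded quantities to which
  \<open>signed_distance_expansion\<close> applies.\<close>

lemma dist_poly_tube:
  "\<exists>C. \<forall>s0 s t \<rho>. 0 < \<rho> \<and> \<rho> \<le> 1 \<and> \<bar>s - s0\<bar> \<le> \<rho> \<and> \<bar>t\<bar> \<le> \<rho> \<longrightarrow>
     \<bar>dist_poly s0 (\<gamma> s + t *\<^sub>R \<nu> s) - t\<bar> \<le> C * \<rho>^4"
proof -
  obtain M where "taylor_bound M" using curve_taylor ..
  note M = taylor_boundD[OF this]
  obtain C where C: "\<forall>\<rho> u v \<kappa> k A A' B B' x y.
     0 \<le> \<rho> \<and> \<rho> \<le> 1 \<and> \<bar>u\<bar> \<le> 1 \<and> \<bar>v\<bar> \<le> 1 \<and> \<bar>\<kappa>\<bar> \<le> M \<and> \<bar>k\<bar> \<le> M \<and>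
     \<bar>A\<bar> \<le> M \<and> \<bar>A'\<bar> \<le> M \<and> \<bar>B\<bar> \<le> M \<and> \<bar>B'\<bar> \<le> M \<and>
     x = \<rho> * u + \<rho>^3 * A - \<rho> * v * (\<kappa> * \<rho> * u + \<rho>^2 * A') \<and>
     y = \<kappa> * (\<rho> * u)^2 / 2 + k * (\<rho> * u)^3 / 6 + \<rho>^4 * B + \<rho> * v * (1 - \<kappa>^2 * (\<rho> * u)^2 / 2 + \<rho>^3 * B')
     \<longrightarrow> \<bar>y - \<kappa> / 2 * x^2 - k / 6 * x^3 - \<kappa>^2 / 2 * (x^2 * y) - \<rho> * v\<bar> \<le> C * \<rho>^4"
    using signed_distance_expansion[of M] ..
  have main: "\<bar>dist_poly s0 (\<gamma> s + t *\<^sub>R \<nu> s) - t\<bar> \<le> C * \<rho>^4"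
    if \<rho>: "0 < \<rho>" "\<rho> \<le> 1" and s: "\<bar>s - s0\<bar> \<le> \<rho>" and t: "\<bar>t\<bar> \<le> \<rho>" for s0 s t \<rho>
  proof -
    define u v where "u = (s - s0) / \<rho>" and "v = t / \<rho>"
    have uv: "s - s0 = \<rho> * u" "t = \<rho> * v" "\<bar>u\<bar> \<le> 1" "\<bar>v\<bar> \<le> 1"
      using \<rho> s t by (auto simp: u_def v_def abs_divide)
    have pw: "M * \<bar>s - s0\<bar>^j \<le> M * \<rho>^j" for j
      using s M(1) by (intro mult_left_mono power_mono) auto
    have rem: "\<bar>(v / \<rho>^j)\<bar> \<le> M" if "\<bar>v\<bar> \<le> M * \<bar>s - s0\<bar>^j" for v j
      using order_trans[OF that pw] \<rho> by (simp add: abs_divide pos_divide_le_eq)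
    have rem': "\<bar>(w \<bullet> e) / \<rho>^j\<bar> \<le> M" if "norm w \<le> M * \<bar>s - s0\<bar>^j" "norm e = 1" for w e :: plane and j
      using rem[of "w \<bullet> e" j] abs_inner_unit[OF that(2), of w] that(1) by linarith
    \<comment> \<open>The orders depend on the projection: in the tangential direction the
      second-order term of the position vanishes, and the quadratic term of the velocity contributes
      the square of the curvature by \<open>velocity_jerk\<close>.\<close>
    define a where "a = ((\<gamma> s - \<gamma> s0 - (s - s0) *\<^sub>R \<gamma>1 s0 - ((s - s0)^2 / 2) *\<^sub>R \<gamma>2 s0) \<bullet> \<gamma>1 s0) / \<rho>^3"
    define a' where "a' = ((\<gamma>1 s - \<gamma>1 s0 - (s - s0) *\<^sub>R \<gamma>2 s0) \<bullet> \<nu> s0) / \<rho>^2"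
    define b where "b = ((\<gamma> s - \<gamma> s0 - (s - s0) *\<^sub>R \<gamma>1 s0 - ((s - s0)^2 / 2) *\<^sub>R \<gamma>2 s0 - ((s - s0)^3 / 6) *\<^sub>R \<gamma>3 s0) \<bullet> \<nu> s0) / \<rho>^4"
    define b' where "b' = ((\<gamma>1 s - \<gamma>1 s0 - (s - s0) *\<^sub>R \<gamma>2 s0 - ((s - s0)^2 / 2) *\<^sub>R \<gamma>3 s0) \<bullet> \<gamma>1 s0) / \<rho>^3"
    have bounds: "\<bar>a\<bar> \<le> M" "\<bar>a'\<bar> \<le> M" "\<bar>b\<bar> \<le> M" "\<bar>b'\<bar> \<le> M"
      unfolding a_def a'_def b_def b'_def by (rule rem'[OF _ norm_velocity] rem'[OF _ norm_normal], rule M)+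
    have kb: "\<bar>curv s0\<bar> \<le> M" "\<bar>curv' s0\<bar> \<le> M"
      unfolding curv_def curv'_def
      using abs_inner_unit[OF norm_normal] M(2,3) order_trans by blast+
    have ip: "\<gamma>2 s0 \<bullet> \<gamma>1 s0 = 0" "\<gamma>1 s0 \<bullet> \<nu> s0 = 0" "\<gamma>3 s0 \<bullet> \<gamma>1 s0 = - ((curv s0)^2)"
      using velocity_acceleration[of s0] velocity_jerk[of s0] normal_orth[of s0]
      by (auto simp: inner_commute curv_def)
    have ea: "(\<gamma> s - \<gamma> s0) \<bullet> \<gamma>1 s0 = \<rho> * u + \<rho>^3 * a"
      using \<rho> by (simp add: a_def inner_diff_left ip inner_velocity uv(1)[symmetric])
    have ea': "\<gamma>1 s \<bullet> \<nu> s0 = curv s0 * \<rho> * u + \<rho>^2 * a'"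
      using \<rho> by (simp add: a'_def inner_diff_left ip curv_def uv(1))
    have eb: "(\<gamma> s - \<gamma> s0) \<bullet> \<nu> s0 = curv s0 * (\<rho> * u)^2 / 2 + curv' s0 * (\<rho> * u)^3 / 6 + \<rho>^4 * b"
      using \<rho> by (simp add: b_def inner_diff_left ip uv(1)[symmetric] curv_def curv'_def)
    have eb': "\<gamma>1 s \<bullet> \<gamma>1 s0 = 1 - (curv s0)^2 * (\<rho> * u)^2 / 2 + \<rho>^3 * b'"
      using \<rho> by (simp add: b'_def inner_diff_left ip uv(1)[symmetric] inner_velocity)
    have x: "tcoord s0 (\<gamma> s + t *\<^sub>R \<nu> s) = \<rho> * u + \<rho>^3 * a - \<rho> * v * (curv s0 * \<rho> * u + \<rho>^2 * a')"
    proof -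
      have "tcoord s0 (\<gamma> s + t *\<^sub>R \<nu> s) = (\<gamma> s - \<gamma> s0) \<bullet> \<gamma>1 s0 + t * (\<nu> s \<bullet> \<gamma>1 s0)"
        by (simp add: tcoord_def inner_diff_left inner_add_left)
      then show ?thesis unfolding normal_inner_velocity ea ea' uv(2) by (simp add: algebra_simps)
    qed
    have y: "ncoord s0 (\<gamma> s + t *\<^sub>R \<nu> s) = curv s0 * (\<rho> * u)^2 / 2 + curv' s0 * (\<rho> * u)^3 / 6 + \<rho>^4 * b
        + \<rho> * v * (1 - (curv s0)^2 * (\<rho> * u)^2 / 2 + \<rho>^3 * b')"
    proof -
      have "ncoord s0 (\<gamma> s + t *\<^sub>R \<nu> s) = (\<gamma> s - \<gamma> s0) \<bullet> \<nu> s0 + t * (\<nu> s \<bullet> \<nu> s0)"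
        by (simp add: ncoord_def inner_diff_left inner_add_left)
      then show ?thesis unfolding normal_inner_normal eb eb' uv(2) by (simp add: algebra_simps)
    qed
    have "\<bar>ncoord s0 (\<gamma> s + t *\<^sub>R \<nu> s) - curv s0 / 2 * (tcoord s0 (\<gamma> s + t *\<^sub>R \<nu> s))^2
        - curv' s0 / 6 * (tcoord s0 (\<gamma> s + t *\<^sub>R \<nu> s))^3
        - (curv s0)^2 / 2 * ((tcoord s0 (\<gamma> s + t *\<^sub>R \<nu> s))^2 * ncoord s0 (\<gamma> s + t *\<^sub>R \<nu> s)) - \<rho> * v\<bar> \<le> C * \<rho>^4"
      by (rule C[rule_format], intro conjI) (rule less_imp_le[OF \<rho>(1)] \<rho>(2) uv bounds kb x y)+
    then show ?thesis unfolding dist_poly_def uv(2)[symmetric] .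
  qed
  show ?thesis by (intro exI[of _ C] allI impI, elim conjE) (rule main)
qed

text \<open>If \<open>p\<close> is within \<open>r\<close> of \<open>\<gamma> s0\<close>, its
  nearest curve point is within \<open>2 * r\<close> of \<open>\<gamma> s0\<close>, and
  \<open>chord_arc\<close> turns this into arc length \<open>4 * r\<close> after a shift by periods.
  So the tube estimate applies with \<open>\<rho> = 4 * r\<close>; \<open>r0\<close> keeps
  \<open>4 * r \<le> 1\<close> and \<open>2 * r < \<eta>\<close>.\<close>

lemma dist_poly_near:
  "\<exists>C r0. r0 > 0 \<and> (\<forall>s0 p r. 0 < r \<and> r \<le> r0 \<and> dist p (\<gamma> s0) \<le> r \<longrightarrow>
     (\<exists>s t. p = \<gamma> s + t *\<^sub>R \<nu> s \<and> infdist p (range \<gamma>) = \<bar>t\<bar> \<and> \<bar>dist_poly s0 p - t\<bar> \<le> C * r^4))"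
proof -
  obtain C where C: "\<And>s0 s t \<rho>. 0 < \<rho> \<Longrightarrow> \<rho> \<le> 1 \<Longrightarrow> \<bar>s - s0\<bar> \<le> \<rho> \<Longrightarrow> \<bar>t\<bar> \<le> \<rho> \<Longrightarrow>
     \<bar>dist_poly s0 (\<gamma> s + t *\<^sub>R \<nu> s) - t\<bar> \<le> C * \<rho>^4"
    using dist_poly_tube by blast
  obtain \<eta> where \<eta>: "\<eta> > 0" and ca: "\<And>s0 s1. norm (\<gamma> s1 - \<gamma> s0) < \<eta> \<Longrightarrow>
     (\<exists>k::int. \<bar>s1 + of_int k * len - s0\<bar> \<le> 2 * norm (\<gamma> s1 - \<gamma> s0))"
    using chord_arc by blast
  define r0 where "r0 = min (1/4) (\<eta> / 4)"
  have main: "\<exists>s t. p = \<gamma> s + t *\<^sub>R \<nu> s \<and> infdist p (range \<gamma>) = \<bar>t\<bar> \<and> \<bar>dist_poly s0 p - t\<bar> \<le> (C * 4^4) * r^4"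
    if r: "0 < r" "r \<le> r0" "dist p (\<gamma> s0) \<le> r" for s0 p r
  proof -
    obtain s t where st: "p = \<gamma> s + t *\<^sub>R \<nu> s" "infdist p (range \<gamma>) = \<bar>t\<bar>" using nearest_point[of p] by blast
    have t: "\<bar>t\<bar> \<le> r" using infdist_le[of "\<gamma> s0" "range \<gamma>" p] st(2) r(3) by simp
    have "norm (\<gamma> s - \<gamma> s0) \<le> dist p (\<gamma> s0) + dist p (\<gamma> s)"
      by (metis dist_commute dist_norm dist_triangle2 add.commute)
    moreover have "dist p (\<gamma> s) = \<bar>t\<bar>" using norm_normal[of s] by (simp add: st(1) dist_norm)
    ultimately have *: "norm (\<gamma> s - \<gamma> s0) \<le> 2 * r" using t r(3) by linarith
    have "2 * r < \<eta>" using r \<eta> by (auto simp: r0_def min_def split: if_splits)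
    then have "norm (\<gamma> s - \<gamma> s0) < \<eta>" using * by linarith
    then obtain k :: int where "\<bar>s + of_int k * len - s0\<bar> \<le> 2 * norm (\<gamma> s - \<gamma> s0)" using ca by blast
    then have k: "\<bar>s + of_int k * len - s0\<bar> \<le> 4 * r" using * by linarith
    let ?s = "s + of_int k * len"
    have eq: "\<gamma> ?s = \<gamma> s" "\<nu> ?s = \<nu> s"
      using periodic_int[of \<gamma>, OF period, of s k] periodic_int[of \<gamma>1, OF period1, of s k]
      by (simp_all add: unit_normal_def)
    have "\<bar>dist_poly s0 (\<gamma> ?s + t *\<^sub>R \<nu> ?s) - t\<bar> \<le> C * (4 * r)^4"
      using r k t by (intro C) (auto simp: r0_def)
    then show ?thesis unfolding eq using st by (intro exI[of _ s] exI[of _ t]) (simp add: power_mult_distrib)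
  qed
  have r0: "r0 > 0" using \<eta> by (simp add: r0_def)
  show ?thesis
    by (rule exI[of _ "C * 4^4"], rule exI[of _ r0], rule conjI, rule r0, intro allI impI, elim conjE) (rule main)
qed

end

section \<open>The two sides of the curve\<close>

lemma connected_subset_frontier:
  "connected S \<Longrightarrow> x \<in> S \<Longrightarrow> x \<in> T \<Longrightarrow> S \<inter> frontier T = {} \<Longrightarrow> S \<subseteq> T"
  using connected_Int_frontier[of S T] by blast

text \<open>How the points of \<Gamma> itself are divided between \<open>\<Omega>1\<close> and
  \<open>\<Omega>2\<close> is left open, hence the differences in \<open>comp\<close>.\<close>

locale interface_regions = interface_curve +
  fixes \<Omega>1 \<Omega>2 :: "plane set"
  assumes \<Omega>1: "\<Omega>1 \<subseteq> unit_square" and \<Omega>2: "\<Omega>2 = unit_square - \<Omega>1"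
    and inside: "range \<gamma> \<subseteq> unit_square"
    and comp: "components (unit_square - range \<gamma>) = {\<Omega>1 - range \<gamma>, \<Omega>2 - range \<gamma>}"
    and away: "{p. infdist p (range \<gamma>) < R} \<inter> frontier unit_square = {}"
begin

abbreviation "\<Gamma> \<equiv> range \<gamma>"

lemma connected_same_side:
  assumes "connected S" "S \<subseteq> unit_square - \<Gamma>"
  shows "S \<inter> \<Omega>1 \<noteq> {} \<Longrightarrow> S \<subseteq> \<Omega>1" "S \<inter> \<Omega>2 \<noteq> {} \<Longrightarrow> S \<subseteq> \<Omega>2"
proof -
  have main: "S \<subseteq> \<Omega> - \<Gamma>" if "\<Omega> - \<Gamma> \<in> components (unit_square - \<Gamma>)" "S \<inter> \<Omega> \<noteq> {}" for \<Omega>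
    using components_maximal[OF that(1) assms] that(2) assms(2) by auto
  have "\<Omega>1 - \<Gamma> \<in> components (unit_square - \<Gamma>)" "\<Omega>2 - \<Gamma> \<in> components (unit_square - \<Gamma>)"
    unfolding comp by blast+
  from main[OF this(1)] main[OF this(2)]
  show "S \<inter> \<Omega>1 \<noteq> {} \<Longrightarrow> S \<subseteq> \<Omega>1" "S \<inter> \<Omega>2 \<noteq> {} \<Longrightarrow> S \<subseteq> \<Omega>2"
    by blast+
qed

lemma infdist_tube: "infdist (\<gamma> s + t *\<^sub>R \<nu> s) \<Gamma> \<le> \<bar>t\<bar>"
  using infdist_le[of "\<gamma> s" \<Gamma> "\<gamma> s + t *\<^sub>R \<nu> s"] norm_normal[of s] by (simp add: dist_norm)

text \<open>The normal segment of half-length \<open>\<bar>t\<bar>\<close> lies in the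
  \<open>R\<close>-neighbourhood, which misses the frontier of the square, so connectedness keeps it
  in the square; injectivity of the tube keeps its end off the curve.\<close>

lemma tube_subset:
  assumes "\<bar>t\<bar> < R" "t \<noteq> 0"
  shows "\<gamma> s + t *\<^sub>R \<nu> s \<in> unit_square - \<Gamma>"
proof -
  define S where "S = (\<lambda>a. \<gamma> s + a *\<^sub>R \<nu> s) ` {-\<bar>t\<bar>..\<bar>t\<bar>}"
  have conn: "connected S" unfolding S_def by (intro connected_continuous_image continuous_intros) auto
  have "\<gamma> s \<in> S" unfolding S_def by (rule image_eqI[of _ _ 0]) auto
  moreover have "\<gamma> s \<in> unit_square" using inside by blast
  ultimately have "S \<subseteq> unit_square" if "S \<inter> frontier unit_square = {}"
    using that by (rule connected_subset_frontier[OF conn])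
  note sub = this
  have "infdist (\<gamma> s + a *\<^sub>R \<nu> s) \<Gamma> < R" if "a \<in> {-\<bar>t\<bar>..\<bar>t\<bar>}" for a
    using infdist_tube[of s a] that assms by auto
  then have "S \<subseteq> {p. infdist p \<Gamma> < R}" unfolding S_def by blast
  then have "S \<inter> frontier unit_square = {}" using away by blast
  then have "S \<subseteq> unit_square" by (rule sub)
  moreover have "\<gamma> s + t *\<^sub>R \<nu> s \<in> S" unfolding S_def by (rule image_eqI[of _ _ t]) auto
  ultimately have "\<gamma> s + t *\<^sub>R \<nu> s \<in> unit_square" by (rule subsetD)
  moreover have "\<gamma> s + t *\<^sub>R \<nu> s \<notin> \<Gamma>"
  proof
    assume "\<gamma> s + t *\<^sub>R \<nu> s \<in> \<Gamma>"
    then obtain s' where "\<gamma> s + t *\<^sub>R \<nu> s = \<gamma> s' + 0 *\<^sub>R \<nu> s'" by auto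
    from tube_inj(1)[OF this] assms R show False by simp
  qed
  ultimately show ?thesis by blast
qed

text \<open>On \<Gamma> both branches are 0, so the value there is independent of the region to
  which the point is assigned.\<close>

definition sdist :: "plane \<Rightarrow> real" where
  "sdist p = (if p \<in> \<Omega>2 then infdist p \<Gamma> else - infdist p \<Gamma>)"

text \<open>Each open half of the tube is connected and misses \<Gamma>, so it lies in one region.
  The points \<open>p1\<close> and \<open>p2\<close> witness that both regions occur in the tube;
  hence the halves lie in different regions, and one sign \<sigma> relates region and normal along
  the whole curve.\<close>

lemma sdist_tube:
  assumes p1: "p1 \<in> \<Omega>1 - \<Gamma>" "infdist p1 \<Gamma> < R" and p2: "p2 \<in> \<Omega>2 - \<Gamma>" "infdist p2 \<Gamma> < R"
  shows "\<exists>\<sigma>\<in>{-1, 1}. \<forall>s t. infdist (\<gamma> s + t *\<^sub>R \<nu> s) \<Gamma> = \<bar>t\<bar> \<and> \<bar>t\<bar> < R \<longrightarrow> sdist (\<gamma> s + t *\<^sub>R \<nu> s) = \<sigma> * t"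
proof -
  define P where "P I = (\<lambda>(s, t). \<gamma> s + t *\<^sub>R \<nu> s) ` (UNIV \<times> I)" for I
  have side: "P I \<subseteq> \<Omega>1 \<or> P I \<subseteq> \<Omega>2" if I: "connected I" "I \<subseteq> {-R<..<R} - {0}" for I
  proof -
    have c: "connected (P I)" unfolding P_def case_prod_unfold unit_normal_def
      by (intro connected_continuous_image continuous_intros connected_Times I(1)
          continuous_on_compose2[OF continuous_curve(1)[of UNIV]]
          continuous_on_compose2[OF continuous_curve(2)[of UNIV]]) auto
    have sub: "P I \<subseteq> unit_square - \<Gamma>"
    proof
      fix p assume "p \<in> P I"
      then obtain s t where "p = \<gamma> s + t *\<^sub>R \<nu> s" "t \<in> I" by (auto simp: P_def)
      then have "\<bar>t\<bar> < R" "t \<noteq> 0" using I(2) by (auto simp: abs_less_iff)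
      then show "p \<in> unit_square - \<Gamma>" using tube_subset[of t s] \<open>p = _\<close> by simp
    qed
    have "P I \<inter> \<Omega>1 \<noteq> {} \<or> P I \<inter> \<Omega>2 \<noteq> {} \<or> P I = {}" using sub \<Omega>2 by blast
    then show ?thesis using connected_same_side[OF c sub] by blast
  qed
  have s1: "P {0<..<R} \<subseteq> \<Omega>1 \<or> P {0<..<R} \<subseteq> \<Omega>2" by (rule side) auto
  have s2: "P {-R<..<0} \<subseteq> \<Omega>1 \<or> P {-R<..<0} \<subseteq> \<Omega>2" by (rule side) auto
  have mem: "p \<in> P {0<..<R} \<or> p \<in> P {-R<..<0}" if p: "p \<notin> \<Gamma>" "infdist p \<Gamma> < R" for p
  proof -
    obtain s t where st: "p = \<gamma> s + t *\<^sub>R \<nu> s" "infdist p \<Gamma> = \<bar>t\<bar>" using nearest_point by blast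
    then have "t \<noteq> 0" using p by auto
    then have "t \<in> {0<..<R} \<or> t \<in> {-R<..<0}" using p(2) st(2) by auto
    then show ?thesis using st(1) by (auto simp: P_def)
  qed
  have dis: "\<Omega>1 \<inter> \<Omega>2 = {}" using \<Omega>2 by auto
  have cases: "(P {0<..<R} \<subseteq> \<Omega>2 \<and> P {-R<..<0} \<subseteq> \<Omega>1) \<or> (P {0<..<R} \<subseteq> \<Omega>1 \<and> P {-R<..<0} \<subseteq> \<Omega>2)"
    using s1 s2 mem[of p1] mem[of p2] p1 p2 dis by blast
  have pos: "\<gamma> s + t *\<^sub>R \<nu> s \<in> P {0<..<R}" if "0 < t" "t < R" for s t using that by (auto simp: P_def)
  have neg: "\<gamma> s + t *\<^sub>R \<nu> s \<in> P {-R<..<0}" if "t < 0" "-R < t" for s t using that by (auto simp: P_def)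
  from cases show ?thesis
  proof
    assume c: "P {0<..<R} \<subseteq> \<Omega>2 \<and> P {-R<..<0} \<subseteq> \<Omega>1"
    have "sdist (\<gamma> s + t *\<^sub>R \<nu> s) = 1 * t" if "infdist (\<gamma> s + t *\<^sub>R \<nu> s) \<Gamma> = \<bar>t\<bar>" "\<bar>t\<bar> < R" for s t
      using pos[of t s] neg[of t s] c dis that by (cases "t > 0"; cases "t < 0") (auto simp: sdist_def)
    then show ?thesis by (intro bexI[of _ 1]) auto
  next
    assume c: "P {0<..<R} \<subseteq> \<Omega>1 \<and> P {-R<..<0} \<subseteq> \<Omega>2"
    have "sdist (\<gamma> s + t *\<^sub>R \<nu> s) = -1 * t" if "infdist (\<gamma> s + t *\<^sub>R \<nu> s) \<Gamma> = \<bar>t\<bar>" "\<bar>t\<bar> < R" for s t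
      using pos[of t s] neg[of t s] c dis that by (cases "t > 0"; cases "t < 0") (auto simp: sdist_def)
    then show ?thesis by (intro bexI[of _ "-1"]) auto
  qed
qed

text \<open>The bound \<open>r \<le> R / 2\<close> puts the normal offset inside the tube, where
  \<sigma> converts it into the signed distance.\<close>

lemma dist_poly_sdist:
  "\<exists>C r0. r0 > 0 \<and> (\<forall>\<sigma> s0 p r.
     (\<forall>s t. infdist (\<gamma> s + t *\<^sub>R \<nu> s) \<Gamma> = \<bar>t\<bar> \<and> \<bar>t\<bar> < R \<longrightarrow> sdist (\<gamma> s + t *\<^sub>R \<nu> s) = \<sigma> * t) \<and>
     \<bar>\<sigma>\<bar> = 1 \<and> 0 < r \<and> r \<le> r0 \<and> dist p (\<gamma> s0) \<le> r \<longrightarrow> \<bar>sdist p - \<sigma> * dist_poly s0 p\<bar> \<le> C * r^4)"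
proof -
  obtain C r0 where r0: "r0 > 0" and C: "\<And>s0 p r. 0 < r \<Longrightarrow> r \<le> r0 \<Longrightarrow> dist p (\<gamma> s0) \<le> r \<Longrightarrow>
     (\<exists>s t. p = \<gamma> s + t *\<^sub>R \<nu> s \<and> infdist p (range \<gamma>) = \<bar>t\<bar> \<and> \<bar>dist_poly s0 p - t\<bar> \<le> C * r^4)"
    using dist_poly_near by blast
  have main: "\<bar>sdist p - \<sigma> * dist_poly s0 p\<bar> \<le> C * r^4"
    if \<sigma>: "\<forall>s t. infdist (\<gamma> s + t *\<^sub>R \<nu> s) \<Gamma> = \<bar>t\<bar> \<and> \<bar>t\<bar> < R \<longrightarrow> sdist (\<gamma> s + t *\<^sub>R \<nu> s) = \<sigma> * t" "\<bar>\<sigma>\<bar> = 1"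
      and r: "0 < r" "r \<le> min r0 (R / 2)" "dist p (\<gamma> s0) \<le> r" for \<sigma> s0 p r
  proof -
    obtain s t where st: "p = \<gamma> s + t *\<^sub>R \<nu> s" "infdist p \<Gamma> = \<bar>t\<bar>" "\<bar>dist_poly s0 p - t\<bar> \<le> C * r^4"
      using C[OF r(1) _ r(3)] r(2) by auto
    have "\<bar>t\<bar> < R" using infdist_le[of "\<gamma> s0" \<Gamma> p] st(2) r R by auto
    then have "sdist p = \<sigma> * t" using \<sigma>(1) st by auto
    then have "\<bar>sdist p - \<sigma> * dist_poly s0 p\<bar> = \<bar>\<sigma>\<bar> * \<bar>dist_poly s0 p - t\<bar>"
      by (simp add: abs_mult[symmetric] algebra_simps abs_minus_commute)
    then show ?thesis using st(3) \<sigma>(2) by simp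
  qed
  have r0': "min r0 (R / 2) > 0" using r0 R by simp
  show ?thesis
    by (rule exI[of _ C], rule exI[of _ "min r0 (R / 2)"], rule conjI, rule r0', intro allI impI, elim conjE) (rule main)
qed

end

section \<open>Quasi-interpolation\<close>

locale quasi_interpolant =
  fixes \<beta> :: real and A :: "nat \<Rightarrow> (plane \<Rightarrow> real) \<Rightarrow> plane \<Rightarrow> real"
  assumes quasi: "quasi_interpolation \<beta> A"
begin

lemmas quasiD = quasi[unfolded quasi_interpolation_def]
lemmas A_spline = quasiD[THEN conjunct1, rule_format]
lemmas A_lin = quasiD[THEN conjunct2, THEN conjunct1]
lemmas A_loc = quasiD[THEN conjunct2, THEN conjunct2, THEN conjunct1]
lemmas A_bound = quasiD[THEN conjunct2, THEN conjunct2, THEN conjunct2, THEN conjunct1]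
lemmas A_order = quasiD[THEN conjunct2, THEN conjunct2, THEN conjunct2, THEN conjunct2]

lemma A_linear:
  "n \<ge> 2 \<Longrightarrow> p \<in> unit_square \<Longrightarrow> A n (\<lambda>q. a * v q + b * w q) p = a * A n v p + b * A n w p"
  by (rule A_lin[rule_format])

text \<open>Continuity is what the intermediate value argument on the normals needs from the
  spline.\<close>

lemma A_continuous:
  assumes "n \<ge> 2"
  shows "continuous_on unit_square (A n v)"
proof -
  obtain m :: nat and u w where uw: "\<forall>k<m. cubic_spline n (u k) \<and> cubic_spline n (w k)"
    and eq: "\<forall>x\<in>{0..1}. \<forall>y\<in>{0..1}. A n v (x, y) = (\<Sum>k<m. u k x * w k y)"
    using A_spline[OF assms, of v] unfolding bicubic_spline_def by (elim exE conjE)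
  have c: "continuous_on {0..1} (u k)" "continuous_on {0..1} (w k)" if "k < m" for k
    using uw that Ck_on_imp_continuous_on unfolding cubic_spline_def by blast+
  have "continuous_on unit_square (\<lambda>p. \<Sum>k<m. u k (fst p) * w k (snd p))"
    by (intro continuous_on_sum continuous_on_mult continuous_on_compose2[OF c(1)]
        continuous_on_compose2[OF c(2)] continuous_intros) auto
  then show ?thesis
    by (rule continuous_on_eq) (use eq in auto)
qed

lemma A_norm:
  assumes n: "n \<ge> 2" and v: "\<And>q. q \<in> mesh n \<Longrightarrow> \<bar>v q\<bar> \<le> m" and m: "m > 0" and p: "p \<in> unit_square"
  shows "\<bar>A n v p\<bar> \<le> \<beta> * m"
proof -
  obtain b where b: "b < \<beta>" "\<forall>v. (\<forall>q\<in>mesh n. \<bar>v q\<bar> \<le> 1) \<longrightarrow> (\<forall>p\<in>unit_square. \<bar>A n v p\<bar> \<le> b)"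
    using A_bound[rule_format, OF n] by (elim exE conjE)
  \<comment> \<open>The summand \<open>0 * v q\<close> gives the scaled function the two-term form
    of \<open>A_linear\<close>.\<close>
  have "\<bar>A n (\<lambda>q. (1/m) * v q + 0 * v q) p\<bar> \<le> b"
    using b(2)[rule_format, of "\<lambda>q. (1/m) * v q + 0 * v q" p] v m p
    by (simp add: abs_mult field_simps)
  then have "(1/m) * \<bar>A n v p\<bar> \<le> b" unfolding A_linear[OF n p] using m by (simp add: abs_mult)
  then have "\<bar>A n v p\<bar> \<le> b * m" using m by (simp add: field_simps)
  also have "\<dots> \<le> \<beta> * m" using b(1) m by simp
  finally show ?thesis .
qed

text \<open>By locality, truncating \<open>v - w\<close> to the stencil of \<open>p\<close> does not
  change the value at \<open>p\<close>; the truncated function is bounded by \<open>m\<close> on the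
  whole mesh, so the operator norm applies. The maximum with 0 covers a negative \<rho>.\<close>

lemma A_local_norm:
  "\<exists>\<rho>\<ge>0. \<forall>n\<ge>2. \<forall>v w m. \<forall>p\<in>unit_square. m > 0 \<and>
     (\<forall>q\<in>mesh n. dist p q \<le> \<rho> / real (n - 1) \<longrightarrow> \<bar>v q - w q\<bar> \<le> m) \<longrightarrow> \<bar>A n v p - A n w p\<bar> \<le> \<beta> * m"
proof -
  obtain \<rho> where \<rho>: "\<forall>n\<ge>2. \<forall>v w. \<forall>p\<in>unit_square.
      (\<forall>q\<in>mesh n. dist p q \<le> \<rho> / real (n - 1) \<longrightarrow> v q = w q) \<longrightarrow> A n v p = A n w p"
    using A_loc ..
  have main: "\<bar>A n v p - A n w p\<bar> \<le> \<beta> * m"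
    if n: "n \<ge> 2" and p: "p \<in> unit_square" and m: "m > 0"
      and close: "\<forall>q\<in>mesh n. dist p q \<le> max \<rho> 0 / real (n - 1) \<longrightarrow> \<bar>v q - w q\<bar> \<le> m" for n v w m p
  proof -
    define u where "u q = (if dist p q \<le> max \<rho> 0 / real (n - 1) then v q - w q else 0)" for q
    have "A n (\<lambda>q. 1 * v q + (-1) * w q) p = A n u p"
    proof (rule \<rho>[rule_format, OF n p])
      fix q assume "q \<in> mesh n" "dist p q \<le> \<rho> / real (n - 1)"
      moreover have "\<rho> / real (n - 1) \<le> max \<rho> 0 / real (n - 1)" by (simp add: divide_right_mono)
      ultimately show "1 * v q + (-1) * w q = u q" by (simp add: u_def)
    qed
    then have "A n v p - A n w p = A n u p" unfolding A_linear[OF n p] by simp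
    also have "\<bar>\<dots>\<bar> \<le> \<beta> * m"
      using close m by (intro A_norm[OF n _ m p]) (auto simp: u_def)
    finally show ?thesis .
  qed
  show ?thesis
    by (rule exI[of _ "max \<rho> 0"], rule conjI, simp, intro allI ballI impI, elim conjE) (rule main)
qed

text \<open>The approximation order concerns one function, with its own constant and threshold. Here
  both are common to a family, as the moving base point on the curve requires.\<close>

definition unif_approx :: "('i \<Rightarrow> plane \<Rightarrow> real) \<Rightarrow> bool" where
  "unif_approx F \<longleftrightarrow> (\<exists>C N. \<forall>n\<ge>N. \<forall>i. \<forall>p\<in>unit_square. \<bar>A n (F i) p - F i p\<bar> \<le> C * (1 / real (n - 1))^4)"

lemma unif_approx_Ck:
  assumes "Ck_on 4 unit_square g"
  shows "unif_approx (\<lambda>_. g)"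
proof -
  have "\<exists>C. \<forall>\<^sub>F n in sequentially. \<forall>p\<in>unit_square. \<bar>A n g p - g p\<bar> \<le> C * (1 / real (n - 1))^4"
    by (rule A_order[rule_format, OF assms])
  then show ?thesis unfolding unif_approx_def eventually_sequentially by blast
qed

lemma unif_approx_lincomb:
  assumes "unif_approx F" "unif_approx G" "bdd_on UNIV a" "bdd_on UNIV b"
  shows "unif_approx (\<lambda>i p. a i * F i p + b i * G i p)"
proof -
  obtain C N where F: "\<And>n i p. n \<ge> N \<Longrightarrow> p \<in> unit_square \<Longrightarrow> \<bar>A n (F i) p - F i p\<bar> \<le> C * (1 / real (n - 1))^4"
    using assms(1) unfolding unif_approx_def by blast
  obtain C' N' where G: "\<And>n i p. n \<ge> N' \<Longrightarrow> p \<in> unit_square \<Longrightarrow> \<bar>A n (G i) p - G i p\<bar> \<le> C' * (1 / real (n - 1))^4"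
    using assms(2) unfolding unif_approx_def by blast
  obtain Ca where Ca: "\<And>i. \<bar>a i\<bar> \<le> Ca" using assms(3) by (auto simp: bdd_on_def)
  obtain Cb where Cb: "\<And>i. \<bar>b i\<bar> \<le> Cb" using assms(4) by (auto simp: bdd_on_def)
  have main: "\<bar>A n (\<lambda>p. a i * F i p + b i * G i p) p - (a i * F i p + b i * G i p)\<bar>
      \<le> (Ca * C + Cb * C') * (1 / real (n - 1))^4"
    if n: "n \<ge> max 2 (max N N')" and p: "p \<in> unit_square" for n i p
  proof -
    have "\<bar>A n (\<lambda>p. a i * F i p + b i * G i p) p - (a i * F i p + b i * G i p)\<bar>
        = \<bar>a i * (A n (F i) p - F i p) + b i * (A n (G i) p - G i p)\<bar>"
      using n by (subst A_linear[OF _ p]) (auto simp: algebra_simps)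
    also have "\<dots> \<le> \<bar>a i\<bar> * \<bar>A n (F i) p - F i p\<bar> + \<bar>b i\<bar> * \<bar>A n (G i) p - G i p\<bar>"
      using abs_triangle_ineq[of "a i * (A n (F i) p - F i p)" "b i * (A n (G i) p - G i p)"] by (simp add: abs_mult)
    also have "\<dots> \<le> Ca * (C * (1 / real (n - 1))^4) + Cb * (C' * (1 / real (n - 1))^4)"
      using F[of n p i] G[of n p i] n p Ca[of i] Cb[of i] by (intro add_mono mult_mono) auto
    finally show ?thesis by (simp add: algebra_simps)
  qed
  show ?thesis unfolding unif_approx_def
    by (rule exI[of _ "Ca * C + Cb * C'"], rule exI[of _ "max 2 (max N N')"], intro allI impI ballI) (rule main)
qed

lemma unif_approx_const: "unif_approx (\<lambda>_ _. c)"
  by (rule unif_approx_Ck) (rule Ck_on_const)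

lemma unif_approx_sum:
  assumes "finite J" "\<And>j. j \<in> J \<Longrightarrow> unif_approx (F j)" "\<And>j. j \<in> J \<Longrightarrow> bdd_on UNIV (a j)"
  shows "unif_approx (\<lambda>i p. \<Sum>j\<in>J. a j i * F j i p)"
  using assms
proof (induction J rule: finite_induct)
  case empty
  then show ?case using unif_approx_const[of 0] by simp
next
  case (insert j J)
  have "unif_approx (\<lambda>i p. a j i * F j i p + 1 * (\<Sum>j\<in>J. a j i * F j i p))"
    using insert by (intro unif_approx_lincomb) (auto intro: bdd_on_const)
  then show ?case using insert by simp
qed

text \<open>The constant 1 is included so that products of three members cover all monomials of
  degree up to 3.\<close>

definition affine_basis :: "nat \<Rightarrow> plane \<Rightarrow> real" where
  "affine_basis i = (if i = 0 then (\<lambda>_. 1) else if i = 1 then fst else snd)"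

lemma affine_basis_Ck: "Ck_on k S (affine_basis i)"
  by (auto simp: affine_basis_def intro: Ck_on_const Ck_on_bounded_linear bounded_linear_fst bounded_linear_snd)

definition affine_fam :: "('i \<Rightarrow> plane \<Rightarrow> real) \<Rightarrow> bool" where
  "affine_fam F \<longleftrightarrow> (\<exists>a. (\<forall>j. bdd_on UNIV (a j)) \<and> (\<forall>i p. F i p = (\<Sum>j<3. a j i * affine_basis j p)))"

lemma affine_famI:
  assumes "bdd_on UNIV a" "bdd_on UNIV b" "bdd_on UNIV c" "\<And>i p. F i p = a i + b i * fst p + c i * snd p"
  shows "affine_fam F"
  unfolding affine_fam_def
  by (rule exI[of _ "\<lambda>j. if j = 0 then a else if j = 1 then b else c"])
     (use assms in \<open>auto simp: eval_nat_numeral affine_basis_def\<close>)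

text \<open>Expanding the three factors leaves 27 fixed products of members of
  \<open>affine_basis\<close>, each approximated to order 4, with coefficients bounded in
  \<open>i\<close>.\<close>

lemma unif_approx_affine3:
  assumes "affine_fam F" "affine_fam G" "affine_fam H"
  shows "unif_approx (\<lambda>i p. F i p * (G i p * H i p))"
proof -
  obtain a where a: "\<And>j. bdd_on UNIV (a j)" "\<And>i p. F i p = (\<Sum>j<3. a j i * affine_basis j p)"
    using assms(1) unfolding affine_fam_def by blast
  obtain b where b: "\<And>j. bdd_on UNIV (b j)" "\<And>i p. G i p = (\<Sum>j<3. b j i * affine_basis j p)"
    using assms(2) unfolding affine_fam_def by blast
  obtain c where c: "\<And>j. bdd_on UNIV (c j)" "\<And>i p. H i p = (\<Sum>j<3. c j i * affine_basis j p)"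
    using assms(3) unfolding affine_fam_def by blast
  have eq: "F i p * (G i p * H i p) = (\<Sum>j<3. a j i * (\<Sum>k<3. b k i * (\<Sum>l<3. c l i *
      (affine_basis j p * (affine_basis k p * affine_basis l p)))))" for i p
    unfolding a(2) b(2) c(2) sum_product by (simp add: sum_distrib_left mult.assoc mult.left_commute)
  have "unif_approx (\<lambda>i p. \<Sum>j<3. a j i * (\<Sum>k<3. b k i * (\<Sum>l<3. c l i *
      (affine_basis j p * (affine_basis k p * affine_basis l p)))))"
    by (intro unif_approx_sum finite_lessThan a b c unif_approx_Ck Ck_on_mult affine_basis_Ck)
  then show ?thesis unfolding eq .
qed

end

locale interface_spline = interface_regions + quasi_interpolant
begin

text \<open>The frame coordinates are affine in \<open>p\<close>, with coefficients bounded along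
  the closed curve.\<close>

lemma dist_poly_approx: "unif_approx dist_poly"
proof -
  obtain M where "taylor_bound M" using curve_taylor ..
  note M = taylor_boundD[OF this]
  obtain B where B: "\<And>s. norm (\<gamma> s) \<le> B"
    using compact_imp_bounded[OF compact_curve] unfolding bounded_iff by blast
  have b: "bdd_on UNIV curv" "bdd_on UNIV curv'"
    using order_trans[OF abs_inner_unit[OF norm_normal] M(2)] order_trans[OF abs_inner_unit[OF norm_normal] M(3)]
    by (auto intro!: bdd_onI[of _ _ M] simp: curv_def curv'_def)
  have fs: "\<bar>fst (e::plane)\<bar> \<le> norm e" "\<bar>snd (e::plane)\<bar> \<le> norm e" for e
    using norm_fst_le[of "fst e" "snd e"] norm_snd_le[of "snd e" "fst e"] by simp_all
  have "\<bar>fst (\<gamma>1 s)\<bar> \<le> 1 \<and> \<bar>snd (\<gamma>1 s)\<bar> \<le> 1 \<and> \<bar>fst (\<nu> s)\<bar> \<le> 1 \<and> \<bar>snd (\<nu> s)\<bar> \<le> 1" for s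
    using fs[of "\<gamma>1 s"] fs[of "\<nu> s"] by (simp only: norm_velocity norm_normal simp_thms)
  then have bv: "bdd_on UNIV (\<lambda>s. fst (\<gamma>1 s))" "bdd_on UNIV (\<lambda>s. snd (\<gamma>1 s))"
     "bdd_on UNIV (\<lambda>s. fst (\<nu> s))" "bdd_on UNIV (\<lambda>s. snd (\<nu> s))"
    by (auto intro!: bdd_onI[of _ _ 1])
  have bg: "bdd_on UNIV (\<lambda>s. \<gamma> s \<bullet> \<gamma>1 s)" "bdd_on UNIV (\<lambda>s. \<gamma> s \<bullet> \<nu> s)"
    using order_trans[OF abs_inner_unit[OF norm_velocity] B] order_trans[OF abs_inner_unit[OF norm_normal] B]
    by (auto intro!: bdd_onI[of _ _ B])
  have t: "affine_fam tcoord"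
    by (rule affine_famI[OF bdd_on_uminus[OF bg(1)] bv(1,2)])
       (simp add: tcoord_def plane_inner inner_diff_left algebra_simps)
  have n: "affine_fam ncoord"
    by (rule affine_famI[OF bdd_on_uminus[OF bg(2)] bv(3,4)])
       (simp add: ncoord_def plane_inner inner_diff_left algebra_simps)
  have one: "affine_fam (\<lambda>_ _. 1)"
    by (rule affine_famI[OF bdd_on_const[of _ 1] bdd_on_const[of _ 0] bdd_on_const[of _ 0]]) simp
  \<comment> \<open>The factors 1 pad every term to a product of three affine functions and the sum
    to nested two-term combinations.\<close>
  have "unif_approx (\<lambda>s p. 1 * (1 * (ncoord s p * (1 * 1)) + (- (curv s / 2)) * (tcoord s p * (tcoord s p * 1)))
     + 1 * ((- (curv' s / 6)) * (tcoord s p * (tcoord s p * tcoord s p)) + (- ((curv s)^2 / 2)) * (tcoord s p * (tcoord s p * ncoord s p))))"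
    by (intro unif_approx_lincomb unif_approx_affine3 t n one bdd_on_intros b)
  moreover have "dist_poly = (\<lambda>s p. 1 * (1 * (ncoord s p * (1 * 1)) + (- (curv s / 2)) * (tcoord s p * (tcoord s p * 1)))
     + 1 * ((- (curv' s / 6)) * (tcoord s p * (tcoord s p * tcoord s p)) + (- ((curv s)^2 / 2)) * (tcoord s p * (tcoord s p * ncoord s p))))"
    by (intro ext) (simp add: dist_poly_def power2_eq_square power3_eq_cube algebra_simps)
  ultimately show ?thesis by simp
qed

end

lemma mesh_subset: "mesh n \<subseteq> unit_square"
  by (auto simp: mesh_def divide_le_eq_1)

section \<open>The zero level of the spline\<close>

lemma hausdorff_dist_le:
  assumes "\<And>x. x \<in> X \<Longrightarrow> \<exists>y\<in>Y. dist x y \<le> e" "\<And>y. y \<in> Y \<Longrightarrow> \<exists>x\<in>X. dist x y \<le> e"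
  shows "hausdorff_dist X Y \<le> ennreal e"
  unfolding hausdorff_dist_def
proof (intro max.boundedI SUP_least)
  fix x assume "x \<in> X"
  then obtain y where "y \<in> Y" "dist x y \<le> e" using assms(1) by blast
  then show "(INF y\<in>Y. ennreal (dist x y)) \<le> ennreal e" by (intro INF_lower2 ennreal_leI)
next
  fix y assume "y \<in> Y"
  then obtain x where "x \<in> X" "dist x y \<le> e" using assms(2) by blast
  then show "(INF x\<in>X. ennreal (dist x y)) \<le> ennreal e" by (intro INF_lower2 ennreal_leI)
qed

context interface_regions
begin

lemma segment_off_curve:
  assumes "p \<in> unit_square" "q \<in> unit_square" "dist p q < infdist p \<Gamma>"
  shows "closed_segment p q \<subseteq> unit_square - \<Gamma>"
proof
  fix x assume x: "x \<in> closed_segment p q"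
  have "convex unit_square" by (intro convex_Times) auto
  then have "x \<in> unit_square" using closed_segment_subset assms(1,2) x by (metis subsetD)
  moreover have "x \<notin> \<Gamma>"
  proof
    assume "x \<in> \<Gamma>"
    then have "infdist p \<Gamma> \<le> dist p x" by (rule infdist_le)
    also have "\<dots> \<le> dist p q" using segment_bound1[OF x] by (simp add: dist_norm norm_minus_commute)
    finally show False using assms(3) by simp
  qed
  ultimately show "x \<in> unit_square - \<Gamma>" by (rule DiffI)
qed

lemma same_side:
  assumes "p \<in> unit_square" "q \<in> unit_square" "dist p q < infdist p \<Gamma>"
  shows "p \<in> \<Omega>1 \<longleftrightarrow> q \<in> \<Omega>1" "p \<in> \<Omega>2 \<longleftrightarrow> q \<in> \<Omega>2"
proof -
  note cs = connected_same_side[OF connected_segment(1) segment_off_curve[OF assms]]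
  have ends: "p \<in> closed_segment p q" "q \<in> closed_segment p q" by auto
  show "p \<in> \<Omega>1 \<longleftrightarrow> q \<in> \<Omega>1" "p \<in> \<Omega>2 \<longleftrightarrow> q \<in> \<Omega>2"
    using cs ends by blast+
qed

text \<open>On one side of the curve the signed distance is, up to a fixed sign, the distance to
  \<Gamma>, which is 1-Lipschitz.\<close>

lemma sdist_close:
  assumes "p \<in> unit_square" "q \<in> unit_square" "dist p q < infdist p \<Gamma>"
  shows "\<bar>sdist q - sdist p\<bar> \<le> dist p q"
  using same_side(2)[OF assms] infdist_triangle_abs[of q \<Gamma> p] by (auto simp: sdist_def dist_commute)

end

context interface_spline
begin

text \<open>With \<open>r = h powr (3/4)\<close> the mesh size is at most \<open>c * r\<close>.
  Within \<open>L * r\<close> of \<Gamma> the data on a stencil agree with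
  \<open>\<tau> * \<sigma> * dist_poly s0\<close> up to \<open>O(h^3)\<close>, and so does the
  spline. Farther away the data on a stencil differ from the constant
  \<open>\<tau> * sdist p\<close> by too little to produce a zero. The points \<open>p1\<close> and
  \<open>p2\<close> serve to fix \<sigma>.\<close>

lemma zero_level_estimate:
  assumes c1: "c1 > 0" and Cv: "Cv \<ge> 0"
  shows "\<exists>C h0. h0 > 0 \<and> (\<forall>h n v \<tau> p1 p2. 0 < h \<and> h < h0 \<and> c1 * h powr (-3/4) \<le> real n \<and> \<bar>\<tau>\<bar> = 1 \<and>
     p1 \<in> \<Omega>1 - \<Gamma> \<and> infdist p1 \<Gamma> < R \<and> p2 \<in> \<Omega>2 - \<Gamma> \<and> infdist p2 \<Gamma> < R \<and>
     (\<forall>q\<in>mesh n. \<bar>v q - \<tau> * sdist q\<bar> \<le> Cv * h^3)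
     \<longrightarrow> hausdorff_dist \<Gamma> (zero_level (A n v)) \<le> ennreal (C * h^3))"
proof -
  obtain \<rho> where \<rho>: "\<rho> \<ge> 0" and loc: "\<forall>n\<ge>2. \<forall>v w m. \<forall>p\<in>unit_square. m > 0 \<and>
     (\<forall>q\<in>mesh n. dist p q \<le> \<rho> / real (n - 1) \<longrightarrow> \<bar>v q - w q\<bar> \<le> m) \<longrightarrow> \<bar>A n v p - A n w p\<bar> \<le> \<beta> * m"
    using A_local_norm by (elim exE conjE)
  obtain Cd0 r0 where r0: "r0 > 0" and Cd0: "\<forall>\<sigma> s0 p r.
     (\<forall>s t. infdist (\<gamma> s + t *\<^sub>R \<nu> s) \<Gamma> = \<bar>t\<bar> \<and> \<bar>t\<bar> < R \<longrightarrow> sdist (\<gamma> s + t *\<^sub>R \<nu> s) = \<sigma> * t) \<and>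
     \<bar>\<sigma>\<bar> = 1 \<and> 0 < r \<and> r \<le> r0 \<and> dist p (\<gamma> s0) \<le> r \<longrightarrow> \<bar>sdist p - \<sigma> * dist_poly s0 p\<bar> \<le> Cd0 * r^4"
    using dist_poly_sdist by (elim exE conjE)
  define Cd where "Cd = \<bar>Cd0\<bar>"
  obtain C30 N3 where C30: "\<forall>n\<ge>N3. \<forall>s. \<forall>p\<in>unit_square. \<bar>A n (dist_poly s) p - dist_poly s p\<bar> \<le> C30 * (1 / real (n - 1))^4"
    using dist_poly_approx unfolding unif_approx_def by (elim exE)
  define C3 where "C3 = \<bar>C30\<bar>"
  obtain C60 N6 where C60: "\<forall>n\<ge>N6. \<forall>i::unit. \<forall>p\<in>unit_square. \<bar>A n (\<lambda>_. 1) p - 1\<bar> \<le> C60 * (1 / real (n - 1))^4"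
    using unif_approx_const[of 1] unfolding unif_approx_def by (elim exE)
  define C6 where "C6 = \<bar>C60\<bar>"
  have abs_nn: "Cd \<ge> 0" "C3 \<ge> 0" "C6 \<ge> 0" by (simp_all add: Cd_def C3_def C6_def)
  have \<beta>: "\<beta> \<ge> 0"
  proof -
    have "\<bar>A 2 (\<lambda>_. 0) (0, 0)\<bar> \<le> \<beta> * 1" by (rule A_norm) auto
    then show ?thesis by simp
  qed
  \<comment> \<open>\<open>C5 * r\<close> bounds the deviation of the data from a constant on a far
    stencil, and \<open>L\<close> makes half of \<open>L * r\<close> exceed the resulting spline
    error \<open>\<beta> * C5 * r\<close>. \<open>L'\<close> adds the stencil radius;
    \<open>C2 * h^3\<close> and \<open>C4 * h^3\<close> bound the near errors of the data and of the
    spline.\<close>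
  define c where "c = 2 / c1"
  define C5 where "C5 = \<rho> * c + Cv + 1"
  define L where "L = 2 * (\<beta> * C5) + \<rho> * c + 1"
  define L' where "L' = L + \<rho> * c"
  define C2 where "C2 = Cv + Cd * L'^4 + 1"
  define C4 where "C4 = \<beta> * C2 + C3 * c^4 + 1"
  have c: "c > 0" using c1 by (simp add: c_def)
  have rc: "\<rho> * c \<ge> 0" using \<rho> c by simp
  have C5: "C5 > 0" using rc Cv by (simp add: C5_def)
  have bC5: "\<beta> * C5 \<ge> 0" using \<beta> C5 by simp
  have L: "L \<ge> 1" using bC5 rc by (simp add: L_def)
  have L': "L' \<ge> L" "L' > 0" using rc L by (auto simp: L'_def)
  have C2: "C2 > 0" using Cv abs_nn L' by (simp add: C2_def add_nonneg_pos)
  have C4: "C4 > 0" using \<beta> C2 abs_nn c by (simp add: C4_def add_nonneg_pos)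
  \<comment> \<open>In order: \<open>r \<le> 1\<close>; near stencils lie where the polynomial is
    accurate; the probing offset \<open>2 * C4 * h^3\<close> is less than \<open>R\<close> and at
    most \<open>L * r\<close>; \<open>n\<close> passes the two thresholds; the constant 1 is
    reproduced within 1/2.\<close>
  define r1 where "r1 = min (min 1 (r0 / L')) (min (min (R / (4 * C4)) (1 / (2 * C4)))
     (min (c1 / (real N3 + real N6 + 2)) (1 / (2 * C6 * c^4 + 1))))"
  have r1: "r1 > 0"
    using r0 L' R C4 c1 abs_nn c by (simp add: r1_def add_nonneg_pos)
  have main: "hausdorff_dist \<Gamma> (zero_level (A n v)) \<le> ennreal (2 * C4 * h^3)"
    if h: "0 < h" "h < min 1 (r1^2)" and nr: "c1 * h powr (-3/4) \<le> real n" and \<tau>: "\<bar>\<tau>\<bar> = 1"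
      and p1: "p1 \<in> \<Omega>1 - \<Gamma>" "infdist p1 \<Gamma> < R" and p2: "p2 \<in> \<Omega>2 - \<Gamma>" "infdist p2 \<Gamma> < R"
      and v: "\<forall>q\<in>mesh n. \<bar>v q - \<tau> * sdist q\<bar> \<le> Cv * h^3" for h n v \<tau> p1 p2
  proof -
    define r where "r = h powr (3/4)"
    have r: "r > 0" using h by (simp add: r_def)
    have r4: "r^4 = h^3"
    proof -
      have "r^4 = h powr real 3" unfolding r_def using h by (simp add: powr_power)
      also have "\<dots> = h^3" using h by (subst powr_realpow) auto
      finally show ?thesis .
    qed
    \<comment> \<open>For \<open>h \<le> 1\<close> one has
      \<open>r^2 = h powr (3/2) \<le> h\<close>, which explains the bound \<open>r1^2\<close> on
      \<open>h\<close>.\<close>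
    have rr1: "r \<le> r1"
    proof -
      have "r^2 = h powr (3/2)" unfolding r_def using h by (simp add: powr_power)
      also have "\<dots> \<le> h powr 1" using h by (intro powr_mono') auto
      also have "\<dots> \<le> r1^2" using h by simp
      finally have "r^2 \<le> r1^2" .
      then show ?thesis by (rule power2_le_imp_le) (rule less_imp_le[OF r1])
    qed
    have rle: "r \<le> 1" "r \<le> r0 / L'" "r \<le> R / (4 * C4)" "r \<le> 1 / (2 * C4)"
      "r \<le> c1 / (real N3 + real N6 + 2)" "r \<le> 1 / (2 * C6 * c^4 + 1)"
      using rr1 by (auto simp: r1_def)
    have h3: "h^3 > 0" using h by simp
    have h3r: "h^3 \<le> r"
      using power_decreasing[of 1 4 r] rle(1) r by (simp add: r4)
    have nr': "c1 \<le> real n * r"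
    proof -
      have "h powr (-3/4) = 1 / r" using powr_minus_divide[of h "3/4"] by (simp add: r_def)
      then have "c1 * (1 / r) \<le> real n" using nr by (simp only:)
      then show ?thesis using r by (simp add: field_simps)
    qed
    have nN: "real N3 + real N6 + 2 \<le> real n"
    proof -
      have "(real N3 + real N6 + 2) * r \<le> c1" using rle(5) by (simp add: field_simps)
      then have "(real N3 + real N6 + 2) * r \<le> real n * r" using nr' by linarith
      then show ?thesis using r by simp
    qed
    then have n: "n \<ge> 2" "n \<ge> N3" "n \<ge> N6" by linarith+
    define d where "d = 1 / real (n - 1)"
    have d: "d \<ge> 0" "d \<le> c * r"
    proof -
      show "d \<ge> 0" by (simp add: d_def)
      have n1: "real (n - 1) = real n - 1" "real n - 1 \<ge> real n / 2" using n by auto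
      have "c1 \<le> 2 * (real n - 1) * r" using nr' mult_right_mono[OF n1(2), of r] r by linarith
      then show "d \<le> c * r" using c1 n unfolding d_def c_def n1(1) by (simp add: field_simps)
    qed
    have d4: "d^4 \<le> c^4 * h^3"
      using power_mono[OF d(2) d(1), of 4] by (simp add: power_mult_distrib r4)
    have rd: "\<rho> / real (n - 1) \<le> \<rho> * c * r"
      using mult_left_mono[OF d(2) \<rho>] by (simp add: d_def mult.assoc)
    obtain \<sigma> where \<sigma>: "\<sigma> \<in> {-1, 1}"
      and side: "\<forall>s t. infdist (\<gamma> s + t *\<^sub>R \<nu> s) \<Gamma> = \<bar>t\<bar> \<and> \<bar>t\<bar> < R \<longrightarrow> sdist (\<gamma> s + t *\<^sub>R \<nu> s) = \<sigma> * t"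
      using sdist_tube[OF p1 p2] ..
    have \<sigma>1: "\<bar>\<sigma>\<bar> = 1" using \<sigma> by auto
    have ts: "\<bar>\<tau> * \<sigma>\<bar> = 1" using \<tau> \<sigma>1 by (simp add: abs_mult)
    have near: "\<bar>A n v p - \<tau> * \<sigma> * dist_poly s0 p\<bar> < C4 * h^3"
      if p: "p \<in> unit_square" and ps: "dist p (\<gamma> s0) \<le> L * r" for p s0
    proof -
      have close: "\<bar>v q - (\<tau> * \<sigma> * dist_poly s0 q + 0 * dist_poly s0 q)\<bar> \<le> C2 * h^3"
        if q: "q \<in> mesh n" "dist p q \<le> \<rho> / real (n - 1)" for q
      proof -
        have "dist q (\<gamma> s0) \<le> dist p q + dist p (\<gamma> s0)" by (rule dist_triangle3)
        also have "\<dots> \<le> \<rho> * c * r + L * r" using order_trans[OF q(2) rd] ps by linarith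
        also have "\<dots> = L' * r" by (simp add: L'_def algebra_simps)
        finally have qs: "dist q (\<gamma> s0) \<le> L' * r" .
        have "L' * r \<le> r0" using rle(2) L' by (simp add: field_simps)
        then have "\<bar>sdist q - \<sigma> * dist_poly s0 q\<bar> \<le> Cd0 * (L' * r)^4"
          using Cd0[rule_format, of \<sigma> "L' * r" q s0] side \<sigma>1 qs r L' by simp
        also have "\<dots> \<le> Cd * (L' * r)^4" by (intro mult_right_mono) (auto simp: Cd_def)
        also have "\<dots> = Cd * L'^4 * h^3" by (simp add: power_mult_distrib r4)
        finally have "\<bar>sdist q - \<sigma> * dist_poly s0 q\<bar> \<le> Cd * L'^4 * h^3" .
        then have "\<bar>\<tau>\<bar> * \<bar>sdist q - \<sigma> * dist_poly s0 q\<bar> \<le> Cd * L'^4 * h^3" using \<tau> by simp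
        then have "\<bar>\<tau> * sdist q - \<tau> * \<sigma> * dist_poly s0 q\<bar> \<le> Cd * L'^4 * h^3"
          unfolding abs_mult[symmetric] by (simp add: algebra_simps)
        moreover have "\<bar>v q - \<tau> * sdist q\<bar> \<le> Cv * h^3" using v q(1) by blast
        moreover have "C2 * h^3 = Cv * h^3 + Cd * L'^4 * h^3 + h^3" by (simp add: C2_def algebra_simps)
        ultimately show ?thesis using h3 by linarith
      qed
      have "\<bar>A n v p - A n (\<lambda>q. \<tau> * \<sigma> * dist_poly s0 q + 0 * dist_poly s0 q) p\<bar> \<le> \<beta> * (C2 * h^3)"
        by (rule loc[rule_format, OF n(1) p], intro conjI ballI impI, rule mult_pos_pos[OF C2 h3]) (rule close)
      then have 1: "\<bar>A n v p - \<tau> * \<sigma> * A n (dist_poly s0) p\<bar> \<le> \<beta> * (C2 * h^3)"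
        unfolding A_linear[OF n(1) p] by simp
      have "\<bar>A n (dist_poly s0) p - dist_poly s0 p\<bar> \<le> C30 * d^4"
        unfolding d_def by (rule C30[rule_format, OF n(2) p])
      also have "\<dots> \<le> C3 * d^4" by (intro mult_right_mono) (auto simp: C3_def)
      also have "\<dots> \<le> C3 * (c^4 * h^3)" using d4 abs_nn by (intro mult_left_mono) auto
      finally have "\<bar>\<tau> * \<sigma>\<bar> * \<bar>A n (dist_poly s0) p - dist_poly s0 p\<bar> \<le> C3 * (c^4 * h^3)" using ts by simp
      then have 2: "\<bar>\<tau> * \<sigma> * A n (dist_poly s0) p - \<tau> * \<sigma> * dist_poly s0 p\<bar> \<le> C3 * (c^4 * h^3)"
        unfolding abs_mult[symmetric] by (simp add: algebra_simps)
      have "C4 * h^3 = \<beta> * (C2 * h^3) + C3 * (c^4 * h^3) + h^3" by (simp add: C4_def algebra_simps)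
      then show ?thesis using 1 2 h3 by linarith
    qed
    \<comment> \<open>Over a far stencil the signed distance varies by at most the stencil radius,
      while its modulus exceeds \<open>L * r\<close>; the spline is therefore close to
      \<open>\<tau> * sdist p\<close> times a number of modulus at least 1/2.\<close>
    have far: "A n v p \<noteq> 0" if p: "p \<in> unit_square" and pf: "infdist p \<Gamma> > L * r" for p
    proof -
      have close: "\<bar>v q - (\<tau> * sdist p * 1 + 0 * 1)\<bar> \<le> C5 * r"
        if q: "q \<in> mesh n" "dist p q \<le> \<rho> / real (n - 1)" for q
      proof -
        have q': "q \<in> unit_square" using mesh_subset q(1) by (rule subsetD)
        have pq: "dist p q \<le> \<rho> * c * r" by (rule order_trans[OF q(2) rd])
        also have "\<dots> \<le> L * r" using r bC5 by (intro mult_right_mono) (auto simp: L_def)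
        finally have "dist p q < infdist p \<Gamma>" using pf by linarith
        then have "\<bar>sdist q - sdist p\<bar> \<le> dist p q" by (rule sdist_close[OF p q'])
        then have "\<bar>\<tau>\<bar> * \<bar>sdist q - sdist p\<bar> \<le> \<rho> * c * r" using \<tau> pq by simp
        then have "\<bar>\<tau> * sdist q - \<tau> * sdist p\<bar> \<le> \<rho> * c * r"
          unfolding abs_mult[symmetric] by (simp add: algebra_simps)
        moreover have "\<bar>v q - \<tau> * sdist q\<bar> \<le> Cv * h^3" using v q(1) by blast
        moreover have "Cv * h^3 \<le> Cv * r" using Cv h3r by (rule mult_left_mono[rotated])
        moreover have "C5 * r = \<rho> * c * r + Cv * r + r" by (simp add: C5_def algebra_simps)
        ultimately show ?thesis using r by linarith
      qed
      have "\<bar>A n v p - A n (\<lambda>q. \<tau> * sdist p * 1 + 0 * 1) p\<bar> \<le> \<beta> * (C5 * r)"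
        by (rule loc[rule_format, OF n(1) p], intro conjI ballI impI, rule mult_pos_pos[OF C5 r]) (rule close)
      then have 1: "\<bar>A n v p - \<tau> * sdist p * A n (\<lambda>_. 1) p\<bar> \<le> \<beta> * C5 * r"
        unfolding A_linear[OF n(1) p] by (simp add: mult.assoc)
      have "\<bar>A n (\<lambda>_. 1) p - 1\<bar> \<le> C60 * d^4"
        unfolding d_def by (rule C60[rule_format, OF n(3) p])
      also have "\<dots> \<le> C6 * d^4" by (intro mult_right_mono) (auto simp: C6_def)
      also have "\<dots> \<le> C6 * (c^4 * r)" using d4 abs_nn c h3r
        by (intro mult_left_mono) (auto intro: order_trans mult_left_mono)
      also have "\<dots> \<le> 1/2"
      proof -
        have "r * (2 * C6 * c^4 + 1) \<le> 1" using rle(6) abs_nn c by (simp add: pos_le_divide_eq add_nonneg_pos)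
        then show ?thesis using r by (simp add: algebra_simps)
      qed
      finally have one: "\<bar>A n (\<lambda>_. 1) p\<bar> \<ge> 1/2" by linarith
      have "\<bar>\<tau> * sdist p * A n (\<lambda>_. 1) p\<bar> = infdist p \<Gamma> * \<bar>A n (\<lambda>_. 1) p\<bar>"
        using \<tau> infdist_nonneg[of p \<Gamma>] by (simp add: abs_mult sdist_def)
      also have "\<dots> \<ge> infdist p \<Gamma> * (1/2)" using one infdist_nonneg by (intro mult_left_mono) auto
      finally have 2: "\<bar>\<tau> * sdist p * A n (\<lambda>_. 1) p\<bar> \<ge> infdist p \<Gamma> / 2" by simp
      have "L * r = 2 * (\<beta> * C5 * r) + (\<rho> * c) * r + r" by (simp add: L_def algebra_simps)
      moreover have "(\<rho> * c) * r \<ge> 0" using rc r by simp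
      ultimately have "infdist p \<Gamma> / 2 > \<beta> * C5 * r" using pf r by linarith
      then show ?thesis using 1 2 by auto
    qed
    show ?thesis
    proof (rule hausdorff_dist_le)
      fix z assume "z \<in> zero_level (A n v)"
      then have z: "z \<in> unit_square" "A n v z = 0" by (auto simp: zero_level_def)
      obtain s t where st: "z = \<gamma> s + t *\<^sub>R \<nu> s" "infdist z \<Gamma> = \<bar>t\<bar>" using nearest_point[of z] by blast
      have dz: "dist z (\<gamma> s) = \<bar>t\<bar>" using norm_normal[of s] by (simp add: st(1) dist_norm)
      have "infdist z \<Gamma> \<le> L * r" using far[OF z(1)] z(2) by linarith
      then have "dist z (\<gamma> s) \<le> L * r" using st(2) dz by simp
      \<comment> \<open>In the frame at the foot of the normal through \<open>z\<close> the
        polynomial equals the offset, so a zero of the spline forces the offset to be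
        \<open>O(h^3)\<close>.\<close>
      from near[OF z(1) this] have "\<bar>\<tau> * \<sigma> * t\<bar> < C4 * h^3"
        unfolding st(1) dist_poly_normal using z(2) st(1) by simp
      then have "\<bar>t\<bar> < C4 * h^3" using ts by (simp add: abs_mult)
      then have "dist (\<gamma> s) z \<le> 2 * C4 * h^3" using dz C4 h3 by (simp add: dist_commute)
      then show "\<exists>x\<in>\<Gamma>. dist x z \<le> 2 * C4 * h^3" by blast
    next
      fix x assume "x \<in> \<Gamma>"
      then obtain s where s: "x = \<gamma> s" by blast
      define t where "t = 2 * C4 * h^3"
      have t: "t > 0" using C4 h3 by (simp add: t_def)
      have tr: "t \<le> 2 * C4 * r" using C4 h3r by (simp add: t_def)
      have tR: "t < R" using tr rle(3) C4 R by (simp add: field_simps)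
      have t1: "2 * C4 * h^3 \<le> L * r"
      proof -
        have "r * r^3 \<le> r * r" using r rle(1) power_decreasing[of 1 3 r] by (intro mult_left_mono) auto
        then have "h^3 \<le> r * r" using r4 by (simp add: numeral_eq_Suc)
        then have "2 * C4 * h^3 \<le> (2 * C4 * r) * r" using C4 by simp
        also have "\<dots> \<le> 1 * r" using rle(4) C4 r by (intro mult_right_mono) (auto simp: field_simps)
        also have "\<dots> \<le> L * r" using L r by (intro mult_right_mono) auto
        finally show ?thesis .
      qed
      \<comment> \<open>The factor \<open>\<tau> * \<sigma>\<close> orients the spline along the
        normal, so that \<open>g a\<close> is within \<open>C4 * h^3\<close> of \<open>a\<close>;
        since \<open>t\<close> is twice that bound, \<open>g\<close> changes sign between
        \<open>-t\<close> and \<open>t\<close>.\<close>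
      define g where "g a = \<tau> * \<sigma> * A n v (\<gamma> s + a *\<^sub>R \<nu> s)" for a
      have inU: "\<gamma> s + a *\<^sub>R \<nu> s \<in> unit_square" if "\<bar>a\<bar> \<le> t" for a
      proof (cases "a = 0")
        case True
        then show ?thesis using inside by auto
      next
        case False
        have "\<bar>a\<bar> < R" using that tR by linarith
        from tube_subset[OF this False, of s] show ?thesis by (rule DiffD1)
      qed
      have "continuous_on {-t..t} g"
        unfolding g_def
        by (intro continuous_on_mult continuous_on_const continuous_on_compose2[OF A_continuous[OF n(1), of v]]
            continuous_intros image_subsetI inU) (auto simp: abs_le_iff)
      moreover have est: "\<bar>g a - a\<bar> < C4 * h^3" if "\<bar>a\<bar> \<le> t" for a
      proof -
        have "dist (\<gamma> s + a *\<^sub>R \<nu> s) (\<gamma> s) \<le> L * r"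
          using that t1 norm_normal[of s] by (simp add: dist_norm t_def)
        from near[OF inU[OF that] this]
        have *: "\<bar>A n v (\<gamma> s + a *\<^sub>R \<nu> s) - \<tau> * \<sigma> * a\<bar> < C4 * h^3" unfolding dist_poly_normal .
        have sq: "\<tau> * \<sigma> * (\<tau> * \<sigma>) = 1" using ts by (metis abs_mult_self_eq mult_1)
        have "g a - a = \<tau> * \<sigma> * (A n v (\<gamma> s + a *\<^sub>R \<nu> s) - \<tau> * \<sigma> * a)"
          using sq by (simp add: g_def algebra_simps)
        then have "\<bar>g a - a\<bar> = \<bar>\<tau> * \<sigma>\<bar> * \<bar>A n v (\<gamma> s + a *\<^sub>R \<nu> s) - \<tau> * \<sigma> * a\<bar>" by (simp add: abs_mult)
        then show ?thesis using * ts by simp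
      qed
      moreover have "g (-t) \<le> 0" "0 \<le> g t"
        using est[of "-t"] est[of t] t by (auto simp: t_def)
      ultimately obtain a where a: "-t \<le> a" "a \<le> t" "g a = 0"
        using IVT'[of g "-t" 0 t] t by auto
      define z where "z = \<gamma> s + a *\<^sub>R \<nu> s"
      have "\<tau> * \<sigma> \<noteq> 0" using ts by auto
      then have "A n v z = 0" using a(3) by (simp add: g_def z_def)
      moreover have "z \<in> unit_square" unfolding z_def using a by (intro inU) auto
      ultimately have "z \<in> zero_level (A n v)" by (simp add: zero_level_def)
      moreover have "dist x z \<le> t" using a norm_normal[of s] by (simp add: z_def s dist_norm abs_le_iff)
      ultimately show "\<exists>y\<in>zero_level (A n v). dist x y \<le> 2 * C4 * h^3" unfolding t_def by blast
    qed
  qed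
  have h0: "min 1 (r1^2) > 0" using r1 by simp
  show ?thesis
    by (rule exI[of _ "2 * C4"], rule exI[of _ "min 1 (r1^2)"], rule conjI, rule h0,
        intro allI impI, elim conjE) (rule main)
qed

end

section \<open>Integrals of functions with a jump across a graph\<close>

lemma measurable_below_graph:
  fixes g :: "real \<Rightarrow> real"
  assumes "continuous_on {a..b} g"
  shows "{p \<in> {a..b} \<times> {c..d}. snd p < g (fst p)} \<in> sets borel"
    and "{p \<in> {a..b} \<times> {c..d}. \<not> snd p < g (fst p)} \<in> sets borel"
proof -
  have cont: "continuous_on ({a..b} \<times> {c..d}) (\<lambda>p. snd p - g (fst p))"
    by (intro continuous_intros continuous_on_compose2[OF assms]) auto
  have "closed {p \<in> {a..b} \<times> {c..d}. snd p - g (fst p) \<in> {0..}}"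
    using continuous_closed_preimage[OF cont, of "{0..}"]
    by (simp add: vimage_def Int_def closed_Times conj_commute)
  then have *: "{p \<in> {a..b} \<times> {c..d}. snd p - g (fst p) \<in> {0..}} \<in> sets borel" by (rule borel_closed)
  moreover have "{p \<in> {a..b} \<times> {c..d}. \<not> snd p < g (fst p)} = {p \<in> {a..b} \<times> {c..d}. snd p - g (fst p) \<in> {0..}}"
    by (auto simp: not_less)
  ultimately show B: "{p \<in> {a..b} \<times> {c..d}. \<not> snd p < g (fst p)} \<in> sets borel" by simp
  have "{p \<in> {a..b} \<times> {c..d}. snd p < g (fst p)} = {a..b} \<times> {c..d} - {p \<in> {a..b} \<times> {c..d}. \<not> snd p < g (fst p)}"
    by blast
  moreover have "{a..b} \<times> {c..d} \<in> sets borel" by (intro borel_closed closed_Times) auto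
  ultimately show "{p \<in> {a..b} \<times> {c..d}. snd p < g (fst p)} \<in> sets borel" using B by simp
qed

text \<open>Every vertical section of the graph has at most one point, and the measure of the graph
  is the integral of the measures of its sections.\<close>

lemma negligible_graph:
  fixes g :: "real \<Rightarrow> real"
  assumes "continuous_on {a..b} g"
  shows "negligible ((\<lambda>x. (x, g x)) ` {a..b})"
proof -
  let ?G = "(\<lambda>x. (x, g x)) ` {a..b}"
  have "compact ?G" by (intro compact_continuous_image continuous_intros assms) auto
  then have "closed ?G" by (rule compact_imp_closed)
  then have s: "?G \<in> sets borel" by (rule borel_closed)
  then have "?G \<in> sets (lborel \<Otimes>\<^sub>M lborel)" by (metis lborel_prod sets_lborel)
  then have "emeasure (lborel \<Otimes>\<^sub>M lborel) ?G = (\<integral>\<^sup>+x. emeasure lborel (Pair x -` ?G) \<partial>lborel)"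
    by (rule lborel.emeasure_pair_measure_alt)
  also have "\<dots> = (\<integral>\<^sup>+(x::real). 0 \<partial>lborel)"
  proof (rule nn_integral_cong)
    fix x :: real
    have "Pair x -` ?G \<subseteq> {g x}" by auto
    then have "countable (Pair x -` ?G)" by (rule countable_subset) simp
    then have "Pair x -` ?G \<in> null_sets lborel" by (rule countable_imp_null_set_lborel)
    then show "emeasure lborel (Pair x -` ?G) = 0" by (rule null_setsD1)
  qed
  finally have "emeasure lborel ?G = 0" by (simp add: lborel_prod)
  then have "?G \<in> null_sets lborel" using s by (auto simp: null_sets_def)
  then show ?thesis by (simp add: negligible_iff_null_sets null_sets_completionI)
qed

text \<open>The graph itself is given to \<open>F2\<close>; by \<open>negligible_graph\<close> this
  choice is invisible to the integrals.\<close>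

definition glue :: "(real \<Rightarrow> real) \<Rightarrow> (plane \<Rightarrow> real) \<Rightarrow> (plane \<Rightarrow> real) \<Rightarrow> plane \<Rightarrow> real" where
  "glue g F1 F2 p = (if snd p < g (fst p) then F1 p else F2 p)"

lemma glue_integrable:
  assumes g: "continuous_on {a..b} g"
    and F: "continuous_on ({a..b} \<times> {c..d}) F1" "continuous_on ({a..b} \<times> {c..d}) F2"
  shows "set_integrable lborel ({a..b} \<times> {c..d}) (glue g F1 F2)"
proof -
  let ?X = "{a..b} \<times> {c..d}"
  let ?A = "{p \<in> ?X. snd p < g (fst p)}" and ?B = "{p \<in> ?X. \<not> snd p < g (fst p)}"
  have X: "compact ?X" by (intro compact_Times) auto
  have "(\<lambda>p. indicator ?A p *\<^sub>R F1 p + indicator ?B p *\<^sub>R F2 p) \<in> borel_measurable borel"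
    using measurable_below_graph[OF g, of c d]
    by (intro borel_measurable_add borel_measurable_continuous_on_indicator continuous_on_subset[OF F(1)]
        continuous_on_subset[OF F(2)]) auto
  moreover have "(\<lambda>p. indicator ?A p *\<^sub>R F1 p + indicator ?B p *\<^sub>R F2 p) = (\<lambda>p. indicator ?X p *\<^sub>R glue g F1 F2 p)"
    by (auto simp: indicator_def glue_def)
  ultimately have meas: "(\<lambda>p. indicator ?X p *\<^sub>R glue g F1 F2 p) \<in> borel_measurable lborel" by simp
  obtain B1 where B1: "\<And>p. p \<in> ?X \<Longrightarrow> norm (F1 p) \<le> B1"
    using compact_imp_bounded[OF compact_continuous_image[OF F(1) X]] unfolding bounded_iff by (metis imageI)
  obtain B2 where B2: "\<And>p. p \<in> ?X \<Longrightarrow> norm (F2 p) \<le> B2"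
    using compact_imp_bounded[OF compact_continuous_image[OF F(2) X]] unfolding bounded_iff by (metis imageI)
  have fin: "emeasure lborel ?X < \<infinity>" using emeasure_compact_finite[OF X] by simp
  show ?thesis unfolding set_integrable_def
  proof (rule integrableI_bounded_set[OF _ meas fin])
    show "?X \<in> sets lborel" using X by (simp add: borel_compact)
    show "AE p in lborel. p \<in> ?X \<longrightarrow> norm (indicator ?X p *\<^sub>R glue g F1 F2 p) \<le> max B1 B2"
      using B1 B2 by (intro AE_I2) (auto simp: glue_def le_max_iff_disj)
  qed (auto simp: indicator_def)
qed

text \<open>Connects the gauge integral of \<open>cell_avg\<close> with iterated integrals by way of
  the Lebesgue integral on the product, whence the Borel form of the assumptions.\<close>

lemma fubini_rectangle:
  fixes H :: "plane \<Rightarrow> real"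
  assumes H: "set_integrable lborel ({a..b} \<times> {c..d}) H"
    and slice: "\<And>x. x \<in> {a..b} \<Longrightarrow> set_integrable lborel {c..d} (\<lambda>y. H (x, y))"
  shows "integral ({a..b} \<times> {c..d}) H = integral {a..b} (\<lambda>x. integral {c..d} (\<lambda>y. H (x, y)))"
    and "(\<lambda>x. integral {c..d} (\<lambda>y. H (x, y))) integrable_on {a..b}"
proof -
  let ?X = "{a..b} \<times> {c..d}"
  have I: "integrable (lborel \<Otimes>\<^sub>M lborel) (\<lambda>p. indicator ?X p *\<^sub>R H p)"
    using H unfolding set_integrable_def lborel_prod .
  have inner: "(LINT y|lborel. indicator ?X (x, y) *\<^sub>R H (x, y)) = indicator {a..b} x *\<^sub>R integral {c..d} (\<lambda>y. H (x, y))" for x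
  proof (cases "x \<in> {a..b}")
    case True
    have "(LINT y|lborel. indicator ?X (x, y) *\<^sub>R H (x, y)) = (LINT y:{c..d}|lborel. H (x, y))"
      unfolding set_lebesgue_integral_def using True by (intro Bochner_Integration.integral_cong) (auto simp: indicator_def)
    then show ?thesis using True set_borel_integral_eq_integral(2)[OF slice[OF True]] by simp
  next
    case False
    then have "(\<lambda>y. indicator ?X (x, y) *\<^sub>R H (x, y)) = (\<lambda>_. 0)" by (auto simp: indicator_def)
    then have "(LINT y|lborel. indicator ?X (x, y) *\<^sub>R H (x, y)) = 0" by (rule ssubst) (rule Bochner_Integration.integral_zero)
    then show ?thesis using False by simp
  qed
  have si: "set_integrable lborel {a..b} (\<lambda>x. integral {c..d} (\<lambda>y. H (x, y)))"
    using lborel_pair.integrable_fst'[OF I] unfolding set_integrable_def inner .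
  show "(\<lambda>x. integral {c..d} (\<lambda>y. H (x, y))) integrable_on {a..b}"
    by (rule set_borel_integral_eq_integral(1)[OF si])
  have "integral ?X H = (LINT p|(lborel \<Otimes>\<^sub>M lborel). indicator ?X p *\<^sub>R H p)"
    using set_borel_integral_eq_integral(2)[OF H] unfolding set_lebesgue_integral_def lborel_prod by simp
  also have "\<dots> = (LINT x:{a..b}|lborel. integral {c..d} (\<lambda>y. H (x, y)))"
    unfolding lborel_pair.integral_fst'[OF I, symmetric] inner set_lebesgue_integral_def ..
  also have "\<dots> = integral {a..b} (\<lambda>x. integral {c..d} (\<lambda>y. H (x, y)))"
    by (rule set_borel_integral_eq_integral(2)[OF si])
  finally show "integral ?X H = integral {a..b} (\<lambda>x. integral {c..d} (\<lambda>y. H (x, y)))" .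
qed

section \<open>Affine polynomials: primitives and cell averages\<close>

definition lin_poly :: "coeffs \<Rightarrow> plane \<Rightarrow> real" where
  "lin_poly = (\<lambda>(a, b, c) (x, y). a * x + b * y + c)"

text \<open>The primitive in \<open>y\<close> that vanishes at \<open>y = 0\<close>. That it is
  quadratic in \<open>y\<close> is the source of the quadratic residual.\<close>

definition lin_prim :: "coeffs \<Rightarrow> real \<Rightarrow> real \<Rightarrow> real" where
  "lin_prim = (\<lambda>(a, b, c) x y. (a * x + c) * y + b * y^2 / 2)"

lemma lin_prim: "((\<lambda>y. lin_prim l x y) has_vector_derivative lin_poly l (x, y)) (at y within S)"
  unfolding lin_prim_def lin_poly_def case_prod_unfold has_real_derivative_iff_has_vector_derivative[symmetric]
  by (auto intro!: derivative_eq_intros)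

lemma continuous_on_lin_poly: "continuous_on S (lin_poly l)"
  unfolding lin_poly_def case_prod_unfold by (intro continuous_intros)

lemma continuous_on_lin_poly_y: "continuous_on S (\<lambda>y. lin_poly l (x, y))"
  unfolding lin_poly_def case_prod_unfold by (intro continuous_intros)

lemma lin_poly_interval_integral:
  "(LBINT y=ereal c..ereal d. lin_poly l (x, y)) = lin_prim l x d - lin_prim l x c"
  by (rule interval_integral_FTC_finite) (auto intro: continuous_on_lin_poly_y lin_prim)

lemma lin_poly_has_integral:
  "c \<le> d \<Longrightarrow> ((\<lambda>y. lin_poly l (x, y)) has_integral lin_prim l x d - lin_prim l x c) {c..d}"
  by (rule fundamental_theorem_of_calculus) (auto intro: lin_prim)

text \<open>By symmetry an affine function averages to its value at the cell centre, which turns a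
  fit to cell averages into interpolation at the centres.\<close>

lemma lin_poly_average:
  assumes h: "h > 0"
  shows "cell_avg h (lin_poly l) i j = lin_poly l ((real i - 1/2) * h, (real j - 1/2) * h)"
proof -
  obtain a b c where l: "l = (a, b, c)" by (cases l)
  define x0 x1 y0 y1 where "x0 = (real i - 1) * h" and "x1 = real i * h" and "y0 = (real j - 1) * h" and "y1 = real j * h"
  have x1: "x1 = x0 + h" and y1: "y1 = y0 + h" by (simp_all add: x0_def x1_def y0_def y1_def left_diff_distrib)
  have le: "x0 \<le> x1" "y0 \<le> y1" using h x1 y1 by auto
  have "integral ({x0..x1} \<times> {y0..y1}) (lin_poly l)
      = integral {x0..x1} (\<lambda>x. integral {y0..y1} (\<lambda>y. lin_poly l (x, y)))"
    using integral_prod_continuous[of x0 y0 x1 y1 "lin_poly l"] continuous_on_lin_poly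
    by (simp add: cbox_Pair_eq)
  also have "\<dots> = integral {x0..x1} (\<lambda>x. a * h * x + (c * h + b * (y1^2 - y0^2) / 2))"
    unfolding integral_unique[OF lin_poly_has_integral[OF le(2)]]
    by (rule integral_cong) (simp add: l lin_prim_def y1 algebra_simps diff_divide_distrib)
  also have "((\<lambda>x. a * h * x + (c * h + b * (y1^2 - y0^2) / 2)) has_integral
     (a * h * x1^2 / 2 + (c * h + b * (y1^2 - y0^2) / 2) * x1) - (a * h * x0^2 / 2 + (c * h + b * (y1^2 - y0^2) / 2) * x0)) {x0..x1}"
    by (rule fundamental_theorem_of_calculus[OF le(1)], unfold has_real_derivative_iff_has_vector_derivative[symmetric])
       (auto intro!: derivative_eq_intros)
  note integral_unique[OF this]
  also have "(a * h * x1^2 / 2 + (c * h + b * (y1^2 - y0^2) / 2) * x1) - (a * h * x0^2 / 2 + (c * h + b * (y1^2 - y0^2) / 2) * x0)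
     = h^2 * lin_poly l (x0 + h / 2, y0 + h / 2)"
    by (simp add: l lin_poly_def x1 y1 power2_eq_square algebra_simps add_divide_distrib)
  finally have "cell_avg h (lin_poly l) i j = lin_poly l (x0 + h / 2, y0 + h / 2)"
    using h by (simp add: cell_avg_def x0_def x1_def y0_def y1_def)
  moreover have "x0 + h / 2 = (real i - 1/2) * h" "y0 + h / 2 = (real j - 1/2) * h"
    by (simp_all add: x0_def y0_def algebra_simps)
  ultimately show ?thesis by (simp only:)
qed

section \<open>The residual and its linearization\<close>

text \<open>The fit is interpolation at three centres forming a right angle, so the slopes are
  difference quotients and the fit is unique. The row \<open>j'\<close> may lie on either side of
  \<open>j\<close>, which covers both fits of a window.\<close>

lemma linear_fit_eq:
  fixes F :: "plane \<Rightarrow> real" and h :: real and i j j' :: nat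
  assumes h: "h > 0" and j: "j' \<noteq> j"
  defines "m \<equiv> cell_avg h F"
  defines "\<alpha> \<equiv> (m (Suc i) j - m i j) / h"
  defines "\<beta> \<equiv> (m i j' - m i j) / ((real j' - real j) * h)"
  shows "linear_fit h F {(i, j'), (i, j), (Suc i, j)}
    = lin_poly (\<alpha>, \<beta>, m i j - \<alpha> * ((real i - 1/2) * h) - \<beta> * ((real j - 1/2) * h))"
proof -
  have nz: "(real j' - real j) * h \<noteq> 0" using h j by simp
  show ?thesis
    unfolding linear_fit_def
  proof (rule the_equality)
    let ?l = "(\<alpha>, \<beta>, m i j - \<alpha> * ((real i - 1/2) * h) - \<beta> * ((real j - 1/2) * h))"
    have hn: "h \<noteq> 0" using h by simp
    have e1: "\<alpha> * h = m (Suc i) j - m i j" using hn by (simp add: \<alpha>_def)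
    have e2: "\<beta> * ((real j' - real j) * h) = m i j' - m i j" by (rule nonzero_eq_divide_eq[OF nz, THEN iffD1]) (simp only: \<beta>_def)
    have "cell_avg h (lin_poly ?l) i j = m i j" "cell_avg h (lin_poly ?l) (Suc i) j = m (Suc i) j"
      unfolding lin_poly_average[OF h] using e1 by (simp_all add: lin_poly_def algebra_simps)
    moreover have "cell_avg h (lin_poly ?l) i j' = m i j'"
      unfolding lin_poly_average[OF h] using e2 by (simp add: lin_poly_def algebra_simps)
    ultimately show "(\<exists>\<alpha> \<beta> \<gamma>. lin_poly ?l = (\<lambda>(x, y). \<alpha> * x + \<beta> * y + \<gamma>)) \<and>
        (\<forall>(i, j)\<in>{(i, j'), (i, j), (Suc i, j)}. cell_avg h (lin_poly ?l) i j = cell_avg h F i j)"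
      by (auto simp: m_def lin_poly_def)
  next
    fix L assume L: "(\<exists>\<alpha> \<beta> \<gamma>. L = (\<lambda>(x, y). \<alpha> * x + \<beta> * y + \<gamma>)) \<and>
        (\<forall>(i, j)\<in>{(i, j'), (i, j), (Suc i, j)}. cell_avg h L i j = cell_avg h F i j)"
    then obtain a b c where "L = (\<lambda>(x, y). a * x + b * y + c)" by blast
    then have l: "L = lin_poly (a, b, c)" by (simp add: lin_poly_def)
    from L have "cell_avg h L i j' = m i j'" "cell_avg h L i j = m i j" "cell_avg h L (Suc i) j = m (Suc i) j"
      by (simp_all add: m_def)
    then have m: "a * ((real i - 1/2) * h) + b * ((real j' - 1/2) * h) + c = m i j'"
       "a * ((real i - 1/2) * h) + b * ((real j - 1/2) * h) + c = m i j"
       "a * ((real (Suc i) - 1/2) * h) + b * ((real j - 1/2) * h) + c = m (Suc i) j"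
      unfolding l lin_poly_average[OF h] by (simp_all add: lin_poly_def)
    have "m (Suc i) j - m i j = a * h" unfolding m[symmetric] by (simp add: algebra_simps)
    then have a: "\<alpha> = a" using h by (simp add: \<alpha>_def)
    have "m i j' - m i j = b * ((real j' - real j) * h)" unfolding m[symmetric] by (simp add: algebra_simps)
    then have b: "\<beta> = b" unfolding \<beta>_def using nz by simp
    have c: "m i j - \<alpha> * ((real i - 1/2) * h) - \<beta> * ((real j - 1/2) * h) = c" unfolding a b m(2)[symmetric] by simp
    show "L = lin_poly (\<alpha>, \<beta>, m i j - \<alpha> * ((real i - 1/2) * h) - \<beta> * ((real j - 1/2) * h))"
      unfolding l c unfolding a b ..
  qed
qed

text \<open>Dividing by the distance \<open>h\<close> of the centres amplifies the error
  \<open>e\<close> of the averages to \<open>2 * e / h\<close> in the slopes; at distance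
  \<open>O(h)\<close> from the centre the values remain accurate to \<open>O(e)\<close>.\<close>

lemma linear_fit_close:
  assumes h: "h > 0" and j: "\<bar>real j' - real j\<bar> = 1"
    and close: "\<And>k l. (k, l) \<in> {(i, j'), (i, j), (Suc i, j)} \<Longrightarrow>
      \<bar>cell_avg h F k l - lin_poly (a, b, c) ((real k - 1/2) * h, (real l - 1/2) * h)\<bar> \<le> e"
  shows "\<exists>a' b' c'. linear_fit h F {(i, j'), (i, j), (Suc i, j)} = lin_poly (a', b', c') \<and>
    \<bar>a' - a\<bar> \<le> 2 * e / h \<and> \<bar>b' - b\<bar> \<le> 2 * e / h \<and>
    (\<forall>x y. \<bar>lin_poly (a', b', c') (x, y) - lin_poly (a, b, c) (x, y)\<bar>
       \<le> e + 2 * e / h * (\<bar>x - (real i - 1/2) * h\<bar> + \<bar>y - (real j - 1/2) * h\<bar>))"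
proof -
  define m where "m = cell_avg h F"
  define \<alpha> where "\<alpha> = (m (Suc i) j - m i j) / h"
  define \<beta> where "\<beta> = (m i j' - m i j) / ((real j' - real j) * h)"
  define xc yc where "xc = (real i - 1/2) * h" and "yc = (real j - 1/2) * h"
  have jj: "j' \<noteq> j" using j by auto
  have fit: "linear_fit h F {(i, j'), (i, j), (Suc i, j)} = lin_poly (\<alpha>, \<beta>, m i j - \<alpha> * xc - \<beta> * yc)"
    unfolding m_def \<alpha>_def \<beta>_def xc_def yc_def by (rule linear_fit_eq[OF h jj])
  have m: "\<bar>m i j - (a * xc + b * yc + c)\<bar> \<le> e" "\<bar>m (Suc i) j - (a * (xc + h) + b * yc + c)\<bar> \<le> e"
    "\<bar>m i j' - (a * xc + b * (yc + (real j' - real j) * h) + c)\<bar> \<le> e"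
    using close[of i j] close[of "Suc i" j] close[of i j']
    by (simp_all add: m_def lin_poly_def xc_def yc_def algebra_simps)
  have "(\<alpha> - a) * h = (m (Suc i) j - (a * (xc + h) + b * yc + c)) - (m i j - (a * xc + b * yc + c))"
  proof -
    have "\<alpha> * h = m (Suc i) j - m i j" using h by (simp add: \<alpha>_def)
    then show ?thesis by (simp add: algebra_simps)
  qed
  then have "\<bar>\<alpha> - a\<bar> * h \<le> 2 * e" using m h by (simp add: abs_mult[symmetric, of _ h] abs_mult_pos) 
  then have a: "\<bar>\<alpha> - a\<bar> \<le> 2 * e / h" using h by (simp add: field_simps)
  have nz: "(real j' - real j) * h \<noteq> 0" using h jj by simp
  have "\<beta> * ((real j' - real j) * h) = m i j' - m i j" by (rule nonzero_eq_divide_eq[OF nz, THEN iffD1]) (simp only: \<beta>_def)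
  then have "(\<beta> - b) * ((real j' - real j) * h) = (m i j' - (a * xc + b * (yc + (real j' - real j) * h) + c)) - (m i j - (a * xc + b * yc + c))"
    by (simp add: algebra_simps)
  then have "\<bar>(\<beta> - b) * ((real j' - real j) * h)\<bar> \<le> 2 * e" using m by linarith
  then have "\<bar>\<beta> - b\<bar> * h \<le> 2 * e" using h j by (simp add: abs_mult)
  then have b: "\<bar>\<beta> - b\<bar> \<le> 2 * e / h" using h by (simp add: field_simps)
  have "\<bar>lin_poly (\<alpha>, \<beta>, m i j - \<alpha> * xc - \<beta> * yc) (x, y) - lin_poly (a, b, c) (x, y)\<bar>
       \<le> e + 2 * e / h * (\<bar>x - xc\<bar> + \<bar>y - yc\<bar>)" for x y
  proof -
    have "lin_poly (\<alpha>, \<beta>, m i j - \<alpha> * xc - \<beta> * yc) (x, y) - lin_poly (a, b, c) (x, y)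
      = (m i j - (a * xc + b * yc + c)) + (\<alpha> - a) * (x - xc) + (\<beta> - b) * (y - yc)"
      by (simp add: lin_poly_def algebra_simps)
    moreover have "\<bar>(\<alpha> - a) * (x - xc)\<bar> \<le> 2 * e / h * \<bar>x - xc\<bar>" "\<bar>(\<beta> - b) * (y - yc)\<bar> \<le> 2 * e / h * \<bar>y - yc\<bar>"
      unfolding abs_mult by (intro mult_right_mono a b abs_ge_zero)+
    ultimately show ?thesis using m(1) by (simp only: distrib_left)
  qed
  then show ?thesis using fit a b unfolding xc_def yc_def by blast
qed

text \<open>A cell of the fit may touch \<Gamma> on its edge, where \<open>F\<close> may take the
  value of the other side; the null set \<open>N\<close> absorbs this.\<close>

lemma cell_avg_close:
  assumes h: "h > 0"
    and cell: "C = {(real i - 1) * h..real i * h} \<times> {(real j - 1) * h..real j * h}"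
    and F: "continuous_on C F'" "negligible N" "\<And>p. p \<in> C - N \<Longrightarrow> F p = F' p"
    and close: "\<And>p. p \<in> C \<Longrightarrow> \<bar>F' p - lin_poly l p\<bar> \<le> e"
  shows "\<bar>cell_avg h F i j - lin_poly l ((real i - 1/2) * h, (real j - 1/2) * h)\<bar> \<le> e"
proof -
  define a b where "a = ((real i - 1) * h, (real j - 1) * h)" and "b = (real i * h, real j * h)"
  have C: "C = cbox a b" by (simp add: cell a_def b_def cbox_Pair_eq)
  have cont: "measure lborel (cbox a b) = h^2"
    using h by (simp add: a_def b_def content_Pair power2_eq_square algebra_simps)
  have e: "e \<ge> 0"
  proof -
    have "a \<in> C" using h by (auto simp: cell a_def intro: mult_right_mono)
    then show ?thesis using close[of a] by linarith
  qed
  have i1: "F' integrable_on cbox a b" using F(1) unfolding C by (rule integrable_continuous)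
  have i2: "lin_poly l integrable_on cbox a b" by (rule integrable_continuous[OF continuous_on_lin_poly])
  have "integral C F = integral C F'" by (rule integral_spike[OF F(2)]) (use F(3) in auto)
  then have "cell_avg h F i j = 1 / h^2 * integral (cbox a b) F'" unfolding cell_avg_def cell[symmetric] C by simp
  moreover have "lin_poly l ((real i - 1/2) * h, (real j - 1/2) * h) = 1 / h^2 * integral (cbox a b) (lin_poly l)"
    unfolding lin_poly_average[OF h, symmetric] cell_avg_def cell[symmetric] C ..
  ultimately have "\<bar>cell_avg h F i j - lin_poly l ((real i - 1/2) * h, (real j - 1/2) * h)\<bar>
     = 1 / h^2 * \<bar>integral (cbox a b) (\<lambda>p. F' p - lin_poly l p)\<bar>"
    using h by (simp add: Henstock_Kurzweil_Integration.integral_diff[OF i1 i2] diff_divide_distrib[symmetric])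
  also have "\<bar>integral (cbox a b) (\<lambda>p. F' p - lin_poly l p)\<bar> \<le> e * h^2"
    using has_integral_bound[OF e integrable_integral[OF integrable_diff[OF i1 i2]]] close unfolding C cont by simp
  finally show ?thesis using h by (simp add: field_simps)
qed

section \<open>Columns of cells and their integrals\<close>

lemma integral_stack:
  fixes H :: "plane \<Rightarrow> real"
  assumes H: "H integrable_on {a..b} \<times> {c..e}" and d: "c \<le> d" "d \<le> e"
  shows "integral ({a..b} \<times> {c..e}) H = integral ({a..b} \<times> {c..d}) H + integral ({a..b} \<times> {d..e}) H"
proof -
  have b: "{a..b} \<times> {c'..d'} = cbox (a, c') (b, d')" for c' d' :: real by (simp add: cbox_Pair_eq)
  have "H integrable_on {a..b} \<times> {c..d}" "H integrable_on {a..b} \<times> {d..e}"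
    unfolding b by (rule integrable_on_subcbox[OF H[unfolded b]]; use d in \<open>auto simp: cbox_Pair_eq\<close>)+
  moreover have "negligible (({a..b} \<times> {c..d}) \<inter> ({a..b} \<times> {d..e}))"
  proof (rule negligible_subset)
    show "negligible {x. x \<bullet> (0::real, 1::real) = d}"
      by (rule negligible_standard_hyperplane) (simp add: Basis_prod_def)
    show "({a..b} \<times> {c..d}) \<inter> ({a..b} \<times> {d..e}) \<subseteq> {x. x \<bullet> (0, 1) = d}" by auto
  qed
  ultimately have "integral ({a..b} \<times> {c..d} \<union> {a..b} \<times> {d..e}) H = integral ({a..b} \<times> {c..d}) H + integral ({a..b} \<times> {d..e}) H"
    by (rule integral_Un)
  moreover have "{a..b} \<times> {c..d} \<union> {a..b} \<times> {d..e} = {a..b} \<times> {c..e}" using d by auto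
  ultimately show ?thesis by simp
qed

lemma column_sum:
  assumes h: "h > 0" and H: "H integrable_on {(real i - 1) * h..real i * h} \<times> {3 * h..7 * h}"
    and N: "negligible N" "\<And>p. p \<in> {(real i - 1) * h..real i * h} \<times> {3 * h..7 * h} - N \<Longrightarrow> F p = H p"
  shows "(\<Sum>j=4..7. cell_avg h F i j) = 1 / h^2 * integral ({(real i - 1) * h..real i * h} \<times> {3 * h..7 * h}) H"
proof -
  let ?I = "{(real i - 1) * h..real i * h}"
  have F: "F integrable_on ?I \<times> {3 * h..7 * h}" by (rule integrable_spike[OF H N(1)]) (use N(2) in auto)
  have sub: "F integrable_on ?I \<times> {c..d}" if "3 * h \<le> c" "d \<le> 7 * h" for c d
  proof -
    have b: "?I \<times> {c'..d'} = cbox ((real i - 1) * h, c') (real i * h, d')" for c' d' :: real by (simp add: cbox_Pair_eq)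
    show ?thesis unfolding b by (rule integrable_on_subcbox[OF F[unfolded b]]) (use that in \<open>auto simp: cbox_Pair_eq\<close>)
  qed
  have "integral (?I \<times> {3 * h..7 * h}) H = integral (?I \<times> {3 * h..7 * h}) F"
    by (rule integral_spike[OF N(1)]) (use N(2) in auto)
  also have "\<dots> = integral (?I \<times> {3 * h..4 * h}) F + integral (?I \<times> {4 * h..5 * h}) F
     + integral (?I \<times> {5 * h..6 * h}) F + integral (?I \<times> {6 * h..7 * h}) F"
    using h by (simp add: integral_stack[OF F, of "6 * h"] integral_stack[OF sub, of "3 * h" "6 * h" "5 * h"]
        integral_stack[OF sub, of "3 * h" "5 * h" "4 * h"])
  finally show ?thesis by (simp add: cell_avg_def eval_nat_numeral distrib_left)
qed

lemma lin_poly_diff: "lin_poly (l - l') p = lin_poly l p - lin_poly l' p"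
  by (cases l; cases l'; cases p) (simp add: lin_poly_def algebra_simps)

lemma lin_prim_diff: "lin_prim (l - l') x y = lin_prim l x y - lin_prim l' x y"
  by (cases l; cases l') (simp add: lin_prim_def algebra_simps diff_divide_distrib)

lemma lin_prim_step:
  "lin_prim (a, b, c) x (q + e) - lin_prim (a, b, c) x q = e * lin_poly (a, b, c) (x, q) + b * e^2 / 2"
  by (simp add: lin_prim_def lin_poly_def power2_eq_square algebra_simps add_divide_distrib)

text \<open>The midpoint rule is exact for affine integrands.\<close>

lemma lin_prim_midpoint: "lin_prim l x q - lin_prim l x g = (q - g) * lin_poly l (x, (q + g) / 2)"
  by (cases l) (simp add: lin_prim_def lin_poly_def power2_eq_square field_simps)

lemma continuous_on_lin_prim: "continuous_on S f \<Longrightarrow> continuous_on S (\<lambda>x. lin_prim l x (f x))"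
  unfolding lin_prim_def case_prod_unfold by (intro continuous_intros) auto

lemma continuous_on_quad: "continuous_on S (quad h u)"
  unfolding quad_def case_prod_unfold by (intro continuous_intros)

lemma LBINT_eq_integral:
  fixes f :: "real \<Rightarrow> real"
  assumes "a \<le> b" "continuous_on {a..b} f"
  shows "(LBINT x=ereal a..ereal b. f x) = integral {a..b} f"
  by (rule interval_integral_eq_integral[OF assms(1) borel_integrable_atLeastAtMost'[OF assms(2)]])

text \<open>Writing the inner integrals as differences of primitives settles their orientation, so
  the formula also holds where the quadratic drops below \<open>3 * h\<close>.\<close>

lemma column_integral_eq:
  assumes h: "h > 0" and L: "L\<^sub>1 h F = lin_poly l1" "L\<^sub>2 h F = lin_poly l2"
  shows "column_integral h F i u = 1 / h^2 * integral {(real i - 1) * h..real i * h}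
     (\<lambda>x. lin_prim (l1 - l2) x (quad h u x) - lin_prim (l1 - l2) x (3 * h)
        + (lin_prim l2 x (7 * h) - lin_prim l2 x (3 * h)))"
proof -
  let ?I = "{(real i - 1) * h..real i * h}"
  have le: "(real i - 1) * h \<le> real i * h" using h by (intro mult_right_mono) auto
  have c1: "continuous_on ?I (\<lambda>x. lin_prim (l1 - l2) x (quad h u x) - lin_prim (l1 - l2) x (3 * h))"
    and c2: "continuous_on ?I (\<lambda>x. lin_prim l2 x (7 * h) - lin_prim l2 x (3 * h))"
    by (intro continuous_intros continuous_on_lin_prim continuous_on_quad)+
  show ?thesis
    unfolding column_integral_def L lin_poly_diff[symmetric] lin_poly_interval_integral
      LBINT_eq_integral[OF le c1] LBINT_eq_integral[OF le c2]
      Henstock_Kurzweil_Integration.integral_add[OF integrable_continuous_interval[OF c1] integrable_continuous_interval[OF c2]] ..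
qed

lemma glue_slice:
  assumes g: "c \<le> g x" "g x \<le> d"
  shows "set_integrable lborel {c..d} (\<lambda>y. glue g (lin_poly l1) (lin_poly l2) (x, y))"
    and "integral {c..d} (\<lambda>y. glue g (lin_poly l1) (lin_poly l2) (x, y))
      = (lin_prim l1 x (g x) - lin_prim l1 x c) + (lin_prim l2 x d - lin_prim l2 x (g x))"
proof -
  let ?H = "\<lambda>y. glue g (lin_poly l1) (lin_poly l2) (x, y)"
  have "set_integrable lborel {c..<g x} (\<lambda>y. lin_poly l1 (x, y))"
    by (rule set_integrable_subset[OF borel_integrable_atLeastAtMost'[of c "g x"]]) (auto intro: continuous_on_lin_poly_y)
  then have 1: "set_integrable lborel {c..<g x} ?H"
    by (rule set_integrable_cong[THEN iffD1, rotated -1]) (auto simp: glue_def)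
  have "set_integrable lborel {g x..d} (\<lambda>y. lin_poly l2 (x, y))"
    by (rule borel_integrable_atLeastAtMost') (rule continuous_on_lin_poly_y)
  then have 2: "set_integrable lborel {g x..d} ?H"
    by (rule set_integrable_cong[THEN iffD1, rotated -1]) (auto simp: glue_def)
  have "{c..<g x} \<union> {g x..d} = {c..d}" using g by auto
  then show "set_integrable lborel {c..d} ?H" using set_integrable_Un[OF 1 2] by simp
  have "(?H has_integral lin_prim l1 x (g x) - lin_prim l1 x c) {c..g x}"
    by (rule has_integral_spike[OF negligible_sing[of "g x"] _ lin_poly_has_integral[OF g(1)]]) (auto simp: glue_def)
  moreover have "(?H has_integral lin_prim l2 x d - lin_prim l2 x (g x)) {g x..d}"
    by (rule has_integral_eq[OF _ lin_poly_has_integral[OF g(2)]]) (auto simp: glue_def)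
  ultimately have "(?H has_integral (lin_prim l1 x (g x) - lin_prim l1 x c) + (lin_prim l2 x d - lin_prim l2 x (g x))) {c..d}"
    by (rule has_integral_combine[OF g])
  then show "integral {c..d} ?H = (lin_prim l1 x (g x) - lin_prim l1 x c) + (lin_prim l2 x d - lin_prim l2 x (g x))"
    by (rule integral_unique)
qed

text \<open>Replacing \<open>F1\<close> and \<open>F2\<close> by affine functions costs at most
  \<open>e\<close> times the area \<open>4 * h^2\<close> of the column; for affine functions the
  column integral is computed by slices.\<close>

lemma column_value:
  assumes h: "h > 0" and I: "I = {(real i - 1) * h..real i * h}"
    and g: "continuous_on I g" "\<And>x. x \<in> I \<Longrightarrow> 3 * h \<le> g x \<and> g x \<le> 7 * h"
    and F: "continuous_on (I \<times> {3 * h..7 * h}) F1" "continuous_on (I \<times> {3 * h..7 * h}) F2"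
    and close: "\<And>p. p \<in> I \<times> {3 * h..7 * h} \<Longrightarrow> \<bar>F1 p - lin_poly l1 p\<bar> \<le> e \<and> \<bar>F2 p - lin_poly l2 p\<bar> \<le> e"
  shows "\<bar>1 / h^2 * integral (I \<times> {3 * h..7 * h}) (glue g F1 F2) - 1 / h^2 * integral I
     (\<lambda>x. (lin_prim l1 x (g x) - lin_prim l1 x (3 * h)) + (lin_prim l2 x (7 * h) - lin_prim l2 x (g x)))\<bar> \<le> 4 * e"
proof -
  let ?X = "I \<times> {3 * h..7 * h}" and ?G = "glue g (lin_poly l1) (lin_poly l2)"
  have s1: "set_integrable lborel ?X (glue g F1 F2)"
    using g(1) F unfolding I by (rule glue_integrable)
  have s2: "set_integrable lborel ?X ?G"
    using g(1) unfolding I by (intro glue_integrable continuous_on_lin_poly)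
  have i1: "glue g F1 F2 integrable_on ?X" by (rule set_borel_integral_eq_integral(1)[OF s1])
  have i2: "?G integrable_on ?X" by (rule set_borel_integral_eq_integral(1)[OF s2])
  have "integral ?X ?G = integral I (\<lambda>x. integral {3 * h..7 * h} (\<lambda>y. ?G (x, y)))"
    unfolding I by (rule fubini_rectangle[OF s2[unfolded I]], rule glue_slice) (use g(2) in \<open>auto simp: I\<close>)
  also have "\<dots> = integral I (\<lambda>x. (lin_prim l1 x (g x) - lin_prim l1 x (3 * h)) + (lin_prim l2 x (7 * h) - lin_prim l2 x (g x)))"
    by (rule integral_cong, rule glue_slice) (use g(2) in auto)
  finally have v: "integral ?X ?G = integral I (\<lambda>x. (lin_prim l1 x (g x) - lin_prim l1 x (3 * h)) + (lin_prim l2 x (7 * h) - lin_prim l2 x (g x)))" .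
  define a b where "a = ((real i - 1) * h, 3 * h)" and "b = (real i * h, 7 * h)"
  have X: "?X = cbox a b" by (simp add: I a_def b_def cbox_Pair_eq)
  have cont: "measure lborel (cbox a b) = 4 * h^2"
    using h by (simp add: a_def b_def content_Pair power2_eq_square algebra_simps)
  have e: "e \<ge> 0"
  proof -
    have "a \<in> ?X" using h by (auto simp: I a_def intro: mult_right_mono)
    then show ?thesis using close[of a] by linarith
  qed
  have "norm (integral ?X (\<lambda>p. glue g F1 F2 p - ?G p)) \<le> e * (4 * h^2)"
    unfolding cont[symmetric] using integrable_integral[OF integrable_diff[OF i1 i2]] close unfolding X
    by (intro has_integral_bound[OF e]) (auto simp: glue_def X[symmetric])
  then have "\<bar>integral ?X (glue g F1 F2) - integral ?X ?G\<bar> \<le> e * (4 * h^2)"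
    by (simp add: Henstock_Kurzweil_Integration.integral_diff[OF i1 i2])
  then have "1 / h^2 * \<bar>integral ?X (glue g F1 F2) - integral ?X ?G\<bar> \<le> 4 * e"
    using h by (simp add: field_simps)
  then show ?thesis using h unfolding v[symmetric]
    by (simp add: diff_divide_distrib[symmetric])
qed

text \<open>The weight of the leading coefficient makes this norm, times \<open>h\<close>, comparable to the supremum
  norm of \<open>quad h\<close> on a window.\<close>

definition scaled_norm :: "real \<Rightarrow> coeffs \<Rightarrow> real" where
  "scaled_norm h = (\<lambda>(a, b, c). h * \<bar>a\<bar> + \<bar>b\<bar> + \<bar>c\<bar>)"

lemma quad_bound:
  assumes "h > 0" "0 \<le> x" "x \<le> 4 * h"
  shows "\<bar>quad h e x\<bar> \<le> 16 * h * scaled_norm h e"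
proof -
  obtain a b c where e: "e = (a, b, c)" by (cases e)
  have "x^2 \<le> (4 * h)^2" using assms by (intro power_mono) auto
  then have "\<bar>a\<bar> * x^2 \<le> \<bar>a\<bar> * (16 * h^2)" by (intro mult_left_mono) (auto simp: power_mult_distrib)
  moreover have "\<bar>b\<bar> * x \<le> \<bar>b\<bar> * (4 * h)" using assms by (intro mult_left_mono) auto
  moreover have "\<bar>a * x^2 + b * x + c * h\<bar> \<le> \<bar>a\<bar> * x^2 + \<bar>b\<bar> * x + \<bar>c\<bar> * h"
  proof -
    have "\<bar>a * x^2\<bar> = \<bar>a\<bar> * x^2" "\<bar>b * x\<bar> = \<bar>b\<bar> * x" "\<bar>c * h\<bar> = \<bar>c\<bar> * h"
      using assms by (simp_all add: abs_mult)
    then show ?thesis by linarith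
  qed
  moreover have "\<bar>b\<bar> * h \<ge> 0" "\<bar>c\<bar> * h \<ge> 0" using assms by simp_all
  ultimately show ?thesis by (simp add: e quad_def scaled_norm_def power2_eq_square algebra_simps)
qed

lemma quad_add: "quad h (u + e) x = quad h u x + quad h e x"
  by (cases u; cases e) (simp add: quad_def algebra_simps)

lemma quad_diff: "quad h (u - e) x = quad h u x - quad h e x"
  by (cases u; cases e) (simp add: quad_def algebra_simps)

lemma quad_scale: "quad h (t *\<^sub>R e) x = t * quad h e x"
  by (cases e) (simp add: quad_def algebra_simps)

lemma scaled_norm_triangle: "h > 0 \<Longrightarrow> scaled_norm h (x + y) \<le> scaled_norm h x + scaled_norm h y"
proof -
  assume h: "h > 0"
  have "h * \<bar>fst x + fst y\<bar> \<le> h * (\<bar>fst x\<bar> + \<bar>fst y\<bar>)" using h by (intro mult_left_mono) auto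
  moreover obtain a b c a' b' c' where "x = (a, b, c)" "y = (a', b', c')" by (cases x; cases y)
  ultimately show ?thesis
    using abs_triangle_ineq[of b b'] abs_triangle_ineq[of c c'] by (simp add: scaled_norm_def algebra_simps)
qed

lemma norm_triple_le: "norm (a, b, c) \<le> \<bar>a\<bar> + \<bar>b\<bar> + \<bar>c::real\<bar>"
  using norm_Pair_le[of a "(b, c)"] norm_Pair_le[of b c] by simp

lemma norm_triple_ge: "\<bar>a\<bar> \<le> norm (a, b, c::real)" "\<bar>b\<bar> \<le> norm (a, b, c::real)" "\<bar>c\<bar> \<le> norm (a::real, b::real, c)"
  using norm_fst_le[of a "(b, c)"] norm_snd_le[of "(b, c)" a] norm_fst_le[of b c] norm_snd_le[of c b] by simp_all

lemma scaled_norm_bounds: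
  assumes "h > 0"
  shows "scaled_norm h x \<ge> 0" "norm x \<le> (1 / h + 1) * scaled_norm h x" "scaled_norm h x \<le> (h + 2) * norm x"
proof -
  obtain a b c where x: "x = (a, b, c)" by (cases x)
  show nn: "scaled_norm h x \<ge> 0" using assms by (simp add: x scaled_norm_def)
  have "h * norm x \<le> h * (\<bar>a\<bar> + \<bar>b\<bar> + \<bar>c\<bar>)" using norm_triple_le assms unfolding x by (intro mult_left_mono) auto
  also have "\<dots> \<le> (1 + h) * scaled_norm h x"
    using assms by (simp add: x scaled_norm_def algebra_simps)
  finally show "norm x \<le> (1 / h + 1) * scaled_norm h x" using assms by (simp add: field_simps)
  have "h * \<bar>a\<bar> \<le> h * norm x" using norm_triple_ge(1)[of a b c] assms unfolding x by (intro mult_left_mono) auto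
  then show "scaled_norm h x \<le> (h + 2) * norm x"
    using norm_triple_ge(2,3)[where a=a and b=b and c=c] by (simp add: x scaled_norm_def algebra_simps)
qed

lemma column_bound:
  assumes h: "h > 0" and w: "continuous_on {(real i - 1) * h..real i * h} w"
    and b: "\<And>x. x \<in> {(real i - 1) * h..real i * h} \<Longrightarrow> \<bar>w x\<bar> \<le> b * h"
  shows "\<bar>1 / h^2 * integral {(real i - 1) * h..real i * h} w\<bar> \<le> b"
proof -
  have "(real i - 1) * h \<le> real i * h" using h by (intro mult_right_mono) auto
  from integral_bound[OF this w, of "b * h"] b
  have "\<bar>integral {(real i - 1) * h..real i * h} w\<bar> \<le> b * h * (real i * h - (real i - 1) * h)" by simp
  also have "\<dots> = b * h^2" by (simp add: power2_eq_square algebra_simps)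
  finally show ?thesis using h by (simp add: abs_mult field_simps)
qed

text \<open>In the variables \<open>a * h\<close>, \<open>b\<close>, \<open>c\<close> the column
  averages do not involve \<open>h\<close>; the weights of \<open>scaled_norm\<close> match these
  variables.\<close>

lemma quad_moment:
  assumes h: "h > 0"
  shows "1 / h^2 * integral {(real i - 1) * h..real i * h} (quad h (a, b, c))
    = (a * h) * (3 * real i ^ 2 - 3 * real i + 1) / 3 + b * (2 * real i - 1) / 2 + c"
proof -
  have le: "(real i - 1) * h \<le> real i * h" using h by (intro mult_right_mono) auto
  have "(quad h (a, b, c) has_integral
    (a * (real i * h)^3 / 3 + b * (real i * h)^2 / 2 + c * h * (real i * h))
    - (a * ((real i - 1) * h)^3 / 3 + b * ((real i - 1) * h)^2 / 2 + c * h * ((real i - 1) * h))) {(real i - 1) * h..real i * h}"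
    by (rule fundamental_theorem_of_calculus[OF le], unfold has_real_derivative_iff_has_vector_derivative[symmetric])
       (auto simp: quad_def intro!: derivative_eq_intros)
  then have "integral {(real i - 1) * h..real i * h} (quad h (a, b, c)) =
    (a * (real i * h)^3 / 3 + b * (real i * h)^2 / 2 + c * h * (real i * h))
    - (a * ((real i - 1) * h)^3 / 3 + b * ((real i - 1) * h)^2 / 2 + c * h * ((real i - 1) * h))"
    by (rule integral_unique)
  also have "\<dots> = h^2 * ((a * h) * (3 * real i ^ 2 - 3 * real i + 1) / 3 + b * (2 * real i - 1) / 2 + c)"
    by (simp add: power2_eq_square power3_eq_cube algebra_simps add_divide_distrib diff_divide_distrib)
  finally show ?thesis using h by simp
qed

text \<open>The derivative of the residual averages the product of the jump \<open>l1 - l2\<close>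
  on the graph with the correction. Since the jump differs from the constant \<open>J\<close> by
  \<open>O(h)\<close>, the derivative is nearly \<open>J\<close> times the moment matrix of columns
  2, 3, 4, which gives the inverse bound \<open>80 / \<delta>\<close>.\<close>

lemma residual_newton:
  fixes a b c :: real
  assumes h: "h > 0" and L: "L\<^sub>1 h F = lin_poly l1" "L\<^sub>2 h F = lin_poly l2" "l1 - l2 = (a, b, c)"
    and b: "\<bar>b\<bar> \<le> B"
    and flat: "\<And>x y. 0 \<le> x \<Longrightarrow> x \<le> 4 * h \<Longrightarrow> \<bar>y\<bar> \<le> 50 * h \<Longrightarrow> \<bar>lin_poly (a, b, c) (x, y) - J\<bar> \<le> B * h"
    and J: "\<delta> > 0" "\<bar>J\<bar> \<ge> \<delta>"
    and E: "E \<ge> 0"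
    and start: "\<And>i. i \<in> {2, 3, 4} \<Longrightarrow> \<bar>column_integral h F i u0 - (\<Sum>j=4..7. cell_avg h F i j)\<bar> \<le> E * h^2"
    and u0: "\<And>x. x \<in> {h..4 * h} \<Longrightarrow> \<bar>quad h u0 x\<bar> \<le> 8 * h"
    and small: "1280 * B * h \<le> \<delta>" "480 * E * h^2 \<le> \<delta>"
      "(80 / \<delta>) * (384 * B * h) * (80 / \<delta>) * (3 * E * h^2) \<le> 1 / 2"
  shows "scaled_norm h (local_quad h F u0 - u0) \<le> 2 * (80 / \<delta>) * (3 * E * h^2)"
proof -
  define I where "I i = {(real i - 1) * h..real i * h}" for i :: nat
  have I: "0 \<le> x" "h \<le> x" "x \<le> 4 * h" if "i \<in> {2, 3, 4}" "x \<in> I i" for i x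
    using that h by (auto simp: I_def)
  have B: "B \<ge> 0" using b by linarith
  define av where "av i w = 1 / h^2 * integral (I i) w" for i and w :: "real \<Rightarrow> real"
  have av_scale: "av i (\<lambda>x. t * w x) = t * av i w" for i w t
    unfolding av_def by simp
  have av_add: "av i (\<lambda>x. w x + v x) = av i w + av i v"
    if "continuous_on (I i) w" "continuous_on (I i) v" for i w v
    using that unfolding av_def I_def
    by (simp add: Henstock_Kurzweil_Integration.integral_add integrable_continuous_interval distrib_left)
  have av_diff: "av i (\<lambda>x. w x - v x) = av i w - av i v"
    if "continuous_on (I i) w" "continuous_on (I i) v" for i w v
    using that unfolding av_def I_def
    by (simp add: Henstock_Kurzweil_Integration.integral_diff integrable_continuous_interval right_diff_distrib)
  have av_bound: "\<bar>av i w\<bar> \<le> m" if "continuous_on (I i) w" "\<And>x. x \<in> I i \<Longrightarrow> \<bar>w x\<bar> \<le> m * h" for i w m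
    using column_bound[OF h, of i w m] that unfolding av_def I_def by blast
  have cl: "continuous_on S (\<lambda>x. lin_poly (a, b, c) (x, quad h u x))" for S u
    unfolding lin_poly_def prod.case by (intro continuous_intros continuous_on_quad)
  define d where "d i u e = av i (\<lambda>x. lin_poly (a, b, c) (x, quad h u x) * quad h e x)" for i u e
  define D where "D u e = (d 2 u e, d 3 u e, d 4 u e)" for u e
  have ci: "column_integral h F i u = av i (\<lambda>x. lin_prim (a, b, c) x (quad h u x) - lin_prim (a, b, c) x (3 * h)
        + (lin_prim l2 x (7 * h) - lin_prim l2 x (3 * h)))" for i u
    unfolding av_def I_def column_integral_eq[OF h L(1,2)] L(3) ..
  have cc: "continuous_on S (\<lambda>x. lin_prim (a, b, c) x (quad h u x) - lin_prim (a, b, c) x (3 * h)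
        + (lin_prim l2 x (7 * h) - lin_prim l2 x (3 * h)))" for S u
    by (intro continuous_intros continuous_on_lin_prim continuous_on_quad)
  have d_add: "d i u (e + e') = d i u e + d i u e'" and d_scale: "d i u (t *\<^sub>R e) = t * d i u e" for i u e e' t
  proof -
    show "d i u (e + e') = d i u e + d i u e'"
      unfolding d_def quad_add distrib_left by (rule av_add) (intro continuous_on_mult cl continuous_on_quad)+
    show "d i u (t *\<^sub>R e) = t * d i u e"
      unfolding d_def quad_scale mult.left_commute[of _ t] by (rule av_scale)
  qed
  have lin: "linear (D u)" for u
    by (rule linearI) (simp_all add: D_def d_add d_scale)
  \<comment> \<open>The remainder is the column average of \<open>b * (quad h e x)^2 / 2\<close>;
    128 is \<open>16^2 / 2\<close> with the 16 of \<open>quad_bound\<close>, and three columns give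
    the 384 below.\<close>
  have step: "\<bar>column_integral h F i (u + e) - column_integral h F i u - d i u e\<bar> \<le> 128 * B * h * (scaled_norm h e)^2"
    if i: "i \<in> {2, 3, 4}" for i u e
  proof -
    have "column_integral h F i (u + e) - column_integral h F i u - d i u e
      = av i (\<lambda>x. b * (quad h e x)^2 / 2)"
    proof -
      let ?w = "\<lambda>u x. lin_prim (a, b, c) x (quad h u x) - lin_prim (a, b, c) x (3 * h)
        + (lin_prim l2 x (7 * h) - lin_prim l2 x (3 * h))"
      let ?v = "\<lambda>x. lin_poly (a, b, c) (x, quad h u x) * quad h e x"
      have "av i (?w (u + e)) - av i (?w u) = av i (\<lambda>x. ?w (u + e) x - ?w u x)"
        by (rule av_diff[OF cc cc, symmetric])
      then have "av i (?w (u + e)) - av i (?w u) - av i ?v = av i (\<lambda>x. ?w (u + e) x - ?w u x) - av i ?v" by (rule arg_cong)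
      also have "\<dots> = av i (\<lambda>x. (?w (u + e) x - ?w u x) - ?v x)"
        by (rule av_diff[OF continuous_on_diff[OF cc cc] continuous_on_mult[OF cl continuous_on_quad], symmetric])
      also have "(\<lambda>x. (?w (u + e) x - ?w u x) - ?v x) = (\<lambda>x. b * (quad h e x)^2 / 2)"
      proof
        fix x
        show "(?w (u + e) x - ?w u x) - ?v x = b * (quad h e x)^2 / 2"
          using lin_prim_step[of a b c x "quad h u x" "quad h e x"] by (simp add: quad_add)
      qed
      finally show ?thesis unfolding ci d_def .
    qed
    also have "\<bar>\<dots>\<bar> \<le> 128 * B * h * (scaled_norm h e)^2"
    proof (rule av_bound)
      show "continuous_on (I i) (\<lambda>x. b * (quad h e x)^2 / 2)" by (intro continuous_intros continuous_on_quad) auto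
      fix x assume "x \<in> I i"
      then have "\<bar>quad h e x\<bar> \<le> 16 * h * scaled_norm h e" using I[OF i] by (intro quad_bound[OF h]) auto
      then have "\<bar>quad h e x\<bar>^2 \<le> (16 * h * scaled_norm h e)^2" by (intro power_mono) auto
      then have "\<bar>b\<bar> * \<bar>quad h e x\<bar>^2 \<le> B * (16 * h * scaled_norm h e)^2"
        using b B by (intro mult_mono) auto
      then show "\<bar>b * (quad h e x)^2 / 2\<bar> \<le> 128 * B * h * (scaled_norm h e)^2 * h"
        by (simp add: abs_mult power2_eq_square algebra_simps)
    qed
    finally show ?thesis .
  qed
  have inj: "scaled_norm h e \<le> 80 / \<delta> * norm (D u e)"
    if u: "scaled_norm h (u - u0) \<le> 2 * (80 / \<delta>) * (3 * E * h^2)" for u e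
  proof -
    define N where "N = scaled_norm h e"
    have N: "N \<ge> 0" unfolding N_def by (rule scaled_norm_bounds[OF h])
    obtain e1 e2 e3 where e: "e = (e1, e2, e3)" by (cases e)
    define m where "m i = av i (quad h e)" for i
    have u1: "scaled_norm h (u - u0) \<le> 1"
    proof -
      have "2 * (80 / \<delta>) * (3 * E * h^2) \<le> 1" using small(2) J(1) by (simp add: field_simps)
      then show ?thesis using u by linarith
    qed
    have md: "\<bar>d i u e - J * m i\<bar> \<le> 16 * B * h * N" if i: "i \<in> {2, 3, 4}" for i
    proof -
      have cj: "continuous_on S (\<lambda>x. J * quad h e x)" for S by (intro continuous_intros continuous_on_quad)
      have "d i u e - J * m i = av i (\<lambda>x. lin_poly (a, b, c) (x, quad h u x) * quad h e x) - av i (\<lambda>x. J * quad h e x)"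
        unfolding d_def m_def av_scale ..
      also have "\<dots> = av i (\<lambda>x. lin_poly (a, b, c) (x, quad h u x) * quad h e x - J * quad h e x)"
        by (rule av_diff[symmetric, OF continuous_on_mult[OF cl continuous_on_quad] cj])
      also have "\<bar>\<dots>\<bar> \<le> 16 * B * h * N"
      proof (rule av_bound)
        show "continuous_on (I i) (\<lambda>x. lin_poly (a, b, c) (x, quad h u x) * quad h e x - J * quad h e x)"
          by (intro continuous_on_diff continuous_on_mult[OF cl continuous_on_quad] cj)
        fix x assume "x \<in> I i"
        note x = I[OF i this]
        \<comment> \<open>The values of \<open>quad h u\<close> stay within
          \<open>8 * h + 16 * h\<close> of 0, well inside the strip where \<open>flat\<close>
          controls the jump.\<close>
        have "\<bar>quad h (u - u0) x\<bar> \<le> 16 * h * scaled_norm h (u - u0)" by (rule quad_bound[OF h x(1,3)])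
        also have "\<dots> \<le> 16 * h" using u1 h by simp
        finally have "\<bar>quad h u x - quad h u0 x\<bar> \<le> 16 * h" by (simp add: quad_diff)
        then have "\<bar>quad h u x\<bar> \<le> 50 * h" using u0[of x] x h by simp
        then have l: "\<bar>lin_poly (a, b, c) (x, quad h u x) - J\<bar> \<le> B * h" by (rule flat[OF x(1,3)])
        have q: "\<bar>quad h e x\<bar> \<le> 16 * h * N" unfolding N_def by (rule quad_bound[OF h x(1,3)])
        have "\<bar>lin_poly (a, b, c) (x, quad h u x) - J\<bar> * \<bar>quad h e x\<bar> \<le> (B * h) * (16 * h * N)"
          using l q B h by (intro mult_mono) auto
        then show "\<bar>lin_poly (a, b, c) (x, quad h u x) * quad h e x - J * quad h e x\<bar> \<le> 16 * B * h * N * h"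
          by (simp add: abs_mult[symmetric] algebra_simps)
      qed
      finally show ?thesis .
    qed
    define T where "T = norm (D u e)"
    have dT: "\<bar>d 2 u e\<bar> \<le> T" "\<bar>d 3 u e\<bar> \<le> T" "\<bar>d 4 u e\<bar> \<le> T"
      unfolding T_def D_def by (rule norm_triple_ge)+
    define X where "X = (T + 16 * B * h * N) / \<delta>"
    have mX: "\<bar>m i\<bar> \<le> X" if i: "i \<in> {2, 3, 4}" for i
    proof -
      have "\<delta> * \<bar>m i\<bar> \<le> \<bar>J\<bar> * \<bar>m i\<bar>" using J by (intro mult_right_mono) auto
      also have "\<dots> \<le> T + 16 * B * h * N" using md[OF i] dT i unfolding abs_mult[symmetric] by auto
      finally show ?thesis using J(1) by (simp add: X_def field_simps)
    qed
    have mm: "m 2 = e1 * h * 7 / 3 + e2 * 3 / 2 + e3" "m 3 = e1 * h * 19 / 3 + e2 * 5 / 2 + e3"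
      "m 4 = e1 * h * 37 / 3 + e2 * 7 / 2 + e3"
      unfolding m_def av_def I_def e quad_moment[OF h] by simp_all
    \<comment> \<open>The second difference of the moments is \<open>2 * p\<close>, the first
      difference \<open>m 3 - m 2\<close> is \<open>4 * p + e2\<close>, and \<open>m 2\<close> then
      gives \<open>e3\<close>; the three bounds add up to \<open>40 * X\<close>.\<close>
    have "\<bar>m 2\<bar> \<le> X" "\<bar>m 3\<bar> \<le> X" "\<bar>m 4\<bar> \<le> X" using mX by auto
    moreover define p where "p = e1 * h"
    ultimately have "\<bar>p\<bar> \<le> 2 * X" "\<bar>e2\<bar> \<le> 10 * X" "\<bar>e3\<bar> \<le> 28 * X" unfolding mm p_def[symmetric] by linarith+
    moreover have "h * \<bar>e1\<bar> = \<bar>p\<bar>" using h by (simp add: p_def abs_mult)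
    ultimately have "N \<le> 40 * X" by (simp add: N_def e scaled_norm_def)
    then have "\<delta> * N \<le> 40 * T + (640 * B * h) * N" using J(1) by (simp add: X_def field_simps)
    \<comment> \<open>The perturbation term is absorbed on the left, which doubles 40 to 80.\<close>
    moreover have "(640 * B * h) * N \<le> \<delta> / 2 * N" using small(1) N by (intro mult_right_mono) auto
    ultimately have "\<delta> * N \<le> 80 * T" by linarith
    then show ?thesis using J(1) by (simp add: N_def[symmetric] T_def[symmetric] field_simps)
  qed
  show ?thesis unfolding local_quad_def
  proof (rule newton_limit_quadratic[where D = D and \<kappa> = "384 * B * h" and c = "1 / h + 1" and c' = "h + 2"])
    fix u e
    have "norm (residual h F (u + e) - residual h F u - D u e)
      \<le> \<bar>column_integral h F 2 (u + e) - column_integral h F 2 u - d 2 u e\<bar>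
       + \<bar>column_integral h F 3 (u + e) - column_integral h F 3 u - d 3 u e\<bar>
       + \<bar>column_integral h F 4 (u + e) - column_integral h F 4 u - d 4 u e\<bar>"
      using norm_triple_le by (simp add: residual_def D_def Let_def)
    also have "\<dots> \<le> 384 * B * h * (scaled_norm h e)^2"
      using step[of 2 u e] step[of 3 u e] step[of 4 u e] by simp
    finally show "norm (residual h F (u + e) - residual h F u - D u e) \<le> 384 * B * h * (scaled_norm h e)^2" .
  next
    have "norm (residual h F u0) \<le> \<bar>column_integral h F 2 u0 - (\<Sum>j=4..7. cell_avg h F 2 j)\<bar>
      + \<bar>column_integral h F 3 u0 - (\<Sum>j=4..7. cell_avg h F 3 j)\<bar> + \<bar>column_integral h F 4 u0 - (\<Sum>j=4..7. cell_avg h F 4 j)\<bar>"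
      unfolding residual_def Let_def by (rule norm_triple_le)
    also have "\<dots> \<le> 3 * E * h^2" using start[of 2] start[of 3] start[of 4] by simp
    finally show "norm (residual h F u0) \<le> 3 * E * h^2" .
  next
    show "80 / \<delta> * (384 * B * h) * (80 / \<delta>) * (3 * E * h\<^sup>2) \<le> 1 / 2" by (rule small(3))
  qed (use h B E J scaled_norm_bounds[OF h] scaled_norm_triangle[OF h] lin inj in \<open>auto simp del: distrib_right_numeral\<close>)
qed

text \<open>What a window supplies after the change of coordinates: two branches, affine
  approximations to them, a section and a start. The values of \<open>F\<close> on the graph are
  left open. The jump is bounded below at the single point \<open>p0\<close>; the bounds on the
  slopes carry it over the window.\<close>

definition window_data :: "real \<Rightarrow> real \<Rightarrow> real \<Rightarrow> real \<Rightarrow> (plane \<Rightarrow> real) \<Rightarrow> (plane \<Rightarrow> real) \<Rightarrow> (plane \<Rightarrow> real) \<Rightarrow>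
    (real \<Rightarrow> real) \<Rightarrow> coeffs \<Rightarrow> coeffs \<Rightarrow> coeffs \<Rightarrow> plane \<Rightarrow> bool" where
  "window_data M \<delta> K h F F1 F2 g u0 l1 l2 p0 \<longleftrightarrow>
     (let W = {h..4 * h} \<times> {h..9 * h} in
      continuous_on W F1 \<and> continuous_on W F2 \<and> continuous_on {h..4 * h} g \<and>
      (\<forall>x\<in>{h..4 * h}. 3 * h \<le> g x \<and> g x \<le> 7 * h \<and> \<bar>quad h u0 x - g x\<bar> \<le> K * h^3) \<and>
      (\<forall>p\<in>W. (snd p < g (fst p) \<longrightarrow> F p = F1 p) \<and> (g (fst p) < snd p \<longrightarrow> F p = F2 p)) \<and>
      (\<forall>p\<in>W. \<bar>F1 p - lin_poly l1 p\<bar> \<le> M * h^2 \<and> \<bar>F2 p - lin_poly l2 p\<bar> \<le> M * h^2) \<and>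
      \<bar>fst l1\<bar> \<le> M \<and> \<bar>fst (snd l1)\<bar> \<le> M \<and> \<bar>fst l2\<bar> \<le> M \<and> \<bar>fst (snd l2)\<bar> \<le> M \<and>
      p0 \<in> W \<and> \<delta> \<le> \<bar>lin_poly l1 p0 - lin_poly l2 p0\<bar> \<and> \<bar>lin_poly l1 p0 - lin_poly l2 p0\<bar> \<le> 2 * M)"

lemma lin_poly_lipschitz:
  assumes "\<bar>a\<bar> \<le> M" "\<bar>b\<bar> \<le> M"
  shows "\<bar>lin_poly (a, b, c) (x, y) - lin_poly (a, b, c) (x', y')\<bar> \<le> M * (\<bar>x - x'\<bar> + \<bar>y - y'\<bar>)"
proof -
  have "\<bar>a * (x - x')\<bar> \<le> M * \<bar>x - x'\<bar>" "\<bar>b * (y - y')\<bar> \<le> M * \<bar>y - y'\<bar>"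
    unfolding abs_mult by (intro mult_right_mono assms abs_ge_zero)+
  moreover have "lin_poly (a, b, c) (x, y) - lin_poly (a, b, c) (x', y') = a * (x - x') + b * (y - y')"
    by (simp add: lin_poly_def algebra_simps)
  ultimately show ?thesis by (simp only: distrib_left)
qed

text \<open>The fits inherit from \<open>l1\<close> and \<open>l2\<close> errors of
  \<open>O(h^2)\<close> in values and \<open>O(h)\<close> in slopes, so their jump is constant up to
  \<open>O(h)\<close>; the residual at the start is \<open>O(h^2)\<close>, from the fit error and
  the starting error \<open>K * h^3\<close>.\<close>

lemma window_newton:
  assumes M: "M \<ge> 1" and \<delta>: "\<delta> > 0" and K: "K \<ge> 0"
  shows "\<exists>C h0. C \<ge> 0 \<and> h0 > 0 \<and> (\<forall>h F F1 F2 g u0 l1 l2 p0. 0 < h \<and> h < h0 \<and>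
    window_data M \<delta> K h F F1 F2 g u0 l1 l2 p0 \<longrightarrow> scaled_norm h (local_quad h F u0 - u0) \<le> C * h^2)"
proof -
  \<comment> \<open>\<open>B * h\<close> bounds the deviation of the fitted jump from
    \<open>J\<close>: twice \<open>129 * M * h^2\<close> from the fits and twice
    \<open>63 * M * h\<close> from the slopes, rounded up. In \<open>E\<close>, 56 is 4 times the
    fit error 14, and \<open>402 * M = B + 2 * M\<close> bounds the jump that multiplies the
    starting error.\<close>
  define B where "B = 400 * M"
  define E where "E = 56 * M + 402 * M * K"
  \<comment> \<open>A common majorant: with \<open>h0 = min \<delta> 1 / X\<close> every
    \<open>t \<le> X\<close> satisfies \<open>h * t < \<delta>\<close> and \<open>h * t < 1\<close>,
    which yields all smallness conditions.\<close>
  define X where "X = 1280 * B + 480 * E + (80 / \<delta>) * (384 * B) * (80 / \<delta>) * (6 * E) + K + 1"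
  have B: "B > 0" using M by (simp add: B_def)
  have E: "E \<ge> 0" using M K by (simp add: E_def)
  have X: "1280 * B \<le> X" "480 * E \<le> X" "(80 / \<delta>) * (384 * B) * (80 / \<delta>) * (6 * E) \<le> X" "K \<le> X" "1 \<le> X"
    using B E K \<delta> by (simp_all add: X_def)
  define h0 where "h0 = min \<delta> 1 / X"
  have h0: "h0 > 0" using X(5) \<delta> by (simp add: h0_def)
  have main: "scaled_norm h (local_quad h F u0 - u0) \<le> (480 * E / \<delta>) * h^2"
    if h: "0 < h" "h < h0" and data: "window_data M \<delta> K h F F1 F2 g u0 l1 l2 p0"
    for h F F1 F2 g u0 l1 l2 p0
  proof -
    let ?W = "{h..4 * h} \<times> {h..9 * h}"
    note d = data[unfolded window_data_def Let_def]
    from d have F1: "continuous_on ?W F1" and F2: "continuous_on ?W F2" and g: "continuous_on {h..4 * h} g" by simp_all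
    from d have gx: "\<And>x. x \<in> {h..4 * h} \<Longrightarrow> 3 * h \<le> g x \<and> g x \<le> 7 * h \<and> \<bar>quad h u0 x - g x\<bar> \<le> K * h^3" by simp
    note FF = d[THEN conjunct2, THEN conjunct2, THEN conjunct2, THEN conjunct2, THEN conjunct1, THEN bspec]
    note Fl = d[THEN conjunct2, THEN conjunct2, THEN conjunct2, THEN conjunct2, THEN conjunct2, THEN conjunct1, THEN bspec]
    obtain a1 b1 c1 where l1: "l1 = (a1, b1, c1)" by (cases l1)
    obtain a2 b2 c2 where l2: "l2 = (a2, b2, c2)" by (cases l2)
    obtain x0 y0 where p0: "p0 = (x0, y0)" by (cases p0)
    from d have ab: "\<bar>a1\<bar> \<le> M" "\<bar>b1\<bar> \<le> M" "\<bar>a2\<bar> \<le> M" "\<bar>b2\<bar> \<le> M" unfolding l1 l2 by simp_all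
    define J where "J = lin_poly l1 p0 - lin_poly l2 p0"
    from d have J: "\<delta> \<le> \<bar>J\<bar>" "\<bar>J\<bar> \<le> 2 * M" and p0W: "h \<le> x0" "x0 \<le> 4 * h" "h \<le> y0" "y0 \<le> 9 * h"
      unfolding J_def p0 by simp_all
    have hX: "h * X < \<delta>" "h * X < 1" using h(2) X(5) by (simp_all add: h0_def field_simps)
    have hs: "h * t < \<delta>" "h * t < 1" if "t \<le> X" for t
      using mult_left_mono[OF that, of h] h(1) hX by linarith+
    have h1: "h < 1" using hs(2)[OF X(5)] by simp
    have h2: "h^2 \<le> h" using h h1 by (simp add: power2_eq_square mult_left_le_one_le)
    define e where "e = M * h^2"
    have e: "e \<ge> 0" using M by (simp add: e_def)
    have eh: "2 * e / h = 2 * M * h" using h by (simp add: e_def power2_eq_square)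
    have eMh: "e \<le> M * h" unfolding e_def using h2 M by (intro mult_left_mono) auto
    define N where "N = (\<lambda>x. (x, g x)) ` {h..4 * h}"
    have N: "negligible N" unfolding N_def by (rule negligible_graph[OF g])
    have cell: "\<bar>cell_avg h F i j - lin_poly l1 ((real i - 1/2) * h, (real j - 1/2) * h)\<bar> \<le> e"
      if ij: "i \<in> {3, 4}" "j \<in> {2, 3}" for i j
    proof (rule cell_avg_close[OF h(1) refl _ N])
      let ?C = "{(real i - 1) * h..real i * h} \<times> {(real j - 1) * h..real j * h}"
      have C: "?C \<subseteq> {h..4 * h} \<times> {h..3 * h}" using ij h by auto
      have CW: "?C \<subseteq> ?W" by (rule order_trans[OF C]) (use h in auto)
      show "continuous_on ?C F1" by (rule continuous_on_subset[OF F1 CW])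
      show "\<bar>F1 p - lin_poly l1 p\<bar> \<le> e" if "p \<in> ?C" for p
        unfolding e_def using Fl[OF subsetD[OF CW that]] by simp
      show "F p = F1 p" if p: "p \<in> ?C - N" for p
      proof -
        have "p \<in> {h..4 * h} \<times> {h..3 * h}" using p C by blast
        then obtain x y where xy: "p = (x, y)" "x \<in> {h..4 * h}" "y \<le> 3 * h" by auto
        have "y \<noteq> g x" using p xy by (auto simp: N_def)
        then have "y < g x" using gx[OF xy(2)] xy(3) by linarith
        moreover have "p \<in> ?W" using p CW by blast
        ultimately show ?thesis using FF[of p] by (simp add: xy(1))
      qed
    qed
    have cell': "\<bar>cell_avg h F i j - lin_poly l2 ((real i - 1/2) * h, (real j - 1/2) * h)\<bar> \<le> e"
      if ij: "i \<in> {3, 4}" "j \<in> {8, 9}" for i j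
    proof (rule cell_avg_close[OF h(1) refl _ N])
      let ?C = "{(real i - 1) * h..real i * h} \<times> {(real j - 1) * h..real j * h}"
      have C: "?C \<subseteq> {h..4 * h} \<times> {7 * h..9 * h}" using ij h by auto
      have CW: "?C \<subseteq> ?W" by (rule order_trans[OF C]) (use h in auto)
      show "continuous_on ?C F2" by (rule continuous_on_subset[OF F2 CW])
      show "\<bar>F2 p - lin_poly l2 p\<bar> \<le> e" if "p \<in> ?C" for p
        unfolding e_def using Fl[OF subsetD[OF CW that]] by simp
      show "F p = F2 p" if p: "p \<in> ?C - N" for p
      proof -
        have "p \<in> {h..4 * h} \<times> {7 * h..9 * h}" using p C by blast
        then obtain x y where xy: "p = (x, y)" "x \<in> {h..4 * h}" "y \<ge> 7 * h" by auto
        have "y \<noteq> g x" using p xy by (auto simp: N_def)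
        then have "g x < y" using gx[OF xy(2)] xy(3) by linarith
        moreover have "p \<in> ?W" using p CW by blast
        ultimately show ?thesis using FF[of p] by (simp add: xy(1))
      qed
    qed
    have ctr: "(real 3 - 1/2) * h = 5/2 * h" "(real 8 - 1/2) * h = 15/2 * h" by simp_all
    have four: "Suc 3 = 4" by simp
    have fit1: "\<exists>a' b' c'. linear_fit h F {(3, 2), (3, 3), (Suc 3, 3)} = lin_poly (a', b', c') \<and>
      \<bar>a' - a1\<bar> \<le> 2 * e / h \<and> \<bar>b' - b1\<bar> \<le> 2 * e / h \<and>
      (\<forall>x y. \<bar>lin_poly (a', b', c') (x, y) - lin_poly (a1, b1, c1) (x, y)\<bar>
         \<le> e + 2 * e / h * (\<bar>x - (real 3 - 1/2) * h\<bar> + \<bar>y - (real 3 - 1/2) * h\<bar>))"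
    proof (rule linear_fit_close[OF h(1)])
      show "\<bar>cell_avg h F k l - lin_poly (a1, b1, c1) ((real k - 1/2) * h, (real l - 1/2) * h)\<bar> \<le> e"
        if "(k, l) \<in> {(3, 2), (3, 3), (Suc 3, 3)}" for k l
        using cell[of k l] that unfolding l1 by auto
    qed simp
    obtain \<alpha>1 \<beta>1 \<zeta>1 where m1: "L\<^sub>1 h F = lin_poly (\<alpha>1, \<beta>1, \<zeta>1)" "\<bar>\<alpha>1 - a1\<bar> \<le> 2 * e / h" "\<bar>\<beta>1 - b1\<bar> \<le> 2 * e / h"
      "\<forall>x y. \<bar>lin_poly (\<alpha>1, \<beta>1, \<zeta>1) (x, y) - lin_poly l1 (x, y)\<bar>
         \<le> e + 2 * e / h * (\<bar>x - (real 3 - 1/2) * h\<bar> + \<bar>y - (real 3 - 1/2) * h\<bar>)"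
      using fit1[unfolded four, folded L\<^sub>1_def l1] by (elim exE conjE)
    have fit2: "\<exists>a' b' c'. linear_fit h F {(3, 9), (3, 8), (Suc 3, 8)} = lin_poly (a', b', c') \<and>
      \<bar>a' - a2\<bar> \<le> 2 * e / h \<and> \<bar>b' - b2\<bar> \<le> 2 * e / h \<and>
      (\<forall>x y. \<bar>lin_poly (a', b', c') (x, y) - lin_poly (a2, b2, c2) (x, y)\<bar>
         \<le> e + 2 * e / h * (\<bar>x - (real 3 - 1/2) * h\<bar> + \<bar>y - (real 8 - 1/2) * h\<bar>))"
    proof (rule linear_fit_close[OF h(1)])
      show "\<bar>cell_avg h F k l - lin_poly (a2, b2, c2) ((real k - 1/2) * h, (real l - 1/2) * h)\<bar> \<le> e"
        if "(k, l) \<in> {(3, 9), (3, 8), (Suc 3, 8)}" for k l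
        using cell'[of k l] that unfolding l2 by auto
    qed simp
    obtain \<alpha>2 \<beta>2 \<zeta>2 where m2: "L\<^sub>2 h F = lin_poly (\<alpha>2, \<beta>2, \<zeta>2)" "\<bar>\<alpha>2 - a2\<bar> \<le> 2 * e / h" "\<bar>\<beta>2 - b2\<bar> \<le> 2 * e / h"
      "\<forall>x y. \<bar>lin_poly (\<alpha>2, \<beta>2, \<zeta>2) (x, y) - lin_poly l2 (x, y)\<bar>
         \<le> e + 2 * e / h * (\<bar>x - (real 3 - 1/2) * h\<bar> + \<bar>y - (real 8 - 1/2) * h\<bar>)"
      using fit2[unfolded four, folded L\<^sub>2_def l2] by (elim exE conjE)
    define m where "m = (\<alpha>1, \<beta>1, \<zeta>1)"
    define m' where "m' = (\<alpha>2, \<beta>2, \<zeta>2)"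
    have mm: "m - m' = (\<alpha>1 - \<alpha>2, \<beta>1 - \<beta>2, \<zeta>1 - \<zeta>2)" by (simp add: m_def m'_def)
    have flat: "\<bar>lin_poly (m - m') (x, y) - J\<bar> \<le> B * h" if x: "0 \<le> x" "x \<le> 4 * h" and y: "\<bar>y\<bar> \<le> 50 * h" for x y
    proof -
      have "\<bar>x - (real 3 - 1/2) * h\<bar> + \<bar>y - (real 3 - 1/2) * h\<bar> \<le> 64 * h"
        "\<bar>x - (real 3 - 1/2) * h\<bar> + \<bar>y - (real 8 - 1/2) * h\<bar> \<le> 64 * h"
        unfolding ctr using x y h by linarith+
      then have s: "2 * e / h * (\<bar>x - (real 3 - 1/2) * h\<bar> + \<bar>y - (real 3 - 1/2) * h\<bar>) \<le> 2 * e / h * (64 * h)"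
        "2 * e / h * (\<bar>x - (real 3 - 1/2) * h\<bar> + \<bar>y - (real 8 - 1/2) * h\<bar>) \<le> 2 * e / h * (64 * h)"
        using e h by (intro mult_left_mono; simp)+
      have "2 * e / h * (64 * h) = 128 * e" using h by simp
      then have 1: "\<bar>lin_poly m (x, y) - lin_poly l1 (x, y)\<bar> \<le> 129 * e" "\<bar>lin_poly m' (x, y) - lin_poly l2 (x, y)\<bar> \<le> 129 * e"
        using m1(4)[rule_format, of x y] m2(4)[rule_format, of x y] s unfolding m_def m'_def by linarith+
      have "\<bar>x - x0\<bar> + \<bar>y - y0\<bar> \<le> 63 * h" using x y p0W by linarith
      then have "M * (\<bar>x - x0\<bar> + \<bar>y - y0\<bar>) \<le> M * (63 * h)" using M by (intro mult_left_mono) auto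
      then have 2: "\<bar>lin_poly l1 (x, y) - lin_poly l1 p0\<bar> \<le> 63 * (M * h)" "\<bar>lin_poly l2 (x, y) - lin_poly l2 p0\<bar> \<le> 63 * (M * h)"
        using lin_poly_lipschitz[OF ab(1,2), of c1 x y x0 y0] lin_poly_lipschitz[OF ab(3,4), of c2 x y x0 y0]
        unfolding l1 l2 p0 by linarith+
      have "M * h \<ge> 0" using M h by simp
      then show ?thesis unfolding lin_poly_diff J_def B_def mult.assoc using 1 2 eMh by linarith
    qed
    have \<beta>: "\<bar>\<beta>1 - \<beta>2\<bar> \<le> B"
    proof -
      have "M * h \<le> M * 1" using h1 M by (intro mult_left_mono) auto
      then show ?thesis using m1(3) m2(3) ab(2,4) M unfolding eh B_def by linarith
    qed
    have Kh: "K * h^3 \<le> h"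
    proof -
      have "K * h^3 = (h * K) * h^2" by (simp add: power2_eq_square power3_eq_cube)
      also have "\<dots> \<le> 1 * h^2" using hs(2)[OF X(4)] by (intro mult_right_mono) auto
      finally show ?thesis using h2 by linarith
    qed
    have q: "\<bar>quad h u0 x\<bar> \<le> 8 * h" if "x \<in> {h..4 * h}" for x
      using gx[OF that] Kh h by linarith
    \<comment> \<open>Both sides are compared with the integral of \<open>?V\<close>, the fits glued
      along the true section \<open>g\<close>: the cell sums differ from it by the fit error, the
      column integral of the start by the gap between two graphs times the jump.\<close>
    have start: "\<bar>column_integral h F i u0 - (\<Sum>j=4..7. cell_avg h F i j)\<bar> \<le> E * h^2" if i: "i \<in> {2, 3, 4}" for i
    proof -
      define I where "I = {(real i - 1) * h..real i * h}"
      have I: "I \<subseteq> {h..4 * h}" using i h by (auto simp: I_def)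
      have IW: "I \<times> {3 * h..7 * h} \<subseteq> ?W" using I h by auto
      have gI: "continuous_on I g" by (rule continuous_on_subset[OF g I])
      have FI: "continuous_on (I \<times> {3 * h..7 * h}) F1" "continuous_on (I \<times> {3 * h..7 * h}) F2"
        by (rule continuous_on_subset[OF F1 IW] continuous_on_subset[OF F2 IW])+
      have int: "glue g F1 F2 integrable_on I \<times> {3 * h..7 * h}"
        using set_borel_integral_eq_integral(1)[OF glue_integrable[of "(real i - 1) * h" "real i * h" g "3 * h" "7 * h" F1 F2]] gI FI
        unfolding I_def by blast
      have sum: "(\<Sum>j=4..7. cell_avg h F i j) = 1 / h^2 * integral (I \<times> {3 * h..7 * h}) (glue g F1 F2)"
        unfolding I_def
      proof (rule column_sum[OF h(1) int[unfolded I_def] N])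
        fix p assume p: "p \<in> {(real i - 1) * h..real i * h} \<times> {3 * h..7 * h} - N"
        then have "p \<in> ?W" using IW unfolding I_def by blast
        moreover have "snd p \<noteq> g (fst p)" using p I unfolding I_def N_def by (auto simp: image_iff)
        ultimately show "F p = glue g F1 F2 p" using FF[of p] by (auto simp: glue_def)
      qed
      have close: "\<bar>F1 p - lin_poly m p\<bar> \<le> 14 * e \<and> \<bar>F2 p - lin_poly m' p\<bar> \<le> 14 * e"
        if p: "p \<in> I \<times> {3 * h..7 * h}" for p
      proof -
        obtain x y where xy: "p = (x, y)" by (cases p)
        have x: "h \<le> x" "x \<le> 4 * h" and y: "3 * h \<le> y" "y \<le> 7 * h" using p I by (auto simp: xy)
        have "\<bar>x - (real 3 - 1/2) * h\<bar> + \<bar>y - (real 3 - 1/2) * h\<bar> \<le> 6 * h"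
          "\<bar>x - (real 3 - 1/2) * h\<bar> + \<bar>y - (real 8 - 1/2) * h\<bar> \<le> 6 * h"
          unfolding ctr using x y h by linarith+
        then have s: "2 * e / h * (\<bar>x - (real 3 - 1/2) * h\<bar> + \<bar>y - (real 3 - 1/2) * h\<bar>) \<le> 2 * e / h * (6 * h)"
          "2 * e / h * (\<bar>x - (real 3 - 1/2) * h\<bar> + \<bar>y - (real 8 - 1/2) * h\<bar>) \<le> 2 * e / h * (6 * h)"
          using e h by (intro mult_left_mono; simp)+
        have "2 * e / h * (6 * h) = 12 * e" using h by simp
        then have "\<bar>lin_poly m p - lin_poly l1 p\<bar> \<le> 13 * e" "\<bar>lin_poly m' p - lin_poly l2 p\<bar> \<le> 13 * e"
          using m1(4)[rule_format, of x y] m2(4)[rule_format, of x y] s unfolding m_def m'_def xy by linarith+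
        moreover have "\<bar>F1 p - lin_poly l1 p\<bar> \<le> e \<and> \<bar>F2 p - lin_poly l2 p\<bar> \<le> e"
          unfolding e_def by (rule Fl[OF subsetD[OF IW p]])
        ultimately show ?thesis by linarith
      qed
      let ?V = "\<lambda>x. (lin_prim m x (g x) - lin_prim m x (3 * h)) + (lin_prim m' x (7 * h) - lin_prim m' x (g x))"
      let ?U = "\<lambda>x. lin_prim (m - m') x (quad h u0 x) - lin_prim (m - m') x (3 * h)
        + (lin_prim m' x (7 * h) - lin_prim m' x (3 * h))"
      have 1: "\<bar>(\<Sum>j=4..7. cell_avg h F i j) - 1 / h^2 * integral I ?V\<bar> \<le> 4 * (14 * e)"
        unfolding sum by (rule column_value[OF h(1) I_def gI _ FI close]) (use gx I in blast)+
      have cV: "continuous_on I ?V" by (intro continuous_intros continuous_on_lin_prim gI)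
      have cU: "continuous_on I ?U" by (intro continuous_intros continuous_on_lin_prim continuous_on_quad)
      have "column_integral h F i u0 - 1 / h^2 * integral I ?V = 1 / h^2 * integral I (\<lambda>x. ?U x - ?V x)"
        unfolding column_integral_eq[OF h(1) m1(1)[folded m_def] m2(1)[folded m'_def]] I_def[symmetric]
        using Henstock_Kurzweil_Integration.integral_diff[OF integrable_continuous_interval[OF cU[unfolded I_def]] integrable_continuous_interval[OF cV[unfolded I_def]], folded I_def]
        by (simp only: right_diff_distrib)
      also have "\<bar>\<dots>\<bar> \<le> 402 * M * K * h^2"
        unfolding I_def
      proof (rule column_bound[OF h(1)])
        show "continuous_on {(real i - 1) * h..real i * h} (\<lambda>x. ?U x - ?V x)"
          by (rule continuous_on_diff[OF cU cV, unfolded I_def])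
        fix x assume "x \<in> {(real i - 1) * h..real i * h}"
        then have x: "x \<in> {h..4 * h}" using I unfolding I_def by blast
        have eq: "?U x - ?V x = lin_prim (m - m') x (quad h u0 x) - lin_prim (m - m') x (g x)"
          by (simp add: lin_prim_diff)
        have mid: "\<bar>(quad h u0 x + g x) / 2\<bar> \<le> 50 * h" using q[OF x] gx[OF x] h by (simp add: abs_le_iff)
        have "\<bar>lin_poly (m - m') (x, (quad h u0 x + g x) / 2) - J\<bar> \<le> B * h"
          using x h by (intro flat mid) auto
        moreover have "B * h \<le> B * 1" using h1 B by (intro mult_left_mono) auto
        ultimately have lb: "\<bar>lin_poly (m - m') (x, (quad h u0 x + g x) / 2)\<bar> \<le> 402 * M"
          using J(2) unfolding B_def by linarith
        have "\<bar>?U x - ?V x\<bar> = \<bar>quad h u0 x - g x\<bar> * \<bar>lin_poly (m - m') (x, (quad h u0 x + g x) / 2)\<bar>"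
          by (subst eq) (simp only: lin_prim_midpoint abs_mult)
        also have "\<dots> \<le> (K * h^3) * (402 * M)" using gx[OF x] lb by (intro mult_mono) auto
        finally show "\<bar>?U x - ?V x\<bar> \<le> 402 * M * K * h^2 * h"
          by (simp add: power2_eq_square power3_eq_cube algebra_simps)
      qed
      finally have 2: "\<bar>column_integral h F i u0 - 1 / h^2 * integral I ?V\<bar> \<le> 402 * M * K * h^2" .
      have "E * h^2 = 4 * (14 * e) + 402 * M * K * h^2" by (simp add: E_def e_def algebra_simps)
      then show ?thesis using 1 2 by linarith
    qed
    have "scaled_norm h (local_quad h F u0 - u0) \<le> 2 * (80 / \<delta>) * (3 * E * h^2)"
    proof (rule residual_newton[OF h(1) m1(1)[folded m_def] m2(1)[folded m'_def] mm \<beta>])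
      show "\<bar>lin_poly (\<alpha>1 - \<alpha>2, \<beta>1 - \<beta>2, \<zeta>1 - \<zeta>2) (x, y) - J\<bar> \<le> B * h"
        if "0 \<le> x" "x \<le> 4 * h" "\<bar>y\<bar> \<le> 50 * h" for x y
        using flat[OF that] unfolding mm .
      show "1280 * B * h \<le> \<delta>" using hs(1)[OF X(1)] by (simp add: mult.commute)
      have "480 * E * h^2 \<le> 480 * E * h" using h2 E by (intro mult_left_mono) auto
      also have "\<dots> = h * (480 * E)" by (rule mult.commute)
      finally show "480 * E * h^2 \<le> \<delta>" using hs(1)[OF X(2)] by linarith
      have c: "0 \<le> (80 / \<delta>) * (384 * B) * (80 / \<delta>) * (6 * E)" using B E \<delta> by simp
      have "(80 / \<delta>) * (384 * B * h) * (80 / \<delta>) * (3 * E * h^2)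
         = ((80 / \<delta>) * (384 * B) * (80 / \<delta>) * (6 * E)) / 2 * (h * h^2)" by simp
      also have "\<dots> \<le> ((80 / \<delta>) * (384 * B) * (80 / \<delta>) * (6 * E)) / 2 * (h * 1)"
        using c h h2 h1 by (intro mult_left_mono) auto
      also have "\<dots> \<le> 1 / 2" using hs(2)[OF X(3)] by (simp add: mult.commute)
      finally show "(80 / \<delta>) * (384 * B * h) * (80 / \<delta>) * (3 * E * h^2) \<le> 1 / 2" .
    qed (use \<delta> J E start q in auto)
    then show ?thesis by simp
  qed
  have C: "480 * E / \<delta> \<ge> 0" using E \<delta> by simp
  show ?thesis
    by (rule exI[of _ "480 * E / \<delta>"], rule exI[of _ h0], rule conjI[OF C], rule conjI[OF h0], intro allI impI, elim conjE)
       (rule main)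
qed

section \<open>The local quadratics along the curve\<close>

text \<open>Extracts the linear part, so that reflections and the exchange of the axes need no
  further case distinction.\<close>

lemma grid_change_isometry:
  assumes "grid_change h T"
  obtains A where "linear A" "\<And>v. norm (A v) = norm v" "\<And>p q. T q = T p + A (q - p)"
    "A (1, 0) \<bullet> A (0, 1) = 0" "\<And>x y. A (x, y) = x *\<^sub>R A (1, 0) + y *\<^sub>R A (0, 1)"
proof -
  obtain s t :: real and k l :: int where st: "s \<in> {-1, 1}" "t \<in> {-1, 1}"
    and T: "T = (\<lambda>(x, y). (s * x + of_int k * h, t * y + of_int l * h)) \<or>
        T = (\<lambda>(x, y). (s * y + of_int k * h, t * x + of_int l * h))"
    using assms unfolding grid_change_def by (elim bexE exE)
  have sq: "s^2 = 1" "t^2 = 1" "s * s = 1" "t * t = 1" using st by auto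
  from T show thesis
  proof
    assume T: "T = (\<lambda>(x, y). (s * x + of_int k * h, t * y + of_int l * h))"
    show thesis
      by (intro that[of "\<lambda>(x, y). (s * x, t * y)"])
         (auto intro!: linearI simp: T norm_prod_def power_mult_distrib sq algebra_simps)
  next
    assume T: "T = (\<lambda>(x, y). (s * y + of_int k * h, t * x + of_int l * h))"
    show thesis
      by (intro that[of "\<lambda>(x, y). (s * y, t * x)"])
         (auto intro!: linearI simp: T norm_prod_def power_mult_distrib sq algebra_simps)
  qed
qed

locale interface_problem = interface_regions +
  fixes f f1 f2 :: "plane \<Rightarrow> real" and \<epsilon> \<delta> :: real
  assumes \<epsilon>: "\<epsilon> > 0"
    and f1: "Ck_on 4 ({-\<epsilon>..1+\<epsilon>} \<times> {-\<epsilon>..1+\<epsilon>}) f1"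
    and f2: "Ck_on 4 ({-\<epsilon>..1+\<epsilon>} \<times> {-\<epsilon>..1+\<epsilon>}) f2"
    and f\<Omega>1: "p \<in> \<Omega>1 \<Longrightarrow> f p = f1 p" and f\<Omega>2: "p \<in> \<Omega>2 \<Longrightarrow> f p = f2 p"
    and \<delta>: "\<delta> > 0" and jump: "p \<in> \<Gamma> \<Longrightarrow> \<bar>f1 p - f2 p\<bar> \<ge> \<delta>"
begin

definition near_section :: "real \<Rightarrow> real \<Rightarrow> (plane \<Rightarrow> plane) \<Rightarrow> (real \<Rightarrow> real) \<Rightarrow> coeffs \<Rightarrow> bool" where
  "near_section K h T g u \<longleftrightarrow> window_section h \<Gamma> \<Omega>1 \<Omega>2 T g \<and> (\<forall>x\<in>{h..4 * h}. \<bar>quad h u x - g x\<bar> \<le> K * h^3)"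

lemma window_sectionD:
  assumes "window_section h \<Gamma> \<Omega>1 \<Omega>2 T g"
  shows "grid_change h T" "p \<in> {h..4 * h} \<times> {h..9 * h} \<Longrightarrow> T p \<in> unit_square"
    "x \<in> {h..4 * h} \<Longrightarrow> 3 * h \<le> g x" "x \<in> {h..4 * h} \<Longrightarrow> g x \<le> 7 * h"
    "{p \<in> {h..4 * h} \<times> {h..9 * h}. T p \<in> \<Gamma>} = (\<lambda>x. (x, g x)) ` {h..4 * h}"
    "x \<in> {h..4 * h} \<Longrightarrow> T (x, g x) \<in> \<Gamma>"
    "x \<in> {h..4 * h} \<Longrightarrow> y \<in> {h..9 * h} \<Longrightarrow> y < g x \<Longrightarrow> T (x, y) \<in> \<Omega>1"
    "x \<in> {h..4 * h} \<Longrightarrow> y \<in> {h..9 * h} \<Longrightarrow> g x < y \<Longrightarrow> T (x, y) \<in> \<Omega>2"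
proof -
  note w = assms[unfolded window_section_def]
  show "grid_change h T" "x \<in> {h..4 * h} \<Longrightarrow> 3 * h \<le> g x" "x \<in> {h..4 * h} \<Longrightarrow> g x \<le> 7 * h"
    and eq: "{p \<in> {h..4 * h} \<times> {h..9 * h}. T p \<in> \<Gamma>} = (\<lambda>x. (x, g x)) ` {h..4 * h}"
    using w by simp_all
  show "T p \<in> unit_square" if "p \<in> {h..4 * h} \<times> {h..9 * h}"
    by (rule subsetD[OF w[THEN conjunct2, THEN conjunct1] imageI[OF that]])
  show "T (x, g x) \<in> \<Gamma>" if "x \<in> {h..4 * h}"
  proof -
    have "(x, g x) \<in> {p \<in> {h..4 * h} \<times> {h..9 * h}. T p \<in> \<Gamma>}" unfolding eq using that by (rule imageI)
    then show ?thesis by (elim CollectE conjE)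
  qed
  note side = w[THEN conjunct2, THEN conjunct2, THEN conjunct2, THEN conjunct2, THEN bspec, THEN bspec]
  show "T (x, y) \<in> \<Omega>1" if "x \<in> {h..4 * h}" "y \<in> {h..9 * h}" "y < g x"
    by (rule side[OF that(1,2), THEN conjunct1, rule_format, OF that(3)])
  show "T (x, y) \<in> \<Omega>2" if "x \<in> {h..4 * h}" "y \<in> {h..9 * h}" "g x < y"
    by (rule side[OF that(1,2), THEN conjunct2, rule_format, OF that(3)])
qed

text \<open>No regularity of \<open>g\<close> is given, but its graph is the preimage of the compact
  curve within the closed window, hence closed; with values in a compact interval this gives
  continuity.\<close>

lemma continuous_section:
  assumes "window_section h \<Gamma> \<Omega>1 \<Omega>2 T g"
  shows "continuous_on {h..4 * h} g"
proof (rule continuous_from_closed_graph[of "{3 * h..7 * h}"])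
  note w = window_sectionD[OF assms]
  obtain A where A: "linear A" "\<And>p q. T q = T p + A (q - p)" using grid_change_isometry[OF w(1)] by metis
  have "continuous_on UNIV T"
  proof -
    have bl: "bounded_linear A" using A(1) by (simp add: linear_conv_bounded_linear)
    have eq: "T = (\<lambda>q. T 0 + A q)" by (rule ext, subst A(2)[of _ 0]) simp
    show ?thesis by (subst eq) (intro continuous_on_add continuous_on_const linear_continuous_on bl)
  qed
  then have "closed (({h..4 * h} \<times> {h..9 * h}) \<inter> T -` \<Gamma>)"
    by (intro closed_Int closed_Times closed_vimage compact_imp_closed[OF compact_curve]) auto
  moreover have "({h..4 * h} \<times> {h..9 * h}) \<inter> T -` \<Gamma> = (\<lambda>x. Pair x (g x)) ` {h..4 * h}"
    using w(5) by (simp add: Int_def vimage_def)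
  ultimately show "closed ((\<lambda>x. Pair x (g x)) ` {h..4 * h})" by simp
  show "g \<in> {h..4 * h} \<rightarrow> {3 * h..7 * h}" using w(3,4) by auto
qed auto

lemma taylor_unit_square:
  assumes \<phi>: "Ck_on 4 ({-\<epsilon>..1+\<epsilon>} \<times> {-\<epsilon>..1+\<epsilon>}) \<phi>"
  shows "\<exists>M\<ge>1. continuous_on unit_square \<phi> \<and> (\<forall>p\<in>unit_square. \<bar>\<phi> p\<bar> \<le> M \<and>
     (\<exists>D. linear D \<and> (\<forall>v. \<bar>D v\<bar> \<le> M * norm v) \<and> (\<forall>q\<in>unit_square. \<bar>\<phi> q - \<phi> p - D (q - p)\<bar> \<le> M * (norm (q - p))\<^sup>2)))"
proof -
  let ?S = "{-\<epsilon>..1+\<epsilon>} \<times> {-\<epsilon>..1+\<epsilon>}"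
  have US: "unit_square \<subseteq> ?S" using \<epsilon> by (intro Sigma_mono) auto
  have c: "continuous_on unit_square \<phi>" by (rule continuous_on_subset[OF Ck_on_imp_continuous_on[OF \<phi>] US])
  have "compact unit_square" by (intro compact_Times) auto
  then obtain M1 where M1: "\<And>p. p \<in> unit_square \<Longrightarrow> \<bar>\<phi> p\<bar> \<le> M1"
    using compact_imp_bounded[OF compact_continuous_image[OF c]] unfolding bounded_iff real_norm_def by (metis imageI)
  have four: "(4::nat) = Suc (Suc (Suc (Suc 0)))" by simp
  have S: "compact ?S" "convex ?S" by (intro compact_Times convex_Times; simp)+
  obtain M2 where M2: "M2 \<ge> 0" "\<forall>p\<in>?S. \<exists>D. linear D \<and> (\<forall>v. \<bar>D v\<bar> \<le> M2 * norm v) \<and> (\<forall>q\<in>?S. \<bar>\<phi> q - \<phi> p - D (q - p)\<bar> \<le> M2 * (norm (q - p))\<^sup>2)"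
    using Ck_on_2_taylor[OF \<phi>[unfolded four] S] by (elim exE conjE)
  define M where "M = max 1 (max M1 M2)"
  have M: "1 \<le> M" "M1 \<le> M" "M2 \<le> M" by (simp_all add: M_def)
  have "\<exists>D. linear D \<and> (\<forall>v. \<bar>D v\<bar> \<le> M * norm v) \<and> (\<forall>q\<in>unit_square. \<bar>\<phi> q - \<phi> p - D (q - p)\<bar> \<le> M * (norm (q - p))\<^sup>2)"
    if p: "p \<in> unit_square" for p
  proof -
    obtain D where D: "linear D" "\<forall>v. \<bar>D v\<bar> \<le> M2 * norm v" "\<forall>q\<in>?S. \<bar>\<phi> q - \<phi> p - D (q - p)\<bar> \<le> M2 * (norm (q - p))\<^sup>2"
      using M2(2)[THEN bspec, OF subsetD[OF US p]] by (elim exE conjE)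
    have "\<bar>D v\<bar> \<le> M * norm v" for v
      by (rule order_trans[OF D(2)[rule_format]]) (intro mult_right_mono M norm_ge_zero)
    moreover have "\<bar>\<phi> q - \<phi> p - D (q - p)\<bar> \<le> M * (norm (q - p))\<^sup>2" if "q \<in> unit_square" for q
      by (rule order_trans[OF D(3)[THEN bspec, OF subsetD[OF US that]]]) (intro mult_right_mono M zero_le_power2)
    ultimately show ?thesis using D(1) by (intro exI[of _ D] conjI allI ballI)
  qed
  then show ?thesis using M(1) c order_trans[OF M1 M(2)] by (intro exI[of _ M] conjI ballI)
qed

text \<open>The Taylor polynomial of \<phi> at \<open>T p0\<close>, read in window coordinates. The
  window measures \<open>3 * h\<close> by \<open>8 * h\<close>, so its points are within
  \<open>11 * h\<close> of \<open>p0\<close>, and 121 is \<open>11^2\<close>.\<close>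

lemma affine_approximation:
  assumes A: "linear A" "\<And>v. norm (A v) = norm v" "\<And>p q. T q = T p + A (q - p)"
    and h: "h > 0" and TW: "T ` ({h..4 * h} \<times> {h..9 * h}) \<subseteq> unit_square" and p0: "p0 \<in> {h..4 * h} \<times> {h..9 * h}"
    and M: "M \<ge> 0" "\<forall>p\<in>unit_square. \<bar>\<phi> p\<bar> \<le> M \<and> (\<exists>D. linear D \<and> (\<forall>v. \<bar>D v\<bar> \<le> M * norm v) \<and>
      (\<forall>q\<in>unit_square. \<bar>\<phi> q - \<phi> p - D (q - p)\<bar> \<le> M * (norm (q - p))\<^sup>2))"
  shows "\<exists>l. \<bar>fst l\<bar> \<le> M \<and> \<bar>fst (snd l)\<bar> \<le> M \<and> lin_poly l p0 = \<phi> (T p0) \<and>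
    (\<forall>p\<in>{h..4 * h} \<times> {h..9 * h}. \<bar>\<phi> (T p) - lin_poly l p\<bar> \<le> 121 * M * h^2)"
proof -
  note W = subsetD[OF TW imageI]
  obtain x0 y0 where xy0: "p0 = (x0, y0)" by (cases p0)
  obtain D where D: "linear D" "\<forall>v. \<bar>D v\<bar> \<le> M * norm v"
      "\<forall>q\<in>unit_square. \<bar>\<phi> q - \<phi> (T p0) - D (q - T p0)\<bar> \<le> M * (norm (q - T p0))\<^sup>2"
    using M(2)[THEN bspec, OF W[OF p0]] by (elim exE conjE)
  define a where "a = D (A (1, 0))"
  define b where "b = D (A (0, 1))"
  have lin: "D (A (x, y)) = a * x + b * y" for x y
  proof -
    have "A (x, y) = A (x *\<^sub>R (1, 0) + y *\<^sub>R (0, 1))" by simp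
    also have "\<dots> = x *\<^sub>R A (1, 0) + y *\<^sub>R A (0, 1)" by (simp only: linear_add[OF A(1)] linear_scale[OF A(1)])
    finally have "D (A (x, y)) = x *\<^sub>R a + y *\<^sub>R b"
      by (simp only: linear_add[OF D(1)] linear_scale[OF D(1)] a_def b_def)
    then show ?thesis by (simp add: mult.commute)
  qed
  have "norm (1::real, 0::real) = 1" "norm (0::real, 1::real) = 1" by simp_all
  then have ab: "\<bar>a\<bar> \<le> M" "\<bar>b\<bar> \<le> M"
    using D(2)[rule_format, of "A (1, 0)"] D(2)[rule_format, of "A (0, 1)"] unfolding A(2) a_def b_def by simp_all
  define l where "l = (a, b, \<phi> (T p0) - a * x0 - b * y0)"
  have "\<bar>\<phi> (T p) - lin_poly l p\<bar> \<le> 121 * M * h^2" if p: "p \<in> {h..4 * h} \<times> {h..9 * h}" for p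
  proof -
    obtain x y where xy: "p = (x, y)" by (cases p)
    have e: "T p - T p0 = A (p - p0)" using A(3)[of p p0] by simp
    have "D (T p - T p0) = a * (x - x0) + b * (y - y0)" unfolding e unfolding xy xy0 by (simp add: lin)
    then have "lin_poly l p = \<phi> (T p0) + D (T p - T p0)" by (simp add: l_def lin_poly_def xy algebra_simps)
    then have "\<bar>\<phi> (T p) - lin_poly l p\<bar> \<le> M * (norm (T p - T p0))\<^sup>2"
      using D(3)[THEN bspec, OF W[OF p]] by (simp add: algebra_simps)
    also have "norm (T p - T p0) \<le> 11 * h"
    proof -
      have "norm (p - p0) \<le> norm (x - x0) + norm (y - y0)" unfolding xy xy0 using norm_Pair_le[of "x - x0" "y - y0"] by simp
      then show ?thesis unfolding e A(2) using p p0 by (auto simp: xy xy0)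
    qed
    then have "M * (norm (T p - T p0))\<^sup>2 \<le> M * (11 * h)\<^sup>2" using M(1) by (intro mult_left_mono power_mono) auto
    finally show ?thesis by (simp add: power_mult_distrib)
  qed
  then show ?thesis using ab by (intro exI[of _ l] conjI ballI) (simp_all add: l_def lin_poly_def xy0)
qed

lemma window_data_section:
  "\<exists>M\<ge>1. \<forall>h T g u. h > 0 \<and> near_section K h T g u \<longrightarrow>
     (\<exists>l1 l2 p0. window_data M \<delta> K h (f \<circ> T) (f1 \<circ> T) (f2 \<circ> T) g u l1 l2 p0)"
proof -
  obtain M1 where M1: "M1 \<ge> 1" "continuous_on unit_square f1" "\<forall>p\<in>unit_square. \<bar>f1 p\<bar> \<le> M1 \<and> (\<exists>D. linear D \<and> (\<forall>v. \<bar>D v\<bar> \<le> M1 * norm v) \<and>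
      (\<forall>q\<in>unit_square. \<bar>f1 q - f1 p - D (q - p)\<bar> \<le> M1 * (norm (q - p))\<^sup>2))"
    using taylor_unit_square[OF f1] by (elim exE conjE)
  obtain M2 where M2: "M2 \<ge> 1" "continuous_on unit_square f2" "\<forall>p\<in>unit_square. \<bar>f2 p\<bar> \<le> M2 \<and> (\<exists>D. linear D \<and> (\<forall>v. \<bar>D v\<bar> \<le> M2 * norm v) \<and>
      (\<forall>q\<in>unit_square. \<bar>f2 q - f2 p - D (q - p)\<bar> \<le> M2 * (norm (q - p))\<^sup>2))"
    using taylor_unit_square[OF f2] by (elim exE conjE)
  define M where "M = 121 * M1 + 121 * M2"
  have main: "\<exists>l1 l2 p0. window_data M \<delta> K h (f \<circ> T) (f1 \<circ> T) (f2 \<circ> T) g u l1 l2 p0"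
    if h: "h > 0" and near: "near_section K h T g u" for h T g u
  proof -
    from near have sec: "window_section h \<Gamma> \<Omega>1 \<Omega>2 T g" and u: "\<forall>x\<in>{h..4 * h}. \<bar>quad h u x - g x\<bar> \<le> K * h^3"
      unfolding near_section_def by simp_all
    note w = window_sectionD[OF sec]
    let ?W = "{h..4 * h} \<times> {h..9 * h}"
    obtain A where A: "linear A" "\<And>v. norm (A v) = norm v" "\<And>p q. T q = T p + A (q - p)"
      using grid_change_isometry[OF w(1)] by metis
    have bl: "bounded_linear A" using A(1) by (simp add: linear_conv_bounded_linear)
    have contT: "continuous_on ?W T"
    proof -
      have eq: "T = (\<lambda>q. T 0 + A q)" by (rule ext, subst A(3)[of _ 0]) simp
      show ?thesis by (subst eq) (intro continuous_on_add continuous_on_const linear_continuous_on bl)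
    qed
    have TW: "T ` ?W \<subseteq> unit_square" using w(2) by (intro image_subsetI)
    \<comment> \<open>The base point lies on the section, so that the jump is at least \<delta>
      there.\<close>
    define p0 where "p0 = (2 * h, g (2 * h))"
    have h2: "2 * h \<in> {h..4 * h}" using h by simp
    have p0: "p0 \<in> ?W" using w(3,4)[OF h2] h by (simp add: p0_def)
    have Tp0: "T p0 \<in> \<Gamma>" unfolding p0_def by (rule w(6)[OF h2])
    have Mn: "0 \<le> M1" "0 \<le> M2" using M1(1) M2(1) by simp_all
    obtain l1 where l1: "\<bar>fst l1\<bar> \<le> M1" "\<bar>fst (snd l1)\<bar> \<le> M1" "lin_poly l1 p0 = f1 (T p0)"
      "\<forall>p\<in>?W. \<bar>f1 (T p) - lin_poly l1 p\<bar> \<le> 121 * M1 * h^2"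
      using affine_approximation[OF A h TW p0 Mn(1) M1(3)] by (elim exE conjE)
    obtain l2 where l2: "\<bar>fst l2\<bar> \<le> M2" "\<bar>fst (snd l2)\<bar> \<le> M2" "lin_poly l2 p0 = f2 (T p0)"
      "\<forall>p\<in>?W. \<bar>f2 (T p) - lin_poly l2 p\<bar> \<le> 121 * M2 * h^2"
      using affine_approximation[OF A h TW p0 Mn(2) M2(3)] by (elim exE conjE)
    have le: "121 * M1 * h^2 \<le> M * h^2" "121 * M2 * h^2 \<le> M * h^2"
      using Mn by (intro mult_right_mono; simp add: M_def)+
    have j: "\<delta> \<le> \<bar>f1 (T p0) - f2 (T p0)\<bar>" by (rule jump[OF Tp0])
    have f12: "\<bar>f1 (T p0)\<bar> \<le> M1" "\<bar>f2 (T p0)\<bar> \<le> M2"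
      using M1(3)[THEN bspec, OF w(2)[OF p0]] M2(3)[THEN bspec, OF w(2)[OF p0]] by simp_all
    have "window_data M \<delta> K h (f \<circ> T) (f1 \<circ> T) (f2 \<circ> T) g u l1 l2 p0"
      unfolding window_data_def Let_def
    proof (intro conjI ballI impI)
      show "continuous_on ?W (f1 \<circ> T)" "continuous_on ?W (f2 \<circ> T)"
        by (rule continuous_on_compose[OF contT continuous_on_subset[OF M1(2) TW]]
            continuous_on_compose[OF contT continuous_on_subset[OF M2(2) TW]])+
      show "continuous_on {h..4 * h} g" by (rule continuous_section[OF sec])
      show "3 * h \<le> g x" "g x \<le> 7 * h" "\<bar>quad h u x - g x\<bar> \<le> K * h^3" if "x \<in> {h..4 * h}" for x
        using w(3,4)[OF that] u that by simp_all
      fix p assume p: "p \<in> ?W"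
      obtain x y where xy: "p = (x, y)" by (cases p)
      have xyW: "x \<in> {h..4 * h}" "y \<in> {h..9 * h}" using p by (simp_all add: xy)
      show "(f \<circ> T) p = (f1 \<circ> T) p" if "snd p < g (fst p)"
        using f\<Omega>1[OF w(7)[OF xyW]] that by (simp add: xy)
      show "(f \<circ> T) p = (f2 \<circ> T) p" if "g (fst p) < snd p"
        using f\<Omega>2[OF w(8)[OF xyW]] that by (simp add: xy)
      show "\<bar>(f1 \<circ> T) p - lin_poly l1 p\<bar> \<le> M * h^2" "\<bar>(f2 \<circ> T) p - lin_poly l2 p\<bar> \<le> M * h^2"
        using order_trans[OF l1(4)[THEN bspec, OF p] le(1)] order_trans[OF l2(4)[THEN bspec, OF p] le(2)] by simp_all
    next
      show "\<bar>fst l1\<bar> \<le> M" "\<bar>fst (snd l1)\<bar> \<le> M" "\<bar>fst l2\<bar> \<le> M" "\<bar>fst (snd l2)\<bar> \<le> M"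
        unfolding M_def using l1(1,2) l2(1,2) Mn by linarith+
      show "p0 \<in> ?W" by (rule p0)
      show "\<delta> \<le> \<bar>lin_poly l1 p0 - lin_poly l2 p0\<bar>" unfolding l1(3) l2(3) by (rule j)
      show "\<bar>lin_poly l1 p0 - lin_poly l2 p0\<bar> \<le> 2 * M" unfolding l1(3) l2(3) M_def using f12 Mn abs_triangle_ineq4[of "f1 (T p0)" "f2 (T p0)"] by simp
    qed
    then show ?thesis by blast
  qed
  have "M \<ge> 1" using M1(1) M2(1) by (simp add: M_def)
  then show ?thesis using main by blast
qed

text \<open>The second difference of \<open>g\<close> is \<open>O(h\<^sup>2)\<close> because three points of \<open>\<Gamma>\<close> with equidistant
  abscissas have a second difference that is vertical, and up to \<open>O(h\<^sup>2)\<close> tangent to \<open>\<Gamma>\<close>, while the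
  tangent is not close to vertical.\<close>

lemma start_bounded:
  assumes K: "K \<ge> 0"
  shows "\<exists>C h0. h0 > 0 \<and> (\<forall>h T g u. 0 < h \<and> h < h0 \<and> near_section K h T g u \<longrightarrow> \<bar>fst u\<bar> \<le> C \<and> \<bar>fst (snd u)\<bar> \<le> C)"
proof -
  obtain M where "taylor_bound M" using curve_taylor ..
  note M = taylor_boundD(1)[OF this] and T2 = taylor_boundD(4)[OF this]
  obtain \<eta> where \<eta>: "\<eta> > 0" and ca: "\<forall>s0 s1. norm (\<gamma> s1 - \<gamma> s0) < \<eta> \<longrightarrow>
     (\<exists>k::int. \<bar>s1 + of_int k * len - s0\<bar> \<le> 2 * norm (\<gamma> s1 - \<gamma> s0))"
    using chord_arc by (elim exE conjE)
  define C where "C = 20000 * M + 21 * K + 2"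
  \<comment> \<open>Chords between the three section points are at most \<open>6 * h\<close>, so
    \<open>8 * h < \<eta>\<close> admits \<open>chord_arc\<close>; \<open>400 * M * h < 1\<close>
    makes the Taylor remainders small against \<open>h\<close>.\<close>
  define h0 where "h0 = min (min 1 (\<eta> / 8)) (1 / (400 * M))"
  have h0: "h0 > 0" using \<eta> M by (simp add: h0_def)
  have main: "\<bar>fst u\<bar> \<le> C \<and> \<bar>fst (snd u)\<bar> \<le> C" if h: "0 < h" "h < h0" and near: "near_section K h T g u" for h T g u
  proof -
    from near have sec: "window_section h \<Gamma> \<Omega>1 \<Omega>2 T g" and u: "\<forall>x\<in>{h..4 * h}. \<bar>quad h u x - g x\<bar> \<le> K * h^3"
      unfolding near_section_def by simp_all
    note w = window_sectionD[OF sec]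
    obtain A where A: "linear A" "\<And>v. norm (A v) = norm v" "\<And>p q. T q = T p + A (q - p)"
      "A (1, 0) \<bullet> A (0, 1) = 0" "\<And>x y. A (x, y) = x *\<^sub>R A (1, 0) + y *\<^sub>R A (0, 1)"
      using grid_change_isometry[OF w(1)] by metis
    define e1 e2 where "e1 = A (1, 0)" and "e2 = A (0, 1)"
    have "norm (1::real, 0::real) = 1" "norm (0::real, 1::real) = 1" by simp_all
    then have n: "norm e1 = 1" "norm e2 = 1" by (simp_all only: e1_def e2_def A(2))
    have ip: "e1 \<bullet> e1 = 1" "e2 \<bullet> e1 = 0"
      using n A(4) by (simp_all add: dot_square_norm e1_def[symmetric] e2_def[symmetric] inner_commute)
    have hs: "h < 1" "8 * h < \<eta>" "400 * M * h < 1"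
      using h M by (simp_all add: h0_def field_simps)
    have x: "h \<in> {h..4 * h}" "5/2 * h \<in> {h..4 * h}" "4 * h \<in> {h..4 * h}" using h by simp_all
    define g0 g1 g2 where "g0 = g h" and "g1 = g (5/2 * h)" and "g2 = g (4 * h)"
    have gb: "3 * h \<le> g0" "g0 \<le> 7 * h" "3 * h \<le> g1" "g1 \<le> 7 * h" "3 * h \<le> g2" "g2 \<le> 7 * h"
      unfolding g0_def g1_def g2_def using w(3,4) x by blast+
    have "T (h, g0) \<in> \<Gamma>" "T (5/2 * h, g1) \<in> \<Gamma>" "T (4 * h, g2) \<in> \<Gamma>"
      unfolding g0_def g1_def g2_def using w(6) x by blast+
    then obtain s0' s1 s2' where s: "T (h, g0) = \<gamma> s0'" "T (5/2 * h, g1) = \<gamma> s1" "T (4 * h, g2) = \<gamma> s2'" by (elim imageE)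
    have P: "\<gamma> s0' - \<gamma> s1 = (- 3/2 * h) *\<^sub>R e1 + (g0 - g1) *\<^sub>R e2"
       "\<gamma> s2' - \<gamma> s1 = (3/2 * h) *\<^sub>R e1 + (g2 - g1) *\<^sub>R e2"
    proof -
      have "T q - T p = A (q - p)" for p q using A(3)[of q p] by simp
      note d = this
      show "\<gamma> s0' - \<gamma> s1 = (- 3/2 * h) *\<^sub>R e1 + (g0 - g1) *\<^sub>R e2"
        unfolding s[symmetric] d e1_def e2_def A(5)[symmetric] by (simp add: algebra_simps)
      show "\<gamma> s2' - \<gamma> s1 = (3/2 * h) *\<^sub>R e1 + (g2 - g1) *\<^sub>R e2"
        unfolding s[symmetric] d e1_def e2_def A(5)[symmetric] by (simp add: algebra_simps)
    qed
    have nb: "norm (a *\<^sub>R e1 + b *\<^sub>R e2) \<le> \<bar>a\<bar> + \<bar>b\<bar>" for a b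
      using norm_triangle_ineq[of "a *\<^sub>R e1" "b *\<^sub>R e2"] n by simp
    have nP: "norm (\<gamma> s0' - \<gamma> s1) \<le> 6 * h" "norm (\<gamma> s2' - \<gamma> s1) \<le> 6 * h"
    proof -
      have "\<bar>- 3/2 * h\<bar> + \<bar>g0 - g1\<bar> \<le> 6 * h" "\<bar>3/2 * h\<bar> + \<bar>g2 - g1\<bar> \<le> 6 * h"
        using gb h by linarith+
      then show "norm (\<gamma> s0' - \<gamma> s1) \<le> 6 * h" "norm (\<gamma> s2' - \<gamma> s1) \<le> 6 * h"
        unfolding P using nb order_trans by blast+
    qed
    have "norm (\<gamma> s0' - \<gamma> s1) < \<eta>" "norm (\<gamma> s2' - \<gamma> s1) < \<eta>" using nP hs(2) h by linarith+
    then obtain k0 k2 :: int where k: "\<bar>s0' + of_int k0 * len - s1\<bar> \<le> 2 * norm (\<gamma> s0' - \<gamma> s1)"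
      "\<bar>s2' + of_int k2 * len - s1\<bar> \<le> 2 * norm (\<gamma> s2' - \<gamma> s1)"
      using ca by blast
    define s0 s2 where "s0 = s0' + of_int k0 * len" and "s2 = s2' + of_int k2 * len"
    have per: "\<gamma> s0 = \<gamma> s0'" "\<gamma> s2 = \<gamma> s2'"
      unfolding s0_def s2_def by (rule periodic_int[of \<gamma>, OF period])+
    have sb: "\<bar>s0 - s1\<bar> \<le> 12 * h" "\<bar>s2 - s1\<bar> \<le> 12 * h" using k nP unfolding s0_def s2_def by linarith+
    define \<tau> r0 r2 where "\<tau> = \<gamma>1 s1" and "r0 = \<gamma> s0 - \<gamma> s1 - (s0 - s1) *\<^sub>R \<gamma>1 s1" and "r2 = \<gamma> s2 - \<gamma> s1 - (s2 - s1) *\<^sub>R \<gamma>1 s1"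
    have rb: "norm r0 \<le> 144 * M * h^2" "norm r2 \<le> 144 * M * h^2"
    proof -
      have "M * \<bar>s0 - s1\<bar>^2 \<le> M * (12 * h)^2" "M * \<bar>s2 - s1\<bar>^2 \<le> M * (12 * h)^2"
        using M sb by (intro mult_left_mono power_mono; simp)+
      then show "norm r0 \<le> 144 * M * h^2" "norm r2 \<le> 144 * M * h^2"
        unfolding r0_def r2_def using T2[of s0 s1] T2[of s2 s1] by (simp_all add: power_mult_distrib)
    qed
    \<comment> \<open>\<open>t\<close> is the component of the tangent along the abscissa,
      \<open>S\<close> the sum of the two signed arcs and \<open>G\<close> the second difference of
      the section.\<close>
    define t where "t = \<tau> \<bullet> e1"
    define S where "S = (s0 - s1) + (s2 - s1)"
    define G where "G = g0 - 2 * g1 + g2"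
    have sum: "S *\<^sub>R \<tau> + r0 + r2 = G *\<^sub>R e2"
    proof -
      have "S *\<^sub>R \<tau> + r0 + r2 = (\<gamma> s0 - \<gamma> s1) + (\<gamma> s2 - \<gamma> s1)"
        unfolding S_def \<tau>_def r0_def r2_def scaleR_left_distrib by simp
      also have "\<dots> = (g0 - g1) *\<^sub>R e2 + (g2 - g1) *\<^sub>R e2" unfolding per P by simp
      also have "\<dots> = G *\<^sub>R e2" unfolding scaleR_left_distrib[symmetric] by (simp add: G_def)
      finally show ?thesis .
    qed
    have ri: "\<bar>r0 \<bullet> e1\<bar> \<le> 144 * M * h^2" "\<bar>r2 \<bullet> e1\<bar> \<le> 144 * M * h^2"
      using abs_inner_unit[OF n(1)] rb order_trans by blast+
    have Mh: "M * h^2 \<le> h / 400"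
    proof -
      have "400 * M * h * h \<le> 1 * h" using hs(3) h by (intro mult_right_mono) auto
      then show ?thesis by (simp add: power2_eq_square)
    qed
    \<comment> \<open>The component along \<open>e1\<close> removes the vertical second difference
      and leaves \<open>S * t = O(h^2)\<close>.\<close>
    have "(S *\<^sub>R \<tau> + r0 + r2) \<bullet> e1 = 0" unfolding sum by (simp add: ip)
    then have "S * t = - (r0 \<bullet> e1) - (r2 \<bullet> e1)" by (simp add: inner_add_left t_def)
    then have St: "\<bar>S\<bar> * \<bar>t\<bar> \<le> 288 * M * h^2" unfolding abs_mult[symmetric] using ri by linarith
    \<comment> \<open>The abscissas differ by \<open>3/2 * h\<close> while the arc is at most
      \<open>12 * h\<close>, so the tangent cannot be close to vertical.\<close>
    have "(\<gamma> s2 - \<gamma> s1) \<bullet> e1 = 3/2 * h" unfolding per P by (simp add: inner_add_left ip)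
    moreover have "(\<gamma> s2 - \<gamma> s1) \<bullet> e1 = (s2 - s1) * t + r2 \<bullet> e1" by (simp add: r2_def t_def \<tau>_def inner_diff_left)
    ultimately have "h \<le> \<bar>s2 - s1\<bar> * \<bar>t\<bar>" unfolding abs_mult[symmetric] using ri(2) Mh h by linarith
    also have "\<dots> \<le> 12 * h * \<bar>t\<bar>" using sb(2) by (intro mult_right_mono) auto
    finally have t: "1 / 12 \<le> \<bar>t\<bar>" using h by (simp add: field_simps)
    have "\<bar>S\<bar> * (1/12) \<le> \<bar>S\<bar> * \<bar>t\<bar>" by (rule mult_left_mono[OF t abs_ge_zero])
    then have Sb: "\<bar>S\<bar> \<le> 3456 * M * h^2" using St by linarith
    have "\<bar>G\<bar> = norm (S *\<^sub>R \<tau> + r0 + r2)" unfolding sum using n(2) by simp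
    also have "\<dots> \<le> \<bar>S\<bar> + norm r0 + norm r2"
      using norm_triangle_ineq[of "S *\<^sub>R \<tau> + r0" r2] norm_triangle_ineq[of "S *\<^sub>R \<tau>" r0] norm_velocity[of s1] by (simp add: \<tau>_def)
    finally have G: "\<bar>G\<bar> \<le> 4000 * M * h^2" using Sb rb Mh M by (simp add: power2_eq_square)
    \<comment> \<open>The start is known only through its values on the window. Its second
      difference at these abscissas is \<open>9/2 * (a * h^2)\<close>, which bounds
      \<open>a\<close>; the difference of the outer values then bounds \<open>b\<close>.\<close>
    obtain a b c where abc: "u = (a, b, c)" by (cases u)
    have q: "\<bar>a * h^2 + b * h + c * h - g0\<bar> \<le> K * h^3" "\<bar>a * (25/4 * h^2) + b * (5/2 * h) + c * h - g1\<bar> \<le> K * h^3"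
       "\<bar>a * (16 * h^2) + b * (4 * h) + c * h - g2\<bar> \<le> K * h^3"
      using u[THEN bspec, OF x(1)] u[THEN bspec, OF x(2)] u[THEN bspec, OF x(3)]
      unfolding abc quad_def g0_def g1_def g2_def by (simp_all add: power_mult_distrib power_divide)
    have Kh: "K * h^3 \<le> K * h^2" using K h hs(1) by (intro mult_left_mono power_decreasing) auto
    have "\<bar>9/2 * (a * h^2)\<bar> \<le> 4000 * M * h^2 + 4 * (K * h^2)"
      using q G Kh unfolding G_def by (simp add: algebra_simps)
    then have "\<bar>a\<bar> * h^2 \<le> (4000 * M + 4 * K) * h^2"
    proof -
      have "K * h^2 \<ge> 0" "M * h^2 \<ge> 0" using K M by simp_all
      then show ?thesis using \<open>\<bar>9/2 * (a * h^2)\<bar> \<le> 4000 * M * h^2 + 4 * (K * h^2)\<close>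
        by (simp add: abs_mult algebra_simps)
    qed
    then have a: "\<bar>a\<bar> \<le> 4000 * M + 4 * K" using h by simp
    have "K * h^2 \<le> K * h" using K h hs(1) by (intro mult_left_mono) (auto simp: power2_eq_square)
    moreover have "\<bar>a * h^2\<bar> \<le> (4000 * M + 4 * K) * h"
    proof -
      have "\<bar>a\<bar> * h^2 \<le> (4000 * M + 4 * K) * h" using a h hs(1) K M by (intro mult_mono) (auto simp: power2_eq_square)
      then show ?thesis by (simp add: abs_mult)
    qed
    ultimately have "\<bar>3 * (b * h)\<bar> \<le> 15 * ((4000 * M + 4 * K) * h) + 4 * h + 2 * (K * h)"
      using q(1,3) Kh gb by (simp add: algebra_simps)
    then have "\<bar>b\<bar> * h \<le> (20000 * M + 21 * K + 2) * h"
      using h mult_nonneg_nonneg[OF K less_imp_le[OF h(1)]] by (simp add: abs_mult algebra_simps)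
    then have b: "\<bar>b\<bar> \<le> 20000 * M + 21 * K + 2" using h by simp
    show ?thesis using a b K M unfolding abc C_def by simp
  qed
  show ?thesis
    by (rule exI[of _ C], rule exI[of _ h0], rule conjI[OF h0], intro allI impI, elim conjE) (rule main)
qed

end

section \<open>The sides of the local curves\<close>

lemma deriv_quad: "deriv (quad h (a, b, c)) x = 2 * a * x + b"
  by (rule DERIV_imp_deriv) (auto simp: quad_def intro!: derivative_eq_intros)

lemma dist_plane_power2: "(dist (a, b) (c, d))^2 = (a - c)^2 + (b - d)^2" for a b c d :: real
  by (simp add: dist_Pair_Pair dist_real_def)

text \<open>If the graph of \<open>q\<close> beyond \<open>x\<close> is hardly nearer to \<open>(v, w)\<close> than \<open>(x, q x)\<close>, then moving \<open>x\<close> by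
  \<open>r = sqrt (D h\<^sup>3) / 2\<close> in both directions shows that the offset from \<open>(x, q x)\<close> to \<open>(v, w)\<close> is almost
  normal to the graph.\<close>

lemma side_estimate:
  fixes a b c B E :: real
  assumes h: "0 < h" "h \<le> 1" and B: "B \<ge> 1" "\<bar>a\<bar> \<le> B" "\<bar>b\<bar> \<le> B" and E: "E \<ge> 0"
    and x: "2 * h \<le> x" "x \<le> 3 * h"
    and D: "D = dist (v, w) (x, quad h (a, b, c) x)" "D \<le> 3"
    and near: "\<And>\<xi>. h \<le> \<xi> \<Longrightarrow> \<xi> \<le> 4 * h \<Longrightarrow> D - E * h^3 \<le> dist (v, w) (\<xi>, quad h (a, b, c) \<xi>)"
    and \<sigma>: "\<bar>\<sigma>\<bar> = 1" "0 \<le> \<sigma> * (w - (quad h (a, b, c) x + (2 * a * x + b) * (v - x)))"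
    and big: "(3600 * (4 * E + 71 * B^2)^2 * B^4 + E + 1) * h^3 \<le> D"
  shows "D / (16 * B) \<le> \<sigma> * (w - quad h (a, b, c) x)"
proof -
  define dx dy s where "dx = v - x" and "dy = w - quad h (a, b, c) x" and "s = 2 * a * x + b"
  \<comment> \<open>The inner product of the offset with the tangent \<open>(1, s)\<close>; it would
    vanish at an interior minimum of the distance and is only small here.\<close>
  define t where "t = dx + s * dy"
  define Q where "Q = 4 * E + 71 * B^2"
  have BB: "B \<le> B^2" "1 \<le> B^2" using self_le_power[OF B(1), of 2] one_le_power[OF B(1), of 2] by simp_all
  have Q: "Q > 0" using E BB by (simp add: Q_def)
  have h3: "h^3 > 0" using h by simp
  have L: "0 \<le> 3600 * Q^2 * B^4" by simp
  have DL: "3600 * Q^2 * B^4 * h^3 \<le> D" "E * h^3 \<le> D" "0 < D"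
  proof -
    have "0 \<le> 3600 * Q^2 * B^4 * h^3" "0 \<le> E * h^3" using L E h3 by simp_all
    moreover have "3600 * Q^2 * B^4 * h^3 + E * h^3 + h^3 \<le> D"
      using big unfolding Q_def[symmetric] distrib_right mult_1 .
    ultimately show "3600 * Q^2 * B^4 * h^3 \<le> D" "E * h^3 \<le> D" "0 < D" using h3 by linarith+
  qed
  have s: "\<bar>s\<bar> \<le> 7 * B"
  proof -
    have "\<bar>a\<bar> * \<bar>x\<bar> \<le> B * 3" using B x h by (intro mult_mono) auto
    then have "\<bar>2 * a * x\<bar> \<le> 6 * B" by (simp add: abs_mult)
    then show ?thesis using B unfolding s_def by linarith
  qed
  have D2: "D^2 = dx^2 + dy^2" unfolding D(1) dist_plane_power2 dx_def dy_def ..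
  have dyD: "\<bar>dy\<bar> \<le> D" by (rule power2_le_imp_le) (use D2 DL(3) in auto)
  \<comment> \<open>The choice \<open>4 * r^2 = D * h^3\<close> balances the two terms of
    \<open>step\<close> below; \<open>D \<le> 3\<close> ensures \<open>r \<le> h\<close>, so
    \<open>x - r\<close> and \<open>x + r\<close> remain in \<open>[h, 4h]\<close>.\<close>
  define r where "r = sqrt (D * h^3) / 2"
  have r: "r > 0" "4 * r^2 = D * h^3" using DL(3) h3 by (simp_all add: r_def power_divide)
  have rh: "r \<le> h"
  proof -
    have "D * h^3 \<le> 3 * h^2" using D(2) h DL(3) by (intro mult_mono power_decreasing) auto
    then have "r^2 \<le> h^2" using r(2) zero_le_power2[of h] by linarith
    then show ?thesis by (rule power2_le_imp_le) (use h in simp)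
  qed
  \<comment> \<open>Expansion of the squared distance at \<open>x + \<eta>\<close>; 71 is
    \<open>1 + 6 + 64\<close>, from \<open>\<eta>^2\<close>, the term with \<open>a * dy\<close> and
    \<open>k^2\<close>.\<close>
  have step: "2 * \<eta> * t \<le> 2 * (D * E * h^3) + 71 * B^2 * \<eta>^2" if \<eta>: "\<bar>\<eta>\<bar> \<le> h" for \<eta>
  proof -
    define k where "k = s * \<eta> + a * \<eta>^2"
    have q: "quad h (a, b, c) (x + \<eta>) = quad h (a, b, c) x + k"
      by (simp add: quad_def k_def s_def power2_eq_square algebra_simps)
    have "D - E * h^3 \<le> dist (v, w) (x + \<eta>, quad h (a, b, c) (x + \<eta>))" using \<eta> x by (intro near) auto
    then have "(D - E * h^3)^2 \<le> (dist (v, w) (x + \<eta>, quad h (a, b, c) (x + \<eta>)))^2"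
      using DL(2) by (intro power_mono) auto
    also have "\<dots> = (dx - \<eta>)^2 + (dy - k)^2"
      unfolding dist_plane_power2 q by (simp add: dx_def dy_def algebra_simps)
    finally have "(D - E * h^3)^2 \<le> (dx - \<eta>)^2 + (dy - k)^2" .
    moreover have "(D - E * h^3)^2 \<ge> D^2 - 2 * (D * E * h^3)" by (simp add: power2_diff algebra_simps)
    moreover have "(dx - \<eta>)^2 + (dy - k)^2 = D^2 - 2 * \<eta> * t - 2 * (a * dy) * \<eta>^2 + \<eta>^2 + k^2"
    proof -
      have "dy * k = \<eta> * (s * dy) + (a * dy) * \<eta>^2" by (simp add: k_def algebra_simps)
      then show ?thesis unfolding D2 t_def by (simp add: power2_diff algebra_simps)
    qed
    moreover have "- 2 * (a * dy) * \<eta>^2 \<le> 6 * B^2 * \<eta>^2"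
    proof -
      have "\<bar>a\<bar> * \<bar>dy\<bar> \<le> B * 3" using B dyD D(2) by (intro mult_mono) auto
      then have "- 2 * (a * dy) \<le> 6 * B" unfolding abs_mult[symmetric] by linarith
      also have "\<dots> \<le> 6 * B^2" using BB by simp
      finally show ?thesis by (intro mult_right_mono) auto
    qed
    moreover have "\<eta>^2 \<le> B^2 * \<eta>^2" using BB by (simp add: mult_le_cancel_right1)
    moreover have "k^2 \<le> 64 * B^2 * \<eta>^2"
    proof -
      have "\<bar>a\<bar> * \<bar>\<eta>\<bar> \<le> B * 1" using B \<eta> h by (intro mult_mono) auto
      then have "\<bar>s + a * \<eta>\<bar> \<le> 8 * B" using s unfolding abs_mult[symmetric] by linarith
      then have "(s + a * \<eta>)^2 \<le> (8 * B)^2" using power_mono[of "\<bar>s + a * \<eta>\<bar>" "8 * B" 2] by simp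
      then have "(s + a * \<eta>)^2 * \<eta>^2 \<le> (8 * B)^2 * \<eta>^2" by (intro mult_right_mono) auto
      moreover have "k = (s + a * \<eta>) * \<eta>" by (simp add: k_def power2_eq_square algebra_simps)
      ultimately show ?thesis by (simp add: power_mult_distrib)
    qed
    ultimately show ?thesis by linarith
  qed
  have tr: "\<bar>t\<bar> \<le> Q * r"
  proof -
    have "2 * r * \<bar>t\<bar> \<le> 2 * (D * E * h^3) + 71 * B^2 * r^2"
      using step[of r] step[of "- r"] r rh by (cases "t \<ge> 0") auto
    also have "D * E * h^3 = 4 * E * r^2" using r(2) by (simp add: algebra_simps)
    finally have "2 * r * \<bar>t\<bar> \<le> r * (2 * (Q * r))"
      using zero_le_power2[of "B * r"] by (simp add: Q_def power2_eq_square algebra_simps)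
    then show ?thesis using r(1) by simp
  qed
  \<comment> \<open>\<open>Q * r\<close> has the order \<open>sqrt (D * h^3)\<close>, which is small
    against \<open>D\<close> as soon as \<open>D\<close> is a large multiple of \<open>h^3\<close>;
    this is what \<open>big\<close> provides.\<close>
  have tD: "120 * B^2 * \<bar>t\<bar> \<le> D"
  proof -
    have "(120 * B^2 * \<bar>t\<bar>)^2 \<le> (120 * B^2 * (Q * r))^2" using tr by (intro power_mono mult_left_mono) auto
    also have "\<dots> = 3600 * Q^2 * B^4 * (4 * r^2)" by (simp add: power_mult_distrib algebra_simps flip: power_mult)
    also have "\<dots> = (3600 * Q^2 * B^4 * h^3) * D" unfolding r(2) by simp
    also have "\<dots> \<le> D^2" using DL by (simp add: power2_eq_square)
    finally show ?thesis by (rule power2_le_imp_le) (use DL(3) in simp)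
  qed
  have "D \<le> \<bar>dx\<bar> + \<bar>dy\<bar>"
    by (rule power2_le_imp_le) (auto simp: D2 power2_sum)
  moreover have "\<bar>dx\<bar> \<le> \<bar>t\<bar> + \<bar>s * dy\<bar>" unfolding t_def by linarith
  moreover have sdy: "\<bar>s * dy\<bar> \<le> 7 * B * \<bar>dy\<bar>" unfolding abs_mult using s by (rule mult_right_mono) simp
  moreover have "\<bar>dy\<bar> \<le> B * \<bar>dy\<bar>" using B by (simp add: mult_le_cancel_right1)
  ultimately have "D \<le> \<bar>t\<bar> + 8 * B * \<bar>dy\<bar>" by linarith
  moreover have t120: "120 * \<bar>t\<bar> \<le> 120 * B^2 * \<bar>t\<bar>" using BB by (simp add: mult_le_cancel_right1)
  ultimately have Ddy: "D \<le> 16 * (B * \<bar>dy\<bar>)" using tD DL(3) by linarith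
  \<comment> \<open>The tangent test reads \<open>(1 + s^2) * dy - s * t\<close>, and
    \<open>t\<close> is too small to overturn the sign of \<open>dy\<close>.\<close>
  have "\<sigma> * dy \<ge> 0"
  proof (rule ccontr)
    assume neg: "\<not> \<sigma> * dy \<ge> 0"
    have ab: "\<bar>\<sigma> * dy\<bar> = \<bar>dy\<bar>" using \<sigma>(1) by (simp add: abs_mult)
    have eq: "w - (quad h (a, b, c) x + (2 * a * x + b) * (v - x)) = (1 + s^2) * dy - s * t"
      by (simp add: dy_def dx_def s_def t_def power2_eq_square algebra_simps)
    then have "0 \<le> (1 + s^2) * (\<sigma> * dy) - \<sigma> * (s * t)"
      using \<sigma>(2) unfolding eq by (simp add: algebra_simps)
    moreover have "s^2 * (\<sigma> * dy) \<le> 0" by (rule mult_nonneg_nonpos) (use neg in \<open>simp_all del: mult_le_0_iff zero_le_mult_iff\<close>)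
    moreover have "\<bar>\<sigma> * (s * t)\<bar> = \<bar>s * t\<bar>" using \<sigma>(1) by (simp add: abs_mult)
    ultimately have "\<bar>dy\<bar> \<le> \<bar>s * t\<bar>" using neg ab by (simp add: distrib_right)
    also have "\<dots> \<le> 7 * B * \<bar>t\<bar>" unfolding abs_mult using s by (rule mult_right_mono) simp
    finally have "B * \<bar>dy\<bar> \<le> B * (7 * B * \<bar>t\<bar>)" using B by (intro mult_left_mono) auto
    then have "D \<le> 112 * B^2 * \<bar>t\<bar>" using Ddy by (simp add: power2_eq_square algebra_simps)
    moreover have "0 \<le> B^2 * \<bar>t\<bar>" by simp
    ultimately show False using tD DL(3) by linarith
  qed
  then have "\<sigma> * dy = \<bar>dy\<bar>" using \<sigma>(1) by (metis abs_mult abs_of_nonneg mult_1)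
  then show ?thesis using Ddy B by (simp add: dy_def[symmetric] field_simps)
qed

text \<open>Moving the foot \<open>(x, y)\<close> vertically by \<beta> towards
  \<open>(v, w)\<close> lowers the squared distance by at least
  \<open>\<beta> * D / (16 * B)\<close>, and \<open>32 * B * e < \<beta>\<close> makes this exceed
  \<open>2 * D * e\<close>. An offset of order \<open>e\<close> thus gains more than
  \<open>e\<close> in distance.\<close>

lemma offset_closer:
  fixes B e v w x y \<beta> :: real
  assumes B: "B > 0" and \<sigma>: "\<bar>\<sigma>\<bar> = 1" and D: "D = dist (v, w) (x, y)" "D / (16 * B) \<le> \<sigma> * (w - y)"
    and \<beta>: "32 * B * e < \<beta>" "16 * B * \<beta> \<le> D" and e: "0 \<le> e" "e < D"
  shows "dist (v, w) (x, y + \<sigma> * \<beta>) < D - e"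
proof (rule power2_less_imp_less)
  have \<beta>0: "0 < \<beta>"
  proof -
    have "0 \<le> 32 * B * e" using B e by simp
    then show ?thesis using \<beta>(1) by linarith
  qed
  define X where "X = \<beta> * (D / (16 * B))"
  have D2: "D^2 = (v - x)^2 + (w - y)^2" unfolding D(1) dist_plane_power2 ..
  have "\<sigma> * \<sigma> = 1" using \<sigma> by (metis abs_mult_self_eq mult_1)
  then have "(\<sigma> * \<beta>)^2 = \<beta>^2" by (simp only: power_mult_distrib) (simp only: power2_eq_square mult_1)
  then have "(w - (y + \<sigma> * \<beta>))^2 = (w - y)^2 - 2 * (\<beta> * (\<sigma> * (w - y))) + \<beta>^2"
    using power2_diff[of "w - y" "\<sigma> * \<beta>"] by (simp add: diff_diff_eq mult_ac)
  then have "(dist (v, w) (x, y + \<sigma> * \<beta>))^2 = D^2 - 2 * (\<beta> * (\<sigma> * (w - y))) + \<beta>^2"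
    unfolding D2 dist_plane_power2 by simp
  also have "\<dots> \<le> D^2 - 2 * X + \<beta>^2" using mult_left_mono[OF D(2), of \<beta>] \<beta>0 unfolding X_def by linarith
  also have "\<beta>^2 \<le> X"
  proof -
    have "\<beta> \<le> D / (16 * B)" using \<beta>(2) B by (simp add: field_simps)
    then show ?thesis using mult_left_mono[of \<beta> "D / (16 * B)" \<beta>] \<beta>0 by (simp add: X_def power2_eq_square)
  qed
  also have "2 * D * e < X"
  proof -
    have "32 * B * e * D < \<beta> * D" using \<beta>(1) e by (intro mult_strict_right_mono) auto
    then show ?thesis using B by (simp add: X_def field_simps)
  qed
  then have "D^2 - 2 * X + X < (D - e)^2" by (simp add: power2_diff) (smt (verit) zero_le_power2)
  finally show "(dist (v, w) (x, y + \<sigma> * \<beta>))^2 < (D - e)^2" by simp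
  show "0 \<le> D - e" using e by simp
qed

lemma infdist_close:
  assumes "X \<noteq> {}" "\<And>x. x \<in> X \<Longrightarrow> \<exists>y\<in>Y. dist x y \<le> e"
  shows "infdist p Y \<le> infdist p X + e"
proof -
  have "infdist p Y - e \<le> dist p x" if x: "x \<in> X" for x
  proof -
    obtain y where y: "y \<in> Y" "dist x y \<le> e" using assms(2)[OF x] by blast
    have "infdist p Y \<le> dist p y" by (rule infdist_le[OF y(1)])
    then show ?thesis using dist_triangle[of p y x] y(2) by linarith
  qed
  then have "infdist p Y - e \<le> infdist p X"
    unfolding infdist_notempty[OF assms(1)] by (intro cINF_greatest assms(1))
  then show ?thesis by linarith
qed

context interface_problem
begin

text \<open>A correction of size \<open>h^2\<close> in the scaled norm is of size \<open>h\<close>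
  in the leading coefficient, \<open>h^2\<close> in the next, and by \<open>quad_bound\<close> of
  size \<open>h^3\<close> in the values on all of \<open>[h, 4h]\<close>; boundedness of the
  coefficients is inherited from the start.\<close>

lemma local_quad_estimate:
  assumes K: "K \<ge> 0"
  shows "\<exists>C h0. C \<ge> 0 \<and> h0 > 0 \<and> (\<forall>h T g u. 0 < h \<and> h < h0 \<and> near_section K h T g u \<longrightarrow>
     \<bar>fst (local_quad h (f \<circ> T) u)\<bar> \<le> C \<and> \<bar>fst (snd (local_quad h (f \<circ> T) u))\<bar> \<le> C \<and>
     (\<forall>x\<in>{h..4 * h}. \<bar>quad h (local_quad h (f \<circ> T) u) x - g x\<bar> \<le> C * h^3))"
proof -
  obtain M where M: "M \<ge> 1" "\<forall>h T g u. h > 0 \<and> near_section K h T g u \<longrightarrow>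
     (\<exists>l1 l2 p0. window_data M \<delta> K h (f \<circ> T) (f1 \<circ> T) (f2 \<circ> T) g u l1 l2 p0)"
    using window_data_section[of K] by (elim exE conjE)
  obtain C1 h1 where C1: "C1 \<ge> 0" "h1 > 0" "\<forall>h F F1 F2 g u0 l1 l2 p0. 0 < h \<and> h < h1 \<and>
    window_data M \<delta> K h F F1 F2 g u0 l1 l2 p0 \<longrightarrow> scaled_norm h (local_quad h F u0 - u0) \<le> C1 * h^2"
    using window_newton[OF M(1) \<delta> K] by (elim exE conjE)
  obtain C2 h2 where C2: "h2 > 0" "\<forall>h T g u. 0 < h \<and> h < h2 \<and> near_section K h T g u \<longrightarrow> \<bar>fst u\<bar> \<le> C2 \<and> \<bar>fst (snd u)\<bar> \<le> C2"
    using start_bounded[OF K] by (elim exE conjE)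
  define C where "C = \<bar>C2\<bar> + 16 * C1 + K"
  have main: "\<bar>fst v\<bar> \<le> C \<and> \<bar>fst (snd v)\<bar> \<le> C \<and> (\<forall>x\<in>{h..4 * h}. \<bar>quad h v x - g x\<bar> \<le> C * h^3)"
    if h: "0 < h" "h < min 1 (min h1 h2)" and near: "near_section K h T g u" and v: "v = local_quad h (f \<circ> T) u" for h T g u v
  proof -
    obtain l1 l2 p0 where "window_data M \<delta> K h (f \<circ> T) (f1 \<circ> T) (f2 \<circ> T) g u l1 l2 p0"
      using M(2)[rule_format, OF conjI[OF h(1) near]] by (elim exE)
    then have sn: "scaled_norm h (v - u) \<le> C1 * h^2" unfolding v using C1(3) h by (metis min_less_iff_conj)
    obtain a b c where vu: "v - u = (a, b, c)" by (cases "v - u")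
    have "\<bar>fst v - fst u\<bar> \<le> C1 \<and> \<bar>fst (snd v) - fst (snd u)\<bar> \<le> C1"
    proof -
      have ab: "fst v - fst u = a" "fst (snd v) - fst (snd u) = b"
        using arg_cong[OF vu, of fst] arg_cong[OF vu, of "\<lambda>p. fst (snd p)"] by simp_all
      have "h * \<bar>a\<bar> \<ge> 0" using h by simp
      then have "h * \<bar>a\<bar> \<le> C1 * h^2" "\<bar>b\<bar> \<le> C1 * h^2" using sn unfolding vu scaled_norm_def by auto
      moreover have "C1 * h^2 \<le> C1 * h" "C1 * h \<le> C1 * 1" using C1(1) h
        by (intro mult_left_mono; simp add: power2_eq_square mult_left_le)+
      ultimately have "h * \<bar>a\<bar> \<le> h * C1" "\<bar>b\<bar> \<le> C1" using mult.commute[of h C1] by linarith+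
      then show ?thesis unfolding ab using h by simp
    qed
    moreover have "\<bar>fst u\<bar> \<le> C2 \<and> \<bar>fst (snd u)\<bar> \<le> C2" using C2(2)[rule_format, of h T g u] h near by simp
    ultimately have "\<bar>fst v\<bar> \<le> C" "\<bar>fst (snd v)\<bar> \<le> C" using C1(1) K unfolding C_def by linarith+
    moreover have "\<bar>quad h v x - g x\<bar> \<le> C * h^3" if x: "x \<in> {h..4 * h}" for x
    proof -
      have "\<bar>quad h (v - u) x\<bar> \<le> 16 * h * scaled_norm h (v - u)" using x h by (intro quad_bound) auto
      also have "\<dots> \<le> 16 * h * (C1 * h^2)" using sn h by (intro mult_left_mono) auto
      finally have "\<bar>quad h v x - quad h u x\<bar> \<le> 16 * C1 * h^3"
        by (simp add: quad_diff power2_eq_square power3_eq_cube algebra_simps)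
      moreover have "\<bar>quad h u x - g x\<bar> \<le> K * h^3" using near x unfolding near_section_def by blast
      moreover have "C * h^3 = \<bar>C2\<bar> * h^3 + 16 * C1 * h^3 + K * h^3" by (simp add: C_def algebra_simps)
      moreover have "\<bar>C2\<bar> * h^3 \<ge> 0" using h by simp
      ultimately show ?thesis by linarith
    qed
    ultimately show ?thesis by blast
  qed
  have pos: "C \<ge> 0" "min 1 (min h1 h2) > 0" using C1 C2(1) K by (simp_all add: C_def)
  show ?thesis
    by (rule exI[of _ C], rule exI[of _ "min 1 (min h1 h2)"], rule conjI[OF pos(1)], rule conjI[OF pos(2)], intro allI impI, elim conjE)
       (rule main, assumption+, rule refl)
qed

text \<open>If the distance \<open>D\<close> of \<open>p\<close> to the local curves is
  \<open>O(h^3)\<close>, the sign is immaterial. Otherwise the point over the foot \<open>x\<close>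
  at height \<open>H * h^3\<close> beyond \<Gamma>, on the side \<sigma>, is nearer to
  \<open>p\<close> than \<Gamma> is; the segment joining them avoids \<Gamma>, and the side of that
  point is known.\<close>

lemma side_error:
  assumes K: "K \<ge> 0"
  shows "\<exists>C h0. C \<ge> 0 \<and> h0 > 0 \<and> (\<forall>h W u0. 0 < h \<and> h < h0 \<and> windows K h \<Gamma> \<Omega>1 \<Omega>2 W u0 \<longrightarrow>
     (\<forall>p\<in>unit_square. \<forall>\<sigma>\<in>{-1, 1}. on_side \<sigma> h f W u0 p \<longrightarrow>
        \<bar>infdist p (local_curves h f W u0) - \<sigma> * sdist p\<bar> \<le> C * h^3))"
proof -
  obtain C1 h1 where C1: "C1 \<ge> 0" "h1 > 0" "\<forall>h T g u. 0 < h \<and> h < h1 \<and> near_section K h T g u \<longrightarrow>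
     \<bar>fst (local_quad h (f \<circ> T) u)\<bar> \<le> C1 \<and> \<bar>fst (snd (local_quad h (f \<circ> T) u))\<bar> \<le> C1 \<and>
     (\<forall>x\<in>{h..4 * h}. \<bar>quad h (local_quad h (f \<circ> T) u) x - g x\<bar> \<le> C1 * h^3)"
    using local_quad_estimate[OF K] by (elim exE conjE)
  \<comment> \<open>\<open>E\<close> is \<open>2 * C1\<close> since \<Gamma> and the local curves
    are compared twice. \<open>H\<close> leaves an offset above \<open>32 * B * C1 * h^3\<close>
    even after the shift of up to \<open>C1 * h^3\<close> from the quadratic to \<Gamma>; the two
    parts of \<open>L\<close> are the threshold of \<open>side_estimate\<close> and the room that
    \<open>offset_closer\<close> needs.\<close>
  define B E where "B = C1 + 1" and "E = 2 * C1"
  define H where "H = 32 * B * C1 + C1 + 1"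
  define L where "L = (3600 * (4 * E + 71 * B^2)^2 * B^4 + E + 1) + 16 * B * (H + C1)"
  have B: "B \<ge> 1" and E: "E \<ge> 0" using C1(1) by (simp_all add: B_def E_def)
  have H: "H \<ge> C1 + 1" using B C1(1) by (simp add: H_def)
  have HB: "0 \<le> 16 * B * (H + C1)" using B H C1(1) by (intro mult_nonneg_nonneg) auto
  have L: "3600 * (4 * E + 71 * B^2)^2 * B^4 + E + 1 \<le> L" "16 * B * (H + C1) \<le> L"
    using HB E by (simp_all add: L_def)
  have L1: "C1 < L"
  proof -
    have "1 * C1 \<le> (16 * B) * (H + C1)" using B H C1(1) by (intro mult_mono) auto
    moreover have "0 \<le> 3600 * (4 * E + 71 * B^2)^2 * B^4" by simp
    ultimately show ?thesis using E unfolding L_def by linarith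
  qed
  define h0 where "h0 = min (min 1 h1) (1 / (H + 1))"
  have h0: "h0 > 0" using C1 H by (simp add: h0_def)
  have main: "\<bar>infdist p (local_curves h f W u0) - \<sigma> * sdist p\<bar> \<le> (2 * L + C1) * h^3"
    if h: "0 < h" "h < h0" and win: "windows K h \<Gamma> \<Omega>1 \<Omega>2 W u0" and p: "p \<in> unit_square"
      and \<sigma>: "\<sigma> \<in> {-1, 1}" and os: "on_side \<sigma> h f W u0 p" for h W u0 p and \<sigma> :: real
  proof -
    define G where "G = local_curves h f W u0"
    define v where "v T = local_quad h (f \<circ> T) (u0 T)" for T
    have \<sigma>1: "\<bar>\<sigma>\<bar> = 1" using \<sigma> by auto
    have h3: "h^3 > 0" using h by simp
    have hh: "h < 1" "h < h1" "H * h < 1"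
      using h H C1(1) by (simp_all add: h0_def field_simps)
    have Hh: "H * h^3 \<le> h"
    proof -
      have "H * h^3 = (H * h) * h^2" by (simp add: power2_eq_square power3_eq_cube)
      also have "\<dots> \<le> 1 * h^2" using hh(3) by (intro mult_right_mono) auto
      also have "\<dots> \<le> h" using h hh(1) by (simp add: power2_eq_square mult_left_le)
      finally show ?thesis .
    qed
    have C1h: "C1 * h^3 \<le> 1" using Hh hh(1) mult_right_mono[of C1 H "h^3"] H h3 by linarith
    note winD = win[unfolded windows_def]
    have sec: "\<exists>g. near_section K h T g (u0 T)" if "T \<in> W" for T
      using winD[THEN conjunct1, THEN bspec, OF that] unfolding near_section_def .
    have est: "\<bar>fst (v T)\<bar> \<le> C1" "\<bar>fst (snd (v T))\<bar> \<le> C1" "x \<in> {h..4 * h} \<Longrightarrow> \<bar>quad h (v T) x - g x\<bar> \<le> C1 * h^3"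
      if "near_section K h T g (u0 T)" for T g x
      using C1(3)[rule_format, of h T g "u0 T"] that h hh(2) unfolding v_def by simp_all
    have dT: "dist (T a) (T b) = dist a b" if ws: "window_section h \<Gamma> \<Omega>1 \<Omega>2 T g" for T g a b
    proof -
      obtain A where A: "linear A" "\<And>v. norm (A v) = norm v" "\<And>p q. T q = T p + A (q - p)"
        using grid_change_isometry[OF window_sectionD(1)[OF ws]] by metis
      show ?thesis using A(3)[of a b] A(2) by (simp add: dist_norm norm_minus_commute[of a b])
    qed
    have dv: "dist (T (x, g x)) (T (x, quad h (v T) x)) \<le> C1 * h^3"
      if "near_section K h T g (u0 T)" "x \<in> {h..4 * h}" for T g x
    proof -
      have "dist (x, g x) (x, quad h (v T) x) = \<bar>quad h (v T) x - g x\<bar>" by (simp add: dist_Pair_Pair dist_real_def abs_minus_commute)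
      moreover have "window_section h \<Gamma> \<Omega>1 \<Omega>2 T g" using that(1) unfolding near_section_def by (rule conjunct1)
      ultimately show ?thesis using est(3)[OF that] dT by simp
    qed
    have GI: "T (x, quad h (v T) x) \<in> G" if "T \<in> W" "x \<in> {2 * h..3 * h}" for T x
      unfolding G_def local_curves_def v_def by (rule UN_I[OF that(1)]) (rule imageI[OF that(2)])
    have G\<Gamma>: "infdist p G \<le> infdist p \<Gamma> + C1 * h^3"
    proof (rule infdist_close)
      show "\<Gamma> \<noteq> {}" by simp
      fix z assume z: "z \<in> \<Gamma>"
      then have "z \<in> (\<Union>T\<in>W. T ` ({2*h..3*h} \<times> {h..9*h}))" by (rule subsetD[OF winD[THEN conjunct2]])
      then obtain T x y where T: "T \<in> W" "z = T (x, y)" "x \<in> {2*h..3*h}" "y \<in> {h..9*h}" by (elim UN_E imageE SigmaE) simp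
      obtain g where g: "near_section K h T g (u0 T)" using sec[OF T(1)] ..
      have ws: "window_section h \<Gamma> \<Omega>1 \<Omega>2 T g" using g unfolding near_section_def by (rule conjunct1)
      have x: "x \<in> {h..4 * h}" using T(3) h by simp
      have "(x, y) \<in> {p \<in> {h..4 * h} \<times> {h..9 * h}. T p \<in> \<Gamma>}" using x T(4) z unfolding T(2) by simp
      then have "y = g x" unfolding window_sectionD(5)[OF ws] by (elim imageE) simp
      then have "dist z (T (x, quad h (v T) x)) \<le> C1 * h^3" using dv[OF g x] T(2) by simp
      then show "\<exists>y\<in>G. dist z y \<le> C1 * h^3" using GI[OF T(1,3)] by (rule bexI)
    qed
    have \<Gamma>G: "infdist p \<Gamma> \<le> infdist p G + C1 * h^3"
    proof (rule infdist_close)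
      obtain T x where "T \<in> W" "x \<in> {2*h..3*h}"
        using os unfolding on_side_def by (elim bexE) 
      then show "G \<noteq> {}" using GI by blast
      fix z assume "z \<in> G"
      then obtain T x where T: "T \<in> W" "x \<in> {2*h..3*h}" "z = T (x, quad h (v T) x)"
        unfolding G_def local_curves_def v_def by (elim UN_E imageE) simp
      obtain g where g: "near_section K h T g (u0 T)" using sec[OF T(1)] ..
      have ws: "window_section h \<Gamma> \<Omega>1 \<Omega>2 T g" using g unfolding near_section_def by (rule conjunct1)
      have x: "x \<in> {h..4 * h}" using T(2) h by simp
      have "dist z (T (x, g x)) \<le> C1 * h^3" using dv[OF g x] unfolding T(3) by (simp add: dist_commute)
      then show "\<exists>y\<in>\<Gamma>. dist z y \<le> C1 * h^3" using window_sectionD(6)[OF ws x] by (rule bexI)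
    qed
    define D where "D = infdist p G"
    have D0: "D \<ge> 0" unfolding D_def by (rule infdist_nonneg)
    have sd: "\<bar>\<sigma> * sdist p\<bar> = infdist p \<Gamma>" using \<sigma>1 infdist_nonneg[of p \<Gamma>] by (simp add: abs_mult sdist_def)
    have "L * h^3 \<ge> 0" using L1 C1(1) h3 by simp
    have fin: "(2 * L + C1) * h^3 = 2 * (L * h^3) + C1 * h^3" by (simp add: algebra_simps)
    show ?thesis
    proof (cases "L * h^3 \<le> D")
      case False
      then have "\<bar>D - \<sigma> * sdist p\<bar> \<le> 2 * (L * h^3) + C1 * h^3"
        using \<Gamma>G sd D0 unfolding D_def[symmetric] by linarith
      then show ?thesis unfolding fin D_def G_def .
    next
      case True
      obtain T x a b where T: "T \<in> W" and x: "x \<in> {2*h..3*h}" and dist: "dist p (T (x, quad h (v T) x)) = infdist p G"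
        and ab: "p = T (a, b)" "0 \<le> \<sigma> * (b - (quad h (v T) x + deriv (quad h (v T)) x * (a - x)))"
        using os unfolding on_side_def Let_def G_def[symmetric] v_def[symmetric] by (elim bexE exE conjE)
      obtain g where g: "near_section K h T g (u0 T)" using sec[OF T] ..
      have ws: "window_section h \<Gamma> \<Omega>1 \<Omega>2 T g" using g unfolding near_section_def by (rule conjunct1)
      obtain c1 c2 c3 where c: "v T = (c1, c2, c3)" by (cases "v T")
      have cb: "\<bar>c1\<bar> \<le> B" "\<bar>c2\<bar> \<le> B" using est(1,2)[OF g] unfolding c B_def by simp_all
      have x': "x \<in> {h..4 * h}" using x h by simp
      have Dd: "D = dist (a, b) (x, quad h (c1, c2, c3) x)"
        using dist unfolding D_def ab(1) dT[OF ws] c by simp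
      have D3: "D \<le> 3"
      proof -
        have "infdist p \<Gamma> \<le> dist p (\<gamma> 0)" by (rule infdist_le) simp
        also have "\<dots> \<le> 2"
        proof -
          have "\<gamma> 0 \<in> unit_square" using inside by blast
          then have "\<bar>fst p - fst (\<gamma> 0)\<bar> \<le> 1" "\<bar>snd p - snd (\<gamma> 0)\<bar> \<le> 1" using p by (auto simp: mem_Times_iff)
          then show ?thesis using norm_Pair_le[of "fst (p - \<gamma> 0)" "snd (p - \<gamma> 0)"]
            unfolding dist_norm prod.collapse by simp
        qed
        finally show ?thesis using G\<Gamma> C1h unfolding D_def by linarith
      qed
      have big: "c * h^3 \<le> D" if "c \<le> L" for c
        using order_trans[OF mult_right_mono[OF that] True] h3 by simp
      have C1D: "C1 * h^3 < D"
      proof -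
        have "C1 * h^3 < L * h^3" using L1 h3 by simp
        then show ?thesis using True by linarith
      qed
      \<comment> \<open>The abscissa ranges over the whole window, beyond the part of the graph that
        belongs to \<open>local_curves\<close>; the comparison goes through \<Gamma>, which the
        quadratic approximates there as well.\<close>
      have near: "D - E * h^3 \<le> dist (a, b) (\<xi>, quad h (c1, c2, c3) \<xi>)" if "h \<le> \<xi>" "\<xi> \<le> 4 * h" for \<xi>
      proof -
        have \<xi>: "\<xi> \<in> {h..4 * h}" using that by simp
        have "infdist p \<Gamma> \<le> dist p (T (\<xi>, g \<xi>))" by (rule infdist_le[OF window_sectionD(6)[OF ws \<xi>]])
        also have "\<dots> \<le> dist p (T (\<xi>, quad h (v T) \<xi>)) + C1 * h^3"
          using dist_triangle[of p "T (\<xi>, g \<xi>)" "T (\<xi>, quad h (v T) \<xi>)"] dv[OF g \<xi>] by (simp add: dist_commute)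
        also have "dist p (T (\<xi>, quad h (v T) \<xi>)) = dist (a, b) (\<xi>, quad h (c1, c2, c3) \<xi>)" unfolding ab(1) dT[OF ws] c ..
        finally show ?thesis using G\<Gamma> unfolding D_def[symmetric] E_def by (simp add: algebra_simps)
      qed
      have up: "D / (16 * B) \<le> \<sigma> * (b - quad h (c1, c2, c3) x)"
      proof (rule side_estimate[OF h(1) less_imp_le[OF hh(1)] B cb E _ _ Dd D3 near \<sigma>1 _ big[OF L(1)]])
        show "0 \<le> \<sigma> * (b - (quad h (c1, c2, c3) x + (2 * c1 * x + c2) * (a - x)))"
          using ab(2) unfolding c deriv_quad .
      qed (use x in auto)
      \<comment> \<open>Measured from the quadratic, \<beta> is the offset that ends exactly
        \<open>H * h^3\<close> beyond \<open>g x\<close> in direction \<sigma>.\<close>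
      define \<beta> where "\<beta> = \<sigma> * (g x - quad h (c1, c2, c3) x) + H * h^3"
      have ss: "\<sigma> * \<sigma> = 1" using \<sigma> by auto
      have "\<bar>\<sigma> * (g x - quad h (c1, c2, c3) x)\<bar> \<le> C1 * h^3"
        using est(3)[OF g x'] \<sigma>1 unfolding c by (simp add: abs_mult abs_minus_commute)
      then have \<beta>b: "H * h^3 - C1 * h^3 \<le> \<beta>" "\<beta> \<le> H * h^3 + C1 * h^3" unfolding \<beta>_def by linarith+
      have "dist (a, b) (x, quad h (c1, c2, c3) x + \<sigma> * \<beta>) < D - C1 * h^3"
      proof (rule offset_closer[OF _ \<sigma>1 Dd up])
        have "H * h^3 - C1 * h^3 = 32 * B * (C1 * h^3) + h^3" by (simp add: H_def algebra_simps)
        then show "32 * B * (C1 * h^3) < \<beta>" using \<beta>b(1) h3 by linarith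
        have "16 * B * \<beta> \<le> 16 * B * (H * h^3 + C1 * h^3)" using \<beta>b(2) B by (intro mult_left_mono) auto
        also have "\<dots> = 16 * B * (H + C1) * h^3" by (simp add: algebra_simps)
        also have "\<dots> \<le> D" by (rule big[OF L(2)])
        finally show "16 * B * \<beta> \<le> D" .
      qed (use B C1(1) h3 C1D in auto)
      moreover have eq: "quad h (c1, c2, c3) x + \<sigma> * \<beta> = g x + \<sigma> * (H * h^3)"
        unfolding \<beta>_def distrib_left mult.assoc[symmetric] ss by simp
      moreover have "dist p (T (x, g x + \<sigma> * (H * h^3))) = dist (a, b) (x, g x + \<sigma> * (H * h^3))"
        unfolding ab(1) dT[OF ws] ..
      moreover have "D \<le> infdist p \<Gamma> + C1 * h^3" unfolding D_def by (rule G\<Gamma>)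
      ultimately have close: "dist p (T (x, g x + \<sigma> * (H * h^3))) < infdist p \<Gamma>"
        by (simp only: eq)
      have gx: "3 * h \<le> g x" "g x \<le> 7 * h" by (rule window_sectionD(3)[OF ws x'] window_sectionD(4)[OF ws x'])+
      have Hp: "0 < H * h^3" using H C1(1) h3 by simp
      have y: "g x + \<sigma> * (H * h^3) \<in> {h..9 * h}" using \<sigma> gx Hh Hp h by auto
      have "(x, g x + \<sigma> * (H * h^3)) \<in> {h..4 * h} \<times> {h..9 * h}" using x' y by (rule SigmaI)
      then have TU: "T (x, g x + \<sigma> * (H * h^3)) \<in> unit_square" by (rule window_sectionD(2)[OF ws])
      have "\<sigma> * sdist p = infdist p \<Gamma>"
      proof (cases "\<sigma> = 1")
        case True
        then have "T (x, g x + \<sigma> * (H * h^3)) \<in> \<Omega>2" using Hp by (intro window_sectionD(8)[OF ws x' y]) simp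
        then have "p \<in> \<Omega>2" using same_side(2)[OF p TU close] by blast
        then show ?thesis using True by (simp add: sdist_def)
      next
        case False
        then have m: "\<sigma> = -1" using \<sigma> by blast
        then have "T (x, g x + \<sigma> * (H * h^3)) \<in> \<Omega>1" using Hp by (intro window_sectionD(7)[OF ws x' y]) simp
        then have "p \<in> \<Omega>1" using same_side(1)[OF p TU close] by blast
        then have "p \<notin> \<Omega>2" using \<Omega>2 by blast
        then show ?thesis using m by (simp add: sdist_def)
      qed
      then have "\<bar>D - \<sigma> * sdist p\<bar> \<le> 2 * (L * h^3) + C1 * h^3"
        using G\<Gamma> \<Gamma>G \<open>L * h^3 \<ge> 0\<close> unfolding D_def by linarith
      then show ?thesis unfolding fin D_def G_def .
    qed
  qed
  have C: "2 * L + C1 \<ge> 0" using L1 C1(1) by simp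
  show ?thesis
    by (rule exI[of _ "2 * L + C1"], rule exI[of _ h0], rule conjI[OF C], rule conjI[OF h0], intro allI impI ballI, elim conjE)
       (rule main)
qed

end

section \<open>The global error bound\<close>

theorem corollary4p4:
  fixes f f1 f2 :: "real \<times> real \<Rightarrow> real"
    and \<Omega>1 \<Omega>2 \<Gamma> :: "(real \<times> real) set"
    and \<gamma> :: "real \<Rightarrow> real \<times> real"
    and \<epsilon> \<delta> R len K c1 c2 \<beta> :: real
    and A :: "nat \<Rightarrow> (real \<times> real \<Rightarrow> real) \<Rightarrow> real \<times> real \<Rightarrow> real"
  assumes "\<epsilon> > 0"
    and "Ck_on 4 ({-\<epsilon>..1+\<epsilon>} \<times> {-\<epsilon>..1+\<epsilon>}) f1"
    and "Ck_on 4 ({-\<epsilon>..1+\<epsilon>} \<times> {-\<epsilon>..1+\<epsilon>}) f2"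
    and "\<Omega>1 \<subseteq> unit_square"
    and "\<Omega>2 = unit_square - \<Omega>1"
    and "\<forall>p\<in>\<Omega>1. f p = f1 p"
    and "\<forall>p\<in>\<Omega>2. f p = f2 p"
    and "\<delta> > 0"
    and "\<forall>p\<in>\<Gamma>. \<bar>f1 p - f2 p\<bar> \<ge> \<delta>"
    and "C4_closed_curve len \<gamma>"
    and "\<Gamma> = range \<gamma>"
    and "\<Gamma> \<subseteq> unit_square"
    and "components (unit_square - \<Gamma>) = {\<Omega>1 - \<Gamma>, \<Omega>2 - \<Gamma>}"
    and "R > 0"
    and "curvature_radius_gt R \<gamma>"
    and "embedded_tube R len \<gamma>"
    and "{p. infdist p \<Gamma> < R} \<inter> frontier unit_square = {}"
    and "c1 > 0" and "c2 > 0"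
    and "quasi_interpolation \<beta> A"
  shows "\<exists>C N0. \<forall>N\<ge>N0. \<forall>h W u\<^sub>0 n Q1 Q2.
           h = 1 / real N \<and>
           windows K h \<Gamma> \<Omega>1 \<Omega>2 W u\<^sub>0 \<and>
           c1 * h powr (-3/4) \<le> real n \<and> real n \<le> c2 * h powr (-3/4) \<and>
           Q1 \<union> Q2 = mesh n \<and> Q1 \<inter> Q2 = {} \<and>
           separated h f W u\<^sub>0 Q1 Q2
           \<longrightarrow> hausdorff_dist \<Gamma>
                 (zero_level (A n (signed_values (local_curves h f W u\<^sub>0) Q1)))
               \<le> ennreal (C * h^3)"
proof -
  interpret interface_spline \<gamma> len R \<Omega>1 \<Omega>2 \<beta> A
    using assms by unfold_locales (simp_all only:)
  interpret interface_problem \<gamma> len R \<Omega>1 \<Omega>2 f f1 f2 \<epsilon> \<delta>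
    using assms by unfold_locales (simp_all only:)
  have \<Gamma>: "\<Gamma> = range \<gamma>" by fact
  have c1: "c1 > 0" by fact
  obtain C h1 where C: "C \<ge> 0" "h1 > 0" "\<forall>h W u0. 0 < h \<and> h < h1 \<and> windows \<bar>K\<bar> h (range \<gamma>) \<Omega>1 \<Omega>2 W u0 \<longrightarrow>
     (\<forall>p\<in>unit_square. \<forall>\<sigma>\<in>{-1, 1}. on_side \<sigma> h f W u0 p \<longrightarrow>
        \<bar>infdist p (local_curves h f W u0) - \<sigma> * sdist p\<bar> \<le> C * h^3)"
    using side_error[OF abs_ge_zero[of K]] by (elim exE conjE)
  obtain C' h2 where C': "h2 > 0" "\<forall>h n v \<tau> p1 p2. 0 < h \<and> h < h2 \<and> c1 * h powr (-3/4) \<le> real n \<and> \<bar>\<tau>\<bar> = 1 \<and>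
     p1 \<in> \<Omega>1 - range \<gamma> \<and> infdist p1 (range \<gamma>) < R \<and> p2 \<in> \<Omega>2 - range \<gamma> \<and> infdist p2 (range \<gamma>) < R \<and>
     (\<forall>q\<in>mesh n. \<bar>v q - \<tau> * sdist q\<bar> \<le> C * h^3)
     \<longrightarrow> hausdorff_dist (range \<gamma>) (zero_level (A n v)) \<le> ennreal (C' * h^3)"
    using zero_level_estimate[OF c1 C(1)] by (elim exE conjE)
  \<comment> \<open>The bound by \<open>R\<close> puts the two witnesses, at distance at most
    \<open>h\<close> from \<Gamma>, inside the tube.\<close>
  define h0 where "h0 = min (min h1 h2) R"
  have h0: "h0 > 0" using C(2) C'(1) R by (simp add: h0_def)
  obtain N0 :: nat where N0: "1 / h0 < real N0" using reals_Archimedean2 by blast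
  have main: "hausdorff_dist (range \<gamma>) (zero_level (A n (signed_values (local_curves h f W u0) Q1))) \<le> ennreal (C' * h^3)"
    if N: "N \<ge> N0" and hN: "h = 1 / real N" and win: "windows K h (range \<gamma>) \<Omega>1 \<Omega>2 W u0"
      and n: "c1 * h powr (-3/4) \<le> real n" and Q: "Q1 \<union> Q2 = mesh n" "Q1 \<inter> Q2 = {}" and sep: "separated h f W u0 Q1 Q2"
    for N h W u0 n Q1 Q2
  proof -
    let ?G = "local_curves h f W u0"
    have N': "1 / h0 < real N" using N0 N by (meson less_le_trans of_nat_le_iff)
    then have Npos: "0 < real N" using h0 by (meson divide_pos_pos less_trans zero_less_one)
    have h: "0 < h" "h < h0" unfolding hN using N' Npos h0 by (simp_all add: field_simps)
    have hh: "h < h1" "h < h2" "h < R" using h(2) by (simp_all add: h0_def)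
    note winD = win[unfolded windows_def]
    \<comment> \<open>\<open>K\<close> may be negative; passing to its absolute value weakens the
      accuracy requirement and meets the sign condition of \<open>side_error\<close>.\<close>
    have win': "windows \<bar>K\<bar> h (range \<gamma>) \<Omega>1 \<Omega>2 W u0"
      unfolding windows_def
    proof (intro conjI ballI)
      fix T assume T: "T \<in> W"
      obtain g where g: "window_section h (range \<gamma>) \<Omega>1 \<Omega>2 T g" "\<forall>x\<in>{h..4 * h}. \<bar>quad h (u0 T) x - g x\<bar> \<le> K * h^3"
        using winD[THEN conjunct1, THEN bspec, OF T] by (elim exE conjE)
      have "K * h^3 \<le> \<bar>K\<bar> * h^3" using h by (intro mult_right_mono) auto
      then show "\<exists>g. window_section h (range \<gamma>) \<Omega>1 \<Omega>2 T g \<and> (\<forall>x\<in>{h..4 * h}. \<bar>quad h (u0 T) x - g x\<bar> \<le> \<bar>K\<bar> * h^3)"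
        using g by (intro exI[of _ g] conjI ballI) (auto intro: order_trans)
    qed (rule winD[THEN conjunct2])
    have err: "\<bar>infdist p ?G - \<sigma> * sdist p\<bar> \<le> C * h^3"
      if "p \<in> unit_square" "\<sigma> \<in> {-1, 1}" "on_side \<sigma> h f W u0 p" for p \<sigma>
      by (rule C(3)[rule_format, OF conjI[OF h(1) conjI[OF hh(1) win']] that])
    \<comment> \<open>The labelling of the two mesh sets is free up to a global sign \<tau>, to
      which the zero level is insensitive.\<close>
    obtain \<tau> where \<tau>: "\<tau> \<in> {-1, 1}" and Q1: "\<forall>p\<in>Q1. on_side \<tau> h f W u0 p" and Q2: "\<forall>p\<in>Q2. on_side (- \<tau>) h f W u0 p"
      using sep unfolding separated_def by (elim bexE conjE)
    have \<tau>1: "\<bar>\<tau>\<bar> = 1" and m\<tau>: "- \<tau> \<in> {-1, 1}" using \<tau> by auto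
    have val: "\<bar>signed_values ?G Q1 q - \<tau> * sdist q\<bar> \<le> C * h^3" if q: "q \<in> mesh n" for q
    proof (cases "q \<in> Q1")
      case True
      then show ?thesis using err[OF subsetD[OF mesh_subset q] \<tau> Q1[THEN bspec, OF True]] by (simp add: signed_values_def)
    next
      case False
      then have "q \<in> Q2" using q Q(1) by blast
      then have "\<bar>infdist q ?G - - \<tau> * sdist q\<bar> \<le> C * h^3" by (intro err[OF subsetD[OF mesh_subset q] m\<tau>] Q2[THEN bspec])
      then show ?thesis using False by (simp add: signed_values_def abs_le_iff)
    qed
    \<comment> \<open>The curve is nonempty, so there is a window; the points at height
      \<open>h\<close> below and above its section over \<open>2 * h\<close> witness both sides of
      the tube.\<close>
    have "\<gamma> 0 \<in> (\<Union>T\<in>W. T ` ({2*h..3*h} \<times> {h..9*h}))" by (rule subsetD[OF winD[THEN conjunct2]]) simp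
    then obtain T where T: "T \<in> W" by (elim UN_E)
    obtain g where ws: "window_section h (range \<gamma>) \<Omega>1 \<Omega>2 T g"
      using winD[THEN conjunct1, THEN bspec, OF T] by (elim exE conjE)
    note w = window_sectionD[OF ws]
    obtain A' where A': "\<And>v. norm (A' v) = norm v" "\<And>p q. T q = T p + A' (q - p)"
      using grid_change_isometry[OF w(1)] by metis
    have x: "2 * h \<in> {h..4 * h}" using h by simp
    have y: "g (2 * h) + \<sigma> * h \<in> {h..9 * h}" if "\<sigma> \<in> {-1, 1}" for \<sigma> using that w(3,4)[OF x] h by auto
    have near: "T (2 * h, g (2 * h) + \<sigma> * h) \<notin> range \<gamma> \<and> infdist (T (2 * h, g (2 * h) + \<sigma> * h)) (range \<gamma>) < R"
      if \<sigma>: "\<sigma> \<in> {-1, 1}" for \<sigma>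
    proof
      show "T (2 * h, g (2 * h) + \<sigma> * h) \<notin> range \<gamma>"
      proof
        assume "T (2 * h, g (2 * h) + \<sigma> * h) \<in> range \<gamma>"
        then have "(2 * h, g (2 * h) + \<sigma> * h) \<in> {p \<in> {h..4 * h} \<times> {h..9 * h}. T p \<in> range \<gamma>}" using x y[OF \<sigma>] by simp
        then have "\<sigma> * h = 0" unfolding w(5) by (elim imageE) simp
        then show False using h \<sigma> by auto
      qed
      have "infdist (T (2 * h, g (2 * h) + \<sigma> * h)) (range \<gamma>) \<le> dist (T (2 * h, g (2 * h) + \<sigma> * h)) (T (2 * h, g (2 * h)))"
        by (rule infdist_le[OF w(6)[OF x]])
      also have "\<dots> = norm (0::real, - (\<sigma> * h))"
        unfolding dist_norm norm_minus_commute[of "T (2 * h, g (2 * h) + \<sigma> * h)"] A'(2)[of "(2 * h, g (2 * h))" "(2 * h, g (2 * h) + \<sigma> * h)"]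
        using A'(1) by simp
      also have "\<dots> = h" using \<sigma> h by auto
      finally show "infdist (T (2 * h, g (2 * h) + \<sigma> * h)) (range \<gamma>) < R" using hh(3) by simp
    qed
    define p1 p2 where "p1 = T (2 * h, g (2 * h) + -1 * h)" and "p2 = T (2 * h, g (2 * h) + 1 * h)"
    have "p1 \<in> \<Omega>1" unfolding p1_def by (rule w(7)[OF x y]) (use h in auto)
    moreover have "p2 \<in> \<Omega>2" unfolding p2_def by (rule w(8)[OF x y]) (use h in auto)
    ultimately have p: "p1 \<in> \<Omega>1 - range \<gamma>" "infdist p1 (range \<gamma>) < R" "p2 \<in> \<Omega>2 - range \<gamma>" "infdist p2 (range \<gamma>) < R"
      using near[of "-1"] near[of 1] unfolding p1_def p2_def by auto
    show ?thesis
      by (rule C'(2)[rule_format, of h n \<tau> p1 p2], intro conjI ballI) (use h hh n \<tau>1 p val in auto)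
  qed
  show ?thesis
    unfolding \<Gamma> by (rule exI[of _ C'], rule exI[of _ N0], intro allI impI, elim conjE) (rule main)
qed

end
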